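(* Let $\nu$ be a Lévy measure on $\mathbb{R}^d_0$ with $\nu(\mathbb{R}^d_0)=+\infty$ admitting the shot noise decomposition $\nu(B)=\int_{0+}^{+\infty}\mathbb{P}(H(r,U)\in B)\,dr$, $B\in\mathcal{B}(\mathbb{R}^d_0)$, where $r\mapsto\|H(r,u)\|$ is nonincreasing for every $u$. Let $f$ be a kernel on $[0,T]\times\mathcal{T}$ and let $Q_t(m)$ and $R_t(m,n)$ be the associated error processes, as defined in the context. Suppose that: (a) $\operatorname{ess\,sup}_{s\in\mathcal{T}}\|f(t,s)\|<+\infty$ for every $t\in[0,T]$; (b) $\int_{\mathcal{T}}\|f(t,s)\|^2\,ds<+\infty$ for every $t\in[0,T]$; (c) $\lim_{m\to+\infty}\int_m^{+\infty}\int_\Omega\|H(r,U(\omega))\|^2\,\mathbb{P}(d\omega)\,dr=0$. Then $\{Q_t(m):t\in[0,T]\}$ and $\{R_t(m,n):t\in[0,T]\}$ converge to degenerate zero processes on $[0,T]$ in the sense of finite dimensional distributions as $m\wedge n\to+\infty$.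
   Context: Fix a probability space $(\Omega,\mathscr{F},\mathbb{P})$, $d\in\mathbb{N}$, $T>0$, and an interval $\mathcal{T}\subseteq\mathbb{R}$ of time indices. Write $\mathbb{R}^d_0=\mathbb{R}^d\setminus\{0\}$ and let $\mathrm{Leb}$ denote Lebesgue measure. A Lévy measure $\nu$ is a measure on $\mathbb{R}^d_0$ with $\int_{\mathbb{R}^d_0}(1\wedge\|\mathbf{z}\|^2)\,\nu(d\mathbf{z})<+\infty$. Shot noise decomposition and truncation: $U$ is a random vector in some space $\mathscr{U}$, and $H:(0,+\infty)\times\mathscr{U}\to\mathbb{R}^d$ is measurable. For $m\in\mathbb{N}$ define the finite Lévy measure $$\nu_m(B)=\int_{0+}^m\mathbb{P}(H(r,U)\in B)\,dr,\qquad B\in\mathcal{B}(\mathbb{R}^d_0),$$ with $\nu_m(\mathbb{R}^d_0)=m$. Thus $(\nu-\nu_m)(B)=\int_m^{+\infty}\mathbb{P}(H(r,U)\in B)\,dr$. Kernel: $f$ is a measurable deterministic mapping on $[0,T]\times\mathcal{T}$ with values in $\mathbb{R}^{d\times d}$ (a scalar kernel being identified with a multiple of the identity matrix). Process: $\{L_s:s\in\mathcal{T}\}$ is a Lévy process in $\mathbb{R}^d$ without Gaussian component and with Lévy measure $\nu$; $\mu(d\mathbf{z},ds)$ is its associated Poisson random measure on $\mathbb{R}^d_0\times\mathcal{T}$ with compensator $\nu(d\mathbf{z})ds$; and $$X_t=\int_{\mathcal{T}}f(t,s)\,dL_s=\int_{\mathcal{T}}\int_{\mathbb{R}^d_0}f(t,s)\mathbf{z}\,\bigl(\mu-\nu\mathbbm{1}_{(0,1]}(\|\mathbf{z}\|)\bigr)(d\mathbf{z},ds),\qquad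 t\in[0,T].$$ Here $\nu\mathbbm{1}_{(0,1]}(\|\mathbf{z}\|)$ stands for $\mathbbm{1}_{(0,1]}(\|\mathbf{z}\|)\nu(d\mathbf{z})ds$, and similarly below. These stochastic integrals are assumed to be well defined. The Poisson random measure splits as $\mu=\mu_m+(\mu-\mu_m)$, where $\mu_m$ and $\mu-\mu_m$ are independent Poisson random measures with intensities $\nu_m(d\mathbf{z})ds$ and $(\nu-\nu_m)(d\mathbf{z})ds$, respectively. Time truncation: $\{\mathcal{T}_n\}_{n\in\mathbb{N}}$ is a nondecreasing sequence of connected open intervals with $\bigcup_n\mathcal{T}_n=\mathcal{T}$ and $\mathrm{Leb}(\mathcal{T}_n)<+\infty$ (if $\mathrm{Leb}(\mathcal{T})<+\infty$ one may take $\mathcal{T}_n\equiv\mathcal{T}$, in which case $R_t(m,n)$ vanishes). Error processes: for $t\in[0,T]$, $$Q_t(m)=\int_{\mathcal{T}}\int_{\mathbb{R}^d_0}f(t,s)\mathbf{z}\,\bigl((\mu-\mu_m)-(\nu-\nu_m)\mathbbm{1}_{(0,1]}(\|\mathbf{z}\|)\bigr)(d\mathbf{z},ds),$$ $$R_t(m,n)=\int_{\mathcal{T}\setminus\mathcal{T}_n}\int_{\mathbb{R}^d_0}f(t,s)\mathbf{z}\,\bigl(\mu_m-\nu_m\mathbbm{1}_{(0,1]}(\|\mathbf{z}\|)\bigr)(d\mathbf{z},ds).$$ *)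

theory Defs
  imports "HOL-Probability.Probability"
begin

abbreviation punctured_borel :: "('a::real_normed_vector) measure" where
  "punctured_borel \<equiv> restrict_space borel (- {0})"

definition levy_measure :: "('a::euclidean_space) measure \<Rightarrow> bool" where
  "levy_measure \<nu> \<longleftrightarrow> sets \<nu> = sets punctured_borel \<and>
     (\<integral>\<^sup>+ z. ennreal (min 1 ((norm z)\<^sup>2)) \<partial>\<nu>) < \<infinity>"

text \<open>
  The measure \<open>B \<mapsto> \<integral>\<^sub>I P(H(r,U) \<in> B) dr\<close>. The full range \<open>{0<..}\<close> of \<open>r\<close> gives \<open>\<nu>\<close>, the range
  \<open>{0<..m}\<close> gives \<open>\<nu>\<^sub>m\<close> and \<open>{m<..}\<close> gives \<open>\<nu> - \<nu>\<^sub>m\<close>; the latter is introduced directly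
  because subtraction of infinite measures is not meaningful setwise.
\<close>
definition shot_noise_measure ::
    "'w measure \<Rightarrow> (real \<Rightarrow> 'u \<Rightarrow> 'a::euclidean_space) \<Rightarrow> ('w \<Rightarrow> 'u) \<Rightarrow> real set \<Rightarrow> 'a measure" where
  "shot_noise_measure M H U I = measure_of (- {0}) (sets punctured_borel)
     (\<lambda>B. \<integral>\<^sup>+ r \<in> I. emeasure M {\<omega> \<in> space M. H r (U \<omega>) \<in> B} \<partial>lborel)"

lemma sets_shot_noise_measure:
  fixes H :: "real \<Rightarrow> 'u \<Rightarrow> 'a::euclidean_space"
  shows "sets (shot_noise_measure M H U I) = sets punctured_borel"
proof -
  have "sets punctured_borel \<subseteq> Pow (- {0::'a})"
    using sets.sets_into_space[of _ "punctured_borel :: 'a measure"] by (auto simp: space_restrict_space)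
  then show ?thesis
    unfolding shot_noise_measure_def
    using sets.sigma_sets_eq[of "punctured_borel :: 'a measure"] by (simp add: space_restrict_space)
qed

lemma emeasure_shot_noise_measure:
  fixes H :: "real \<Rightarrow> 'u \<Rightarrow> 'a::euclidean_space"
  assumes M: "prob_space M" and U: "U \<in> M \<rightarrow>\<^sub>M S"
    and H: "(\<lambda>(r, u). H r u) \<in> (restrict_space borel {0<..} \<Otimes>\<^sub>M S) \<rightarrow>\<^sub>M borel"
    and I: "I \<in> sets borel" "I \<subseteq> {0<..}" and B: "B \<in> sets punctured_borel"
  shows "emeasure (shot_noise_measure M H U I) B =
    (\<integral>\<^sup>+ r \<in> I. emeasure M {\<omega> \<in> space M. H r (U \<omega>) \<in> B} \<partial>lborel)"
proof -
  interpret prob_space M by fact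
  let ?p = "\<lambda>B r. emeasure M {\<omega> \<in> space M. H r (U \<omega>) \<in> B}"
  have Bb: "B \<in> sets borel" if "B \<in> sets (punctured_borel :: 'a measure)" for B
    using that by (auto simp: sets_restrict_space_iff)
  have HU: "(\<lambda>(r, \<omega>). H r (U \<omega>)) \<in> (restrict_space borel {0<..} \<Otimes>\<^sub>M M) \<rightarrow>\<^sub>M borel"
  proof -
    have "(\<lambda>x. (fst x, U (snd x))) \<in>
        (restrict_space borel {0<..} \<Otimes>\<^sub>M M) \<rightarrow>\<^sub>M (restrict_space borel {0<..} \<Otimes>\<^sub>M S)"
      using U by measurable
    from measurable_compose[OF this H] show ?thesis by (simp add: case_prod_beta)
  qed
  have ev: "{\<omega> \<in> space M. H r (U \<omega>) \<in> B} \<in> sets M" if "B \<in> sets borel" "r > 0" for B r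
  proof -
    have "(\<lambda>\<omega>. H r (U \<omega>)) \<in> M \<rightarrow>\<^sub>M borel"
      using measurable_compose[OF measurable_Pair1' HU, of r] that by (simp add: space_restrict_space)
    from measurable_sets[OF this that(1)] show ?thesis
      by (simp add: vimage_def Int_def conj_commute)
  qed
  have meas: "(\<lambda>r. ?p B r * indicator I r) \<in> borel_measurable lborel" if "B \<in> sets borel" for B
  proof -
    let ?A = "(\<lambda>(r, \<omega>). H r (U \<omega>)) -` B \<inter> space (restrict_space borel {0<..} \<Otimes>\<^sub>M M)"
    have "?A \<in> sets (restrict_space borel {0<..} \<Otimes>\<^sub>M M)"
      by (rule measurable_sets[OF HU that])
    from measurable_emeasure_Pair[OF this]
    have "(\<lambda>r. emeasure M (Pair r -` ?A)) \<in> borel_measurable (restrict_space borel {0<..})" .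
    moreover have "Pair r -` ?A = {\<omega> \<in> space M. H r (U \<omega>) \<in> B}" if "r > 0" for r
      using that by (auto simp: space_pair_measure space_restrict_space)
    ultimately have "?p B \<in> borel_measurable (restrict_space borel {0<..})"
      by (subst measurable_cong[where g = "\<lambda>r. emeasure M (Pair r -` ?A)"])
         (auto simp: space_restrict_space)
    then have 1: "(\<lambda>r. ?p B r * indicator {0<..} r) \<in> borel_measurable borel"
      by (subst (asm) borel_measurable_restrict_space_iff_ennreal) auto
    have "(\<lambda>r. (?p B r * indicator {0<..} r) * indicator I r) \<in> borel_measurable borel"
      using 1 I(1) by measurable
    moreover have "(\<lambda>r. (?p B r * indicator {0<..} r) * indicator I r) = (\<lambda>r. ?p B r * indicator I r)"
      using I(2) by (auto simp: fun_eq_iff indicator_def)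
    ultimately show ?thesis by simp
  qed
  show ?thesis
  proof (rule emeasure_measure_of[OF shot_noise_measure_def])
    show "sets punctured_borel \<subseteq> Pow (- {0::'a})"
      using sets.sets_into_space[of _ "punctured_borel :: 'a measure"]
      by (auto simp: space_restrict_space)
    show "B \<in> sets (shot_noise_measure M H U I)"
      using B by (simp add: sets_shot_noise_measure)
    show "positive (sets (shot_noise_measure M H U I)) (\<lambda>B. \<integral>\<^sup>+ r \<in> I. ?p B r \<partial>lborel)"
      by (simp add: positive_def)
    show "countably_additive (sets (shot_noise_measure M H U I)) (\<lambda>B. \<integral>\<^sup>+ r \<in> I. ?p B r \<partial>lborel)"
    proof (rule countably_additiveI)
      fix A :: "nat \<Rightarrow> 'a set"
      assume A: "range A \<subseteq> sets (shot_noise_measure M H U I)" "disjoint_family A"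
      then have Ab: "A i \<in> sets borel" for i
        using Bb by (auto simp: sets_shot_noise_measure)
      have eq: "?p (\<Union>i. A i) r * indicator I r = (\<Sum>i. ?p (A i) r * indicator I r)" for r
      proof (cases "r \<in> I")
        case True
        then have r: "r > 0" using I by auto
        have "{\<omega> \<in> space M. H r (U \<omega>) \<in> (\<Union>i. A i)} = (\<Union>i. {\<omega> \<in> space M. H r (U \<omega>) \<in> A i})"
          by auto
        moreover have "(\<Sum>i. ?p (A i) r) = emeasure M (\<Union>i. {\<omega> \<in> space M. H r (U \<omega>) \<in> A i})"
          using A(2) ev[OF Ab r] by (intro suminf_emeasure) (auto simp: disjoint_family_on_def)
        ultimately show ?thesis using True by simp
      qed simp
      show "(\<Sum>i. \<integral>\<^sup>+ r \<in> I. ?p (A i) r \<partial>lborel) = (\<integral>\<^sup>+ r \<in> I. ?p (\<Union>i. A i) r \<partial>lborel)"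
        unfolding eq by (rule nn_integral_suminf[symmetric]) (rule meas[OF Ab])
    qed
  qed
qed

text \<open>
  \<open>Q\<close> below is a random measure: every \<open>Q \<omega>\<close> is a measure on the same measurable space as the
  intensity \<open>\<Lambda>\<close>. The Poisson weights are written out because \<open>poisson_pmf\<close> is restricted to
  positive rates, whereas \<open>\<Lambda>(B) = 0\<close> has to be allowed.
\<close>
definition poisson_random_measure :: "'w measure \<Rightarrow> ('w \<Rightarrow> 'e measure) \<Rightarrow> 'e measure \<Rightarrow> bool" where
  "poisson_random_measure M Q \<Lambda> \<longleftrightarrow>
     (\<forall>\<omega>\<in>space M. sets (Q \<omega>) = sets \<Lambda>) \<and>
     (\<forall>B\<in>sets \<Lambda>. (\<lambda>\<omega>. emeasure (Q \<omega>) B) \<in> borel_measurable M) \<and>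
     (\<forall>B\<in>sets \<Lambda>. emeasure \<Lambda> B < \<infinity> \<longrightarrow>
        (\<forall>k::nat. measure M {\<omega>\<in>space M. emeasure (Q \<omega>) B = of_nat k} =
           measure \<Lambda> B ^ k / fact k * exp (- measure \<Lambda> B))) \<and>
     (\<forall>B\<in>sets \<Lambda>. emeasure \<Lambda> B = \<infinity> \<longrightarrow> (AE \<omega> in M. emeasure (Q \<omega>) B = \<infinity>)) \<and>
     (\<forall>(J::nat set) B. finite J \<longrightarrow> (\<forall>i\<in>J. B i \<in> sets \<Lambda>) \<longrightarrow> disjoint_family_on B J \<longrightarrow>
        prob_space.indep_vars M (\<lambda>_. borel) (\<lambda>i \<omega>. emeasure (Q \<omega>) (B i)) J)"

definition indep_random_measures ::
    "'w measure \<Rightarrow> 'e measure \<Rightarrow> ('w \<Rightarrow> 'e measure) \<Rightarrow> ('w \<Rightarrow> 'e measure) \<Rightarrow> bool" where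
  "indep_random_measures M E Q Q' \<longleftrightarrow>
     prob_space.indep_var M
       (PiM (sets E) (\<lambda>_. borel)) (\<lambda>\<omega>. \<lambda>B\<in>sets E. emeasure (Q \<omega>) B)
       (PiM (sets E) (\<lambda>_. borel)) (\<lambda>\<omega>. \<lambda>B\<in>sets E. emeasure (Q' \<omega>) B)"

definition time_intensity :: "('a::euclidean_space) measure \<Rightarrow> real set \<Rightarrow> ('a \<times> real) measure" where
  "time_intensity \<nu> \<T> = \<nu> \<Otimes>\<^sub>M restrict_space lborel \<T>"

definition levy_process ::
    "'w measure \<Rightarrow> real set \<Rightarrow> (real \<Rightarrow> 'w \<Rightarrow> 'a::euclidean_space) \<Rightarrow> bool" where
  "levy_process M \<T> L \<longleftrightarrow>
     (\<forall>s\<in>\<T>. L s \<in> borel_measurable M) \<and>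
     (0 \<in> \<T> \<longrightarrow> (AE \<omega> in M. L 0 \<omega> = 0)) \<and>
     (\<forall>(k::nat) \<tau>. \<tau> ` {..k} \<subseteq> \<T> \<longrightarrow> strict_mono_on {..k} \<tau> \<longrightarrow>
        prob_space.indep_vars M (\<lambda>_. borel) (\<lambda>i \<omega>. L (\<tau> (Suc i)) \<omega> - L (\<tau> i) \<omega>) {..<k}) \<and>
     (\<forall>r s h. r \<in> \<T> \<longrightarrow> r + h \<in> \<T> \<longrightarrow> s \<in> \<T> \<longrightarrow> s + h \<in> \<T> \<longrightarrow>
        distr M borel (\<lambda>\<omega>. L (r + h) \<omega> - L r \<omega>) = distr M borel (\<lambda>\<omega>. L (s + h) \<omega> - L s \<omega>)) \<and>
     (AE \<omega> in M. \<forall>s\<in>\<T>. continuous (at s within \<T> \<inter> {s..}) (\<lambda>r. L r \<omega>) \<and>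
        (\<exists>l. ((\<lambda>r. L r \<omega>) \<longlongrightarrow> l) (at s within \<T> \<inter> {..<s})))"

text \<open>
  Levy-Khintchine formula without Gaussian component. The drift belonging to the truncation
  \<open>\<one>(\<parallel>z\<parallel> \<le> 1)\<close> is zero, in accordance with \<open>\<integral> f dL = \<integral>\<integral> f(s) z (\<mu> - \<nu> \<one>(\<parallel>z\<parallel> \<le> 1))(dz,ds)\<close>.
\<close>
definition levy_khintchine ::
    "'w measure \<Rightarrow> real set \<Rightarrow> (real \<Rightarrow> 'w \<Rightarrow> 'a::euclidean_space) \<Rightarrow> 'a measure \<Rightarrow> bool" where
  "levy_khintchine M \<T> L \<nu> \<longleftrightarrow>
     (\<forall>r s u. r \<in> \<T> \<longrightarrow> s \<in> \<T> \<longrightarrow> r < s \<longrightarrow>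
        (LINT \<omega>|M. iexp (u \<bullet> (L s \<omega> - L r \<omega>))) =
        exp (complex_of_real (s - r) *
          (LINT z|\<nu>. iexp (u \<bullet> z) - 1 - \<i> * complex_of_real (indicator {z. norm z \<le> 1} z * (u \<bullet> z)))))"

text \<open>
  \<open>\<mu>\<close> counts the jumps of \<open>L\<close>. A left endpoint of \<open>\<T>\<close> is excluded since there is no left limit.
\<close>
definition jump_measure_of ::
    "'w measure \<Rightarrow> real set \<Rightarrow> (real \<Rightarrow> 'w \<Rightarrow> 'a::euclidean_space) \<Rightarrow> ('w \<Rightarrow> ('a \<times> real) measure) \<Rightarrow> bool" where
  "jump_measure_of M \<T> L \<mu> \<longleftrightarrow>
     (AE \<omega> in M. \<forall>B \<in> sets (punctured_borel \<Otimes>\<^sub>M restrict_space lborel \<T>).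
        emeasure (\<mu> \<omega>) B = emeasure (count_space UNIV)
          {s\<in>\<T>. (\<exists>r\<in>\<T>. r < s) \<and>
             (L s \<omega> - Lim (at s within \<T> \<inter> {..<s}) (\<lambda>r. L r \<omega>), s) \<in> B})"

definition converges_in_probability ::
    "'w measure \<Rightarrow> (nat \<Rightarrow> 'w \<Rightarrow> 'a::metric_space) \<Rightarrow> ('w \<Rightarrow> 'a) \<Rightarrow> bool" where
  "converges_in_probability M Y Z \<longleftrightarrow>
     (\<forall>e>0. (\<lambda>j. measure M {\<omega>\<in>space M. dist (Y j \<omega>) (Z \<omega>) > e}) \<longlonglongrightarrow> 0)"

text \<open>
  \<open>levy_integral M \<T> Q \<nu> A g Z\<close> says that the stochastic integral
  \<open>\<integral>\<^sub>A \<integral> g(s) z (Q - \<nu> \<one>(\<parallel>z\<parallel> \<le> 1))(dz,ds)\<close> is well defined and equal to \<open>Z\<close>, for a Poisson random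
  measure \<open>Q\<close> on \<open>(- {0}) \<times> \<T>\<close> with intensity \<open>\<nu>(dz) ds\<close> and \<open>A \<subseteq> \<T>\<close>. On
  \<open>{\<parallel>z\<parallel> > \<epsilon>} \<times> E\<close> with \<open>E\<close> of finite Lebesgue measure, both parts are ordinary Lebesgue integrals
  for kernels that are locally integrable in time.
  As usual for infinite activity, small jumps are added by letting \<open>\<epsilon>\<close> tend to \<open>0\<close>, in
  probability. Requiring the same limit for every exhaustion of \<open>A\<close> makes the
  integral unconditional in time, so the notion does not depend on a particular time truncation; the
  cutoff in \<open>z\<close> stays rotationally symmetric, so the compensator is integrated over \<open>z\<close> first.
\<close>
definition truncated_levy_integral ::
    "real set \<Rightarrow> ('w \<Rightarrow> ((real^'d) \<times> real) measure) \<Rightarrow> (real^'d) measure \<Rightarrow> (real \<Rightarrow> real^'d^'d) \<Rightarrow>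
      real \<Rightarrow> real set \<Rightarrow> 'w \<Rightarrow> real^'d" where
  "truncated_levy_integral \<T> Q \<nu> g \<epsilon> E \<omega> =
     (LINT (z, s) : {z. \<epsilon> < norm z} \<times> E | Q \<omega>. g s *v z) -
     (LINT (z, s) : {z. \<epsilon> < norm z \<and> norm z \<le> 1} \<times> E | time_intensity \<nu> \<T>. g s *v z)"

definition levy_integral ::
    "'w measure \<Rightarrow> real set \<Rightarrow> ('w \<Rightarrow> ((real^'d) \<times> real) measure) \<Rightarrow> (real^'d) measure \<Rightarrow>
      real set \<Rightarrow> (real \<Rightarrow> real^'d^'d) \<Rightarrow> ('w \<Rightarrow> real^'d) \<Rightarrow> bool" where
  "levy_integral M \<T> Q \<nu> A g Z \<longleftrightarrow>
     Z \<in> borel_measurable M \<and>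
     (\<forall>E \<epsilon>. (\<forall>j. E j \<in> sets borel \<and> emeasure lborel (E j) < \<infinity>) \<longrightarrow> incseq E \<longrightarrow> (\<Union>j. E j) = A \<longrightarrow>
        (\<forall>j. 0 < \<epsilon> j) \<longrightarrow> decseq \<epsilon> \<longrightarrow> \<epsilon> \<longlonglongrightarrow> 0 \<longrightarrow>
        (\<forall>j. AE \<omega> in M. set_integrable (Q \<omega>) ({z. \<epsilon> j < norm z} \<times> E j) (\<lambda>(z, s). g s *v z)) \<and>
        (\<forall>j. set_integrable (time_intensity \<nu> \<T>)
           ({z. \<epsilon> j < norm z \<and> norm z \<le> 1} \<times> E j) (\<lambda>(z, s). g s *v z)) \<and>
        converges_in_probability M (\<lambda>j. truncated_levy_integral \<T> Q \<nu> g (\<epsilon> j) (E j)) Z)"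

definition fdd_converges ::
    "'w measure \<Rightarrow> real set \<Rightarrow> ('i \<Rightarrow> real \<Rightarrow> 'w \<Rightarrow> 'a::topological_space) \<Rightarrow> (real \<Rightarrow> 'w \<Rightarrow> 'a) \<Rightarrow>
      'i filter \<Rightarrow> bool" where
  "fdd_converges M I Y Z F \<longleftrightarrow>
     (\<forall>J h. finite J \<longrightarrow> J \<subseteq> I \<longrightarrow>
        continuous_map (product_topology (\<lambda>_. euclidean) J) euclideanreal h \<longrightarrow>
        bounded (h ` (J \<rightarrow>\<^sub>E UNIV)) \<longrightarrow>
        ((\<lambda>i. LINT \<omega>|M. h (\<lambda>t\<in>J. Y i t \<omega>)) \<longlongrightarrow> (LINT \<omega>|M. h (\<lambda>t\<in>J. Z t \<omega>))) F)"

end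

theory Submission
  imports Defs
begin

text \<open>
  Fix \<open>t\<close> and write \<open>g = f t\<close>, \<open>\<nu>\<^sub>r = \<nu> - \<nu>\<^sub>m\<close>. The truncated integral of \<open>g(s) z\<close> over \<open>\<epsilon> < \<parallel>z\<parallel>\<close>,
  \<open>s \<in> E\<close> against \<open>\<mu> - \<mu>\<^sub>m\<close> has only its jumps with \<open>\<parallel>z\<parallel> \<le> 1\<close> compensated. It is therefore a fully
  compensated integral plus the drift \<open>\<integral>\<^sub>E g(s) c\<^sub>m ds\<close>, where \<open>c\<^sub>m\<close> is the \<open>\<nu>\<^sub>r\<close>-integral of \<open>z\<close> over
  \<open>\<parallel>z\<parallel> > 1\<close> (lemma \<open>truncated_decomposition\<close>).

  The compensated part has second moment at most \<open>d \<integral>\<parallel>g\<parallel>\<^sup>2 ds \<integral>\<parallel>z\<parallel>\<^sup>2 \<nu>\<^sub>r(dz)\<close>, uniformly in \<open>\<epsilon>\<close> and \<open>E\<close>,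
  by the variance formula for Poisson random measures (\<open>poisson_L2_bound\<close>, \<open>compensated_L2\<close>). The shot
  noise representation turns \<open>\<integral>\<parallel>z\<parallel>\<^sup>2 \<nu>\<^sub>r(dz)\<close> into the tail integral of hypothesis \<open>c\<close>, which tends
  to zero.

  The drift is the delicate part: \<open>g\<close> is square integrable, but need not be integrable, when the time
  interval is unbounded, so that \<open>c\<^sub>m \<longlonglongrightarrow> 0\<close> does not settle it. Here the existence of the error process
  itself helps. Were \<open>s \<mapsto> g(s) c\<^sub>m\<close> not integrable, some exhaustion of the time interval would make the
  drift diverge while the compensated part stays bounded in \<open>L\<^sup>2\<close>, contradicting convergence along every
  exhaustion (\<open>kernel_mean_integrable\<close>). Hence every \<open>c\<^sub>m\<close> lies in the finite-dimensional space of those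
  \<open>v\<close> for which \<open>s \<mapsto> g(s) v\<close> is integrable. There \<open>v \<mapsto> \<integral>\<parallel>g(s) v\<parallel> ds\<close> is a seminorm, thus continuous,
  and the drift vanishes in the limit (\<open>integral_norm_matrix_vector_tendsto_0\<close>). This gives the claim for
  \<open>Q\<close> and a bound on the residual integrals that is uniform in \<open>\<epsilon>\<close> and \<open>E\<close> (\<open>residual_tail_uniform\<close>).

  For \<open>R\<close> no moment bound is available, since \<open>\<nu>\<^sub>m\<close> may have heavy tails. Instead, over a time set
  \<open>T\<^sub>j - T\<^sub>n\<close>, the integral against \<open>\<mu>\<^sub>m\<close> equals the integral against \<open>\<mu>\<close> minus the residual one. The
  former is a difference of two truncated versions of \<open>X\<close>, and these converge to \<open>X\<close> as cutoff and time
  window vary independently (\<open>levy_integral_net\<close>); the latter is small by the uniform bound.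

  Finally, convergence to zero in probability at each time yields convergence of the finite dimensional
  distributions (\<open>fdd_converges_zeroI\<close>).
\<close>

section \<open>Superposition of measures\<close>

lemma nn_integral_superposition:
  fixes g :: "'b \<Rightarrow> ennreal"
  assumes sets: "sets N1 = sets N" "sets N2 = sets N"
    and add: "\<And>B. B \<in> sets N \<Longrightarrow> emeasure N B = emeasure N1 B + emeasure N2 B"
    and g: "g \<in> borel_measurable N"
  shows "(\<integral>\<^sup>+ x. g x \<partial>N) = (\<integral>\<^sup>+ x. g x \<partial>N1) + (\<integral>\<^sup>+ x. g x \<partial>N2)"
  using g
proof (induction rule: borel_measurable_induct)
  case (cong f g)
  then show ?case
    using nn_integral_cong[of N f g] nn_integral_cong[of N1 f g] nn_integral_cong[of N2 f g]
    by (simp add: sets_eq_imp_space_eq[OF sets(1)] sets_eq_imp_space_eq[OF sets(2)])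
next
  case (set A)
  then show ?case using add[of A] sets by simp
next
  case (mult u c)
  note [measurable_cong] = sets
  have [measurable]: "u \<in> borel_measurable N" by fact
  show ?case using mult by (simp add: nn_integral_cmult distrib_left)
next
  case (add u v)
  note [measurable_cong] = sets
  have [measurable]: "u \<in> borel_measurable N" "v \<in> borel_measurable N" by fact+
  show ?case using add by (simp add: nn_integral_add ac_simps)
next
  case (seq F)
  note [measurable_cong] = sets
  have [measurable]: "F i \<in> borel_measurable N" for i by fact
  have m: "incseq (\<lambda>i. \<integral>\<^sup>+ x. F i x \<partial>N')" for N'
    using seq(3) by (intro monoI nn_integral_mono) (auto simp: mono_def le_fun_def)
  have "(\<integral>\<^sup>+ x. (SUP i. F i x) \<partial>N') = (SUP i. \<integral>\<^sup>+ x. F i x \<partial>N')" if "sets N' = sets N" for N'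
  proof -
    note [measurable_cong] = that
    show ?thesis by (rule nn_integral_monotone_convergence_SUP[OF seq(3)]) measurable
  qed
  from this[OF refl] this[OF sets(1)] this[OF sets(2)] show ?case
    using seq.IH by (simp add: ennreal_SUP_add[OF m m] SUP_apply image_comp)
qed

lemma integral_superposition:
  fixes g :: "'b \<Rightarrow> 'a::{banach, second_countable_topology}"
  assumes sets: "sets N1 = sets N" "sets N2 = sets N"
    and add: "\<And>B. B \<in> sets N \<Longrightarrow> emeasure N B = emeasure N1 B + emeasure N2 B"
    and g: "integrable N g"
  shows "integrable N1 g" "integrable N2 g" "integral\<^sup>L N g = integral\<^sup>L N1 g + integral\<^sup>L N2 g"
proof -
  have gN: "g \<in> borel_measurable N" using g by auto
  have int: "integrable N1 g \<and> integrable N2 g" if "integrable N g" for g :: "'b \<Rightarrow> 'a"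
  proof -
    have [measurable]: "g \<in> borel_measurable N" using that by auto
    have "(\<integral>\<^sup>+ x. ennreal (norm (g x)) \<partial>N1) + (\<integral>\<^sup>+ x. ennreal (norm (g x)) \<partial>N2) < \<infinity>"
      using nn_integral_superposition[OF sets add, of "\<lambda>x. ennreal (norm (g x))"] that
      by (auto simp: integrable_iff_bounded)
    moreover have "g \<in> borel_measurable N1" "g \<in> borel_measurable N2"
      using sets by (simp_all cong: measurable_cong_sets)
    ultimately show ?thesis by (simp add: integrable_iff_bounded)
  qed
  show "integrable N1 g" "integrable N2 g" using int[OF g] by auto
  show "integral\<^sup>L N g = integral\<^sup>L N1 g + integral\<^sup>L N2 g"
    using g
  proof (induction rule: integrable_induct)
    case (base A c)
    have "emeasure N1 A < \<infinity>" "emeasure N2 A < \<infinity>" using base add[of A] by auto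
    then have "measure N A = measure N1 A + measure N2 A"
      using add[OF base(1)] by (simp add: measure_def enn2real_plus)
    then show ?case using base sets \<open>emeasure N1 A < \<infinity>\<close> \<open>emeasure N2 A < \<infinity>\<close>
      by (simp add: scaleR_add_left less_top[symmetric])
  next
    case (add f g)
    then show ?case using int[of f] int[of g] by simp
  next
    case (lim f s)
    have f: "integrable N f" by fact
    have *: "(\<lambda>i. integral\<^sup>L N' (s i)) \<longlonglongrightarrow> integral\<^sup>L N' f" if N': "integrable N' f" "sets N' = sets N" for N'
    proof (rule integral_dominated_convergence[where w = "\<lambda>x. 2 * norm (f x)"])
      show "f \<in> borel_measurable N'" using N' by auto
      show "s i \<in> borel_measurable N'" for i
        using lim(1)[of i] N'(2) by (auto cong: measurable_cong_sets dest: borel_measurable_integrable)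
      show "integrable N' (\<lambda>x. 2 * norm (f x))" using N' by auto
      show "AE x in N'. (\<lambda>i. s i x) \<longlonglongrightarrow> f x" "AE x in N'. norm (s i x) \<le> 2 * norm (f x)" for i
        using lim.hyps sets_eq_imp_space_eq[OF N'(2)] by auto
    qed
    have "(\<lambda>i. integral\<^sup>L N1 (s i) + integral\<^sup>L N2 (s i)) \<longlonglongrightarrow> integral\<^sup>L N1 f + integral\<^sup>L N2 f"
      using int[OF f] sets by (intro tendsto_add *) auto
    moreover have "(\<lambda>i. integral\<^sup>L N1 (s i) + integral\<^sup>L N2 (s i)) \<longlonglongrightarrow> integral\<^sup>L N f"
      using *[OF f refl] lim.IH by simp
    ultimately show ?case using LIMSEQ_unique by blast
  qed
qed

section \<open>Integrals against random measures\<close>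

text \<open>
  A random measure whose values on measurable sets are random variables need not be a kernel of
  subprobability measures, so measurability of its integrals is obtained by approximating the integrand.
\<close>

lemma borel_measurable_nn_integral_random:
  fixes g :: "'e \<Rightarrow> ennreal"
  assumes sets: "\<And>\<omega>. \<omega> \<in> space M \<Longrightarrow> sets (Q \<omega>) = sets \<Lambda>"
    and Q: "\<And>B. B \<in> sets \<Lambda> \<Longrightarrow> (\<lambda>\<omega>. emeasure (Q \<omega>) B) \<in> borel_measurable M"
    and g: "g \<in> borel_measurable \<Lambda>"
  shows "(\<lambda>\<omega>. \<integral>\<^sup>+ x. g x \<partial>Q \<omega>) \<in> borel_measurable M"
  using g
proof (induction rule: borel_measurable_induct)
  case (cong f g)
  have "(\<integral>\<^sup>+ x. f x \<partial>Q \<omega>) = (\<integral>\<^sup>+ x. g x \<partial>Q \<omega>)" if "\<omega> \<in> space M" for \<omega>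
    using cong(3) sets_eq_imp_space_eq[OF sets[OF that]] by (intro nn_integral_cong) auto
  then show ?case using cong(4) by (simp cong: measurable_cong)
next
  case (set A)
  have "(\<integral>\<^sup>+ x. indicator A x \<partial>Q \<omega>) = emeasure (Q \<omega>) A" if "\<omega> \<in> space M" for \<omega>
    using set sets[OF that] by simp
  then show ?case using Q[OF set] by (simp cong: measurable_cong)
next
  case (mult u c)
  have "(\<integral>\<^sup>+ x. c * u x \<partial>Q \<omega>) = c * (\<integral>\<^sup>+ x. u x \<partial>Q \<omega>)" if "\<omega> \<in> space M" for \<omega>
    using mult.hyps sets[OF that] by (intro nn_integral_cmult) (simp cong: measurable_cong_sets)
  then show ?case using mult.IH by (simp cong: measurable_cong)
next
  case (add u v)
  have "(\<integral>\<^sup>+ x. v x + u x \<partial>Q \<omega>) = (\<integral>\<^sup>+ x. v x \<partial>Q \<omega>) + (\<integral>\<^sup>+ x. u x \<partial>Q \<omega>)" if "\<omega> \<in> space M" for \<omega>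
    using add.hyps sets[OF that] by (intro nn_integral_add) (simp_all cong: measurable_cong_sets)
  then show ?case using add.IH by (simp cong: measurable_cong)
next
  case (seq F)
  have "(\<integral>\<^sup>+ x. (SUP i. F i x) \<partial>Q \<omega>) = (SUP i. \<integral>\<^sup>+ x. F i x \<partial>Q \<omega>)" if "\<omega> \<in> space M" for \<omega>
    using seq(1) sets[OF that]
    by (intro nn_integral_monotone_convergence_SUP[OF seq(3)]) (simp cong: measurable_cong_sets)
  then show ?case using seq.IH by (simp add: SUP_apply image_comp cong: measurable_cong)
qed

lemma borel_measurable_integral_random:
  fixes g :: "'e \<Rightarrow> 'a::euclidean_space"
  assumes sets: "\<And>\<omega>. \<omega> \<in> space M \<Longrightarrow> sets (Q \<omega>) = sets \<Lambda>"
    and Q: "\<And>B. B \<in> sets \<Lambda> \<Longrightarrow> (\<lambda>\<omega>. emeasure (Q \<omega>) B) \<in> borel_measurable M"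
    and g: "g \<in> borel_measurable \<Lambda>"
  shows "(\<lambda>\<omega>. \<integral> x. g x \<partial>Q \<omega>) \<in> borel_measurable M"
proof (subst borel_measurable_euclidean_space, rule ballI)
  fix i :: 'a assume i: "i \<in> Basis"
  let ?n = "\<lambda>\<omega>. \<integral>\<^sup>+ x. ennreal (norm (g x)) \<partial>Q \<omega>"
  let ?p = "\<lambda>\<omega>. \<integral>\<^sup>+ x. ennreal (g x \<bullet> i) \<partial>Q \<omega>"
  let ?q = "\<lambda>\<omega>. \<integral>\<^sup>+ x. ennreal (- (g x \<bullet> i)) \<partial>Q \<omega>"
  note m = borel_measurable_nn_integral_random[OF sets Q]
  have [measurable]: "?n \<in> borel_measurable M" "?p \<in> borel_measurable M" "?q \<in> borel_measurable M"
    using g by (auto intro!: m)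
  have "integral\<^sup>L (Q \<omega>) g \<bullet> i = (if ?n \<omega> < \<infinity> then enn2real (?p \<omega>) - enn2real (?q \<omega>) else 0)"
    if w: "\<omega> \<in> space M" for \<omega>
  proof -
    have gQ: "g \<in> borel_measurable (Q \<omega>)" using g sets[OF w] by (simp cong: measurable_cong_sets)
    show ?thesis
    proof (cases "integrable (Q \<omega>) g")
      case True
      then have "integral\<^sup>L (Q \<omega>) g \<bullet> i = enn2real (?p \<omega>) - enn2real (?q \<omega>)"
        by (subst integral_inner_left[symmetric], simp)
           (intro real_lebesgue_integral_def integrable_inner_left)
      with True show ?thesis by (simp add: integrable_iff_bounded)
    next
      case False
      then show ?thesis using gQ by (auto simp: not_integrable_integral_eq integrable_iff_bounded)
    qed
  qed
  then show "(\<lambda>\<omega>. integral\<^sup>L (Q \<omega>) g \<bullet> i) \<in> borel_measurable M"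
    by (simp cong: measurable_cong)
qed

section \<open>Moments of Poisson random measures\<close>

lemma poisson_weight_sums:
  fixes l :: real
  shows "(\<lambda>k. l ^ k / fact k * exp (- l)) sums 1"
    "(\<lambda>k. real k * (l ^ k / fact k * exp (- l))) sums l"
    "(\<lambda>k. (real k - l)\<^sup>2 * (l ^ k / fact k * exp (- l))) sums l"
proof -
  let ?p = "\<lambda>k. l ^ k / fact k * exp (- l)"
  have "(\<lambda>k. l ^ k / fact k * exp (- l)) sums (exp l * exp (- l))"
    using exp_converges[of l] by (intro sums_mult2) (simp add: divide_inverse mult.commute)
  then show 1: "?p sums 1" by (simp add: exp_minus)
  have shift: "real (Suc k) * ?p (Suc k) = l * ?p k" for k
    by (simp add: field_simps del: of_nat_Suc)
  have "(\<lambda>k. real (Suc k) * ?p (Suc k)) sums l"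
    unfolding shift using sums_mult[OF 1, of l] by simp
  then show 2: "(\<lambda>k. real k * ?p k) sums l"
    by (subst (asm) sums_Suc_iff) simp
  have "(\<lambda>k. l * (real k * ?p k) + l * ?p k) sums (l * l + l * 1)"
    by (intro sums_add sums_mult 1 2)
  moreover have "real (Suc k) ^ 2 * ?p (Suc k) = l * (real k * ?p k) + l * ?p k" for k
  proof -
    have "real (Suc k) ^ 2 * ?p (Suc k) = real (Suc k) * (real (Suc k) * ?p (Suc k))"
      by (simp add: power2_eq_square del: of_nat_Suc)
    also have "\<dots> = real (Suc k) * (l * ?p k)" unfolding shift ..
    also have "\<dots> = l * (real k * ?p k) + l * ?p k"
      unfolding of_nat_Suc by (simp only: distrib_right distrib_left mult_1_left mult_1_right mult_ac add_ac)
    finally show ?thesis .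
  qed
  ultimately have "(\<lambda>k. real (Suc k) ^ 2 * ?p (Suc k)) sums (l * l + l)" by simp
  then have 3: "(\<lambda>k. real k ^ 2 * ?p k) sums (l * l + l)"
    by (subst (asm) sums_Suc_iff) simp
  have "(\<lambda>k. real k ^ 2 * ?p k - 2 * l * (real k * ?p k) + l^2 * ?p k) sums (l * l + l - 2 * l * l + l^2 * 1)"
    by (intro sums_add sums_diff sums_mult 1 2 3)
  moreover have "real k ^ 2 * p - 2 * l * (real k * p) + l^2 * p = (real k - l)\<^sup>2 * p" for k p
    by (simp add: power2_eq_square algebra_simps)
  moreover have "l * l + l - 2 * l * l + l^2 * 1 = l"
    by (simp add: power2_eq_square)
  ultimately show "(\<lambda>k. (real k - l)\<^sup>2 * ?p k) sums l" by (simp only:)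
qed

lemma poisson_random_measureD:
  assumes "poisson_random_measure M Q \<Lambda>"
  shows "\<And>\<omega>. \<omega> \<in> space M \<Longrightarrow> sets (Q \<omega>) = sets \<Lambda>"
    and "\<And>B. B \<in> sets \<Lambda> \<Longrightarrow> (\<lambda>\<omega>. emeasure (Q \<omega>) B) \<in> borel_measurable M"
  using assms by (auto simp: poisson_random_measure_def)

lemma poisson_nn_integral_measurable:
  fixes g :: "'e \<Rightarrow> ennreal"
  assumes "poisson_random_measure M Q \<Lambda>" "g \<in> borel_measurable \<Lambda>"
  shows "(\<lambda>\<omega>. \<integral>\<^sup>+ x. g x \<partial>Q \<omega>) \<in> borel_measurable M"
  using borel_measurable_nn_integral_random[of M Q \<Lambda> g] poisson_random_measureD[OF assms(1)] assms(2)
  by blast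

lemma poisson_integral_measurable:
  fixes g :: "'e \<Rightarrow> 'a::euclidean_space"
  assumes "poisson_random_measure M Q \<Lambda>" "g \<in> borel_measurable \<Lambda>"
  shows "(\<lambda>\<omega>. \<integral> x. g x \<partial>Q \<omega>) \<in> borel_measurable M"
  using borel_measurable_integral_random[of M Q \<Lambda> g] poisson_random_measureD[OF assms(1)] assms(2)
  by blast

context prob_space
begin

text \<open>
  The prescribed probabilities of the finite counts already add up to one, so the count is almost surely
  a natural number, and expectations of its functions are series.
\<close>

lemma poisson_count:
  assumes Q: "poisson_random_measure M Q \<Lambda>" and B: "B \<in> sets \<Lambda>" "emeasure \<Lambda> B < \<infinity>"
  shows "AE \<omega> in M. emeasure (Q \<omega>) B < \<infinity>"
    and "\<phi> \<in> borel_measurable borel \<Longrightarrow> (\<integral>\<^sup>+ \<omega>. \<phi> (emeasure (Q \<omega>) B) \<partial>M) =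
      (\<Sum>k. \<phi> (of_nat k) * ennreal (measure \<Lambda> B ^ k / fact k * exp (- measure \<Lambda> B)))"
proof -
  let ?N = "\<lambda>\<omega>. emeasure (Q \<omega>) B"
  let ?p = "\<lambda>k::nat. measure \<Lambda> B ^ k / fact k * exp (- measure \<Lambda> B)"
  let ?A = "\<lambda>k::nat. {\<omega>\<in>space M. ?N \<omega> = of_nat k}"
  have [measurable]: "?N \<in> borel_measurable M" using poisson_random_measureD(2)[OF Q B(1)] .
  have p: "prob (?A k) = ?p k" for k
    using Q B by (auto simp: poisson_random_measure_def)
  have A: "?A k \<in> sets M" for k by measurable
  have dA: "disjoint_family ?A" by (auto simp: disjoint_family_on_def)
  have "(\<lambda>k. prob (?A k)) sums prob (\<Union>k. ?A k)"
    using A dA by (intro finite_measure_UNION) auto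
  moreover have "(\<lambda>k. prob (?A k)) sums 1" unfolding p by (rule poisson_weight_sums)
  ultimately have "prob (\<Union>k. ?A k) = 1" by (rule sums_unique2)
  then have AE: "AE \<omega> in M. \<omega> \<in> (\<Union>k. ?A k)"
    using A by (subst AE_in_set_eq_1) auto
  then show "AE \<omega> in M. ?N \<omega> < \<infinity>" by eventually_elim (auto simp: ennreal_of_nat_eq_real_of_nat)
  assume [measurable]: "\<phi> \<in> borel_measurable borel"
  have "(\<integral>\<^sup>+ \<omega>. \<phi> (?N \<omega>) \<partial>M) = (\<integral>\<^sup>+ \<omega>. (\<Sum>k. \<phi> (of_nat k) * indicator (?A k) \<omega>) \<partial>M)"
  proof (rule nn_integral_cong_AE)
    show "AE \<omega> in M. \<phi> (?N \<omega>) = (\<Sum>k. \<phi> (of_nat k) * indicator (?A k) \<omega>)"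
      using AE
    proof eventually_elim
      case (elim \<omega>)
      then obtain n where n: "?N \<omega> = of_nat n" "\<omega> \<in> space M" by auto
      have "(\<Sum>k. \<phi> (of_nat k) * indicator (?A k) \<omega>) = (\<Sum>k\<in>{n}. \<phi> (of_nat k) * indicator (?A k) \<omega>)"
        using n by (intro suminf_finite) (auto simp: indicator_def)
      then show ?case using n by simp
    qed
  qed
  also have "\<dots> = (\<Sum>k. \<phi> (of_nat k) * emeasure M (?A k))"
    by (subst nn_integral_suminf) (simp_all add: nn_integral_cmult_indicator)
  also have "\<dots> = (\<Sum>k. \<phi> (of_nat k) * ennreal (?p k))"
    using p by (simp add: emeasure_eq_measure)
  finally show "(\<integral>\<^sup>+ \<omega>. \<phi> (?N \<omega>) \<partial>M) = (\<Sum>k. \<phi> (of_nat k) * ennreal (?p k))" .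
qed

lemma poisson_count_mean:
  assumes Q: "poisson_random_measure M Q \<Lambda>" and B: "B \<in> sets \<Lambda>"
  shows "(\<integral>\<^sup>+ \<omega>. emeasure (Q \<omega>) B \<partial>M) = emeasure \<Lambda> B"
proof (cases "emeasure \<Lambda> B < \<infinity>")
  case True
  have "(\<integral>\<^sup>+ \<omega>. emeasure (Q \<omega>) B \<partial>M) =
      (\<Sum>k. ennreal (real k * (measure \<Lambda> B ^ k / fact k * exp (- measure \<Lambda> B))))"
    by (subst poisson_count(2)[OF Q B True, of "\<lambda>x. x"])
       (simp_all add: ennreal_of_nat_eq_real_of_nat ennreal_mult[symmetric])
  also have "\<dots> = ennreal (measure \<Lambda> B)"
    by (intro suminf_ennreal_eq poisson_weight_sums) auto
  finally show ?thesis using True by (simp add: emeasure_eq_ennreal_measure)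
next
  case False
  then have "emeasure \<Lambda> B = \<infinity>" by (simp add: less_top[symmetric])
  moreover from this have "AE \<omega> in M. emeasure (Q \<omega>) B = \<infinity>"
    using Q B by (auto simp: poisson_random_measure_def)
  ultimately show ?thesis
    by (subst nn_integral_cong_AE[where v = "\<lambda>_. \<infinity>"]) (auto simp: emeasure_space_1)
qed

text \<open>
  Campbell's formula.
\<close>

lemma poisson_campbell:
  fixes g :: "'b \<Rightarrow> ennreal"
  assumes Q: "poisson_random_measure M Q \<Lambda>" and g: "g \<in> borel_measurable \<Lambda>"
  shows "(\<integral>\<^sup>+ \<omega>. (\<integral>\<^sup>+ x. g x \<partial>Q \<omega>) \<partial>M) = (\<integral>\<^sup>+ x. g x \<partial>\<Lambda>)"
proof -
  note sets = poisson_random_measureD(1)[OF Q]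
  note meas = poisson_nn_integral_measurable[OF Q]
  show ?thesis using g
  proof (induction rule: borel_measurable_induct)
    case (cong f g)
    have "(\<integral>\<^sup>+ x. f x \<partial>Q \<omega>) = (\<integral>\<^sup>+ x. g x \<partial>Q \<omega>)" if "\<omega> \<in> space M" for \<omega>
      using cong(3) sets_eq_imp_space_eq[OF sets[OF that]] by (intro nn_integral_cong) auto
    moreover have "(\<integral>\<^sup>+ x. f x \<partial>\<Lambda>) = (\<integral>\<^sup>+ x. g x \<partial>\<Lambda>)"
      using cong(3) by (intro nn_integral_cong) auto
    ultimately show ?case using cong(4) by (simp cong: nn_integral_cong)
  next
    case (set A)
    have "(\<integral>\<^sup>+ x. indicator A x \<partial>Q \<omega>) = emeasure (Q \<omega>) A" if "\<omega> \<in> space M" for \<omega>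
      using set sets[OF that] by simp
    then show ?case using poisson_count_mean[OF Q set] set by (simp cong: nn_integral_cong)
  next
    case (mult u c)
    have "(\<integral>\<^sup>+ x. c * u x \<partial>Q \<omega>) = c * (\<integral>\<^sup>+ x. u x \<partial>Q \<omega>)" if "\<omega> \<in> space M" for \<omega>
      using mult.hyps sets[OF that] by (intro nn_integral_cmult) (simp cong: measurable_cong_sets)
    then have "(\<integral>\<^sup>+ \<omega>. (\<integral>\<^sup>+ x. c * u x \<partial>Q \<omega>) \<partial>M) = (\<integral>\<^sup>+ \<omega>. c * (\<integral>\<^sup>+ x. u x \<partial>Q \<omega>) \<partial>M)"
      by (intro nn_integral_cong)
    also have "\<dots> = c * (\<integral>\<^sup>+ x. u x \<partial>\<Lambda>)"
      using mult.hyps mult.IH by (subst nn_integral_cmult) (auto intro!: meas)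
    finally show ?case using mult.hyps by (simp add: nn_integral_cmult)
  next
    case (add u v)
    have "(\<integral>\<^sup>+ x. v x + u x \<partial>Q \<omega>) = (\<integral>\<^sup>+ x. v x \<partial>Q \<omega>) + (\<integral>\<^sup>+ x. u x \<partial>Q \<omega>)" if "\<omega> \<in> space M" for \<omega>
      using add.hyps sets[OF that] by (intro nn_integral_add) (simp_all cong: measurable_cong_sets)
    then have "(\<integral>\<^sup>+ \<omega>. (\<integral>\<^sup>+ x. v x + u x \<partial>Q \<omega>) \<partial>M) =
        (\<integral>\<^sup>+ \<omega>. (\<integral>\<^sup>+ x. v x \<partial>Q \<omega>) + (\<integral>\<^sup>+ x. u x \<partial>Q \<omega>) \<partial>M)"
      by (intro nn_integral_cong)
    also have "\<dots> = (\<integral>\<^sup>+ x. v x \<partial>\<Lambda>) + (\<integral>\<^sup>+ x. u x \<partial>\<Lambda>)"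
      using add.hyps add.IH by (subst nn_integral_add) (auto intro!: meas)
    finally show ?case using add.hyps by (simp add: nn_integral_add)
  next
    case (seq F)
    note F = \<open>incseq F\<close> \<open>\<And>i. F i \<in> borel_measurable \<Lambda>\<close>
    have "(\<integral>\<^sup>+ x. (SUP i. F i x) \<partial>Q \<omega>) = (SUP i. \<integral>\<^sup>+ x. F i x \<partial>Q \<omega>)" if "\<omega> \<in> space M" for \<omega>
      using F sets[OF that]
      by (intro nn_integral_monotone_convergence_SUP[OF F(1)]) (simp cong: measurable_cong_sets)
    then have "(\<integral>\<^sup>+ \<omega>. (\<integral>\<^sup>+ x. (SUP i. F i x) \<partial>Q \<omega>) \<partial>M) = (\<integral>\<^sup>+ \<omega>. (SUP i. \<integral>\<^sup>+ x. F i x \<partial>Q \<omega>) \<partial>M)"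
      by (intro nn_integral_cong)
    also have "\<dots> = (SUP i. \<integral>\<^sup>+ \<omega>. (\<integral>\<^sup>+ x. F i x \<partial>Q \<omega>) \<partial>M)"
    proof (rule nn_integral_monotone_convergence_SUP)
      show "incseq (\<lambda>i \<omega>. \<integral>\<^sup>+ x. F i x \<partial>Q \<omega>)"
        using F(1) by (intro monoI le_funI nn_integral_mono) (auto simp: mono_def le_fun_def)
      show "(\<lambda>\<omega>. \<integral>\<^sup>+ x. F i x \<partial>Q \<omega>) \<in> borel_measurable M" for i
        by (rule meas[OF F(2)])
    qed
    also have "\<dots> = (\<integral>\<^sup>+ x. (SUP i. F i x) \<partial>\<Lambda>)"
      using seq.IH nn_integral_monotone_convergence_SUP[OF F(1,2)] by simp
    finally show ?case by (simp add: SUP_apply image_comp)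
  qed
qed

lemma poisson_AE_integrable:
  fixes g :: "'b \<Rightarrow> 'c::euclidean_space"
  assumes Q: "poisson_random_measure M Q \<Lambda>" and g: "integrable \<Lambda> g"
  shows "AE \<omega> in M. integrable (Q \<omega>) g"
proof -
  have gm: "g \<in> borel_measurable \<Lambda>" using g by auto
  have "(\<integral>\<^sup>+ \<omega>. (\<integral>\<^sup>+ x. ennreal (norm (g x)) \<partial>Q \<omega>) \<partial>M) < \<infinity>"
    using g by (subst poisson_campbell[OF Q]) (auto simp: integrable_iff_bounded)
  then have "AE \<omega> in M. (\<integral>\<^sup>+ x. ennreal (norm (g x)) \<partial>Q \<omega>) \<noteq> \<infinity>"
    using gm by (intro nn_integral_noteq_infinite poisson_nn_integral_measurable[OF Q]) auto
  with AE_space show ?thesis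
  proof eventually_elim
    case (elim \<omega>)
    then have "g \<in> borel_measurable (Q \<omega>)"
      using gm poisson_random_measureD(1)[OF Q elim(1)] by (simp cong: measurable_cong_sets)
    with elim show ?case by (auto simp: integrable_iff_bounded less_top)
  qed
qed

lemma poisson_count_centered:
  assumes Q: "poisson_random_measure M Q \<Lambda>" and B: "B \<in> sets \<Lambda>" "emeasure \<Lambda> B < \<infinity>"
  defines "Y \<equiv> \<lambda>\<omega>. measure (Q \<omega>) B - measure \<Lambda> B"
  shows "integrable M Y" "expectation Y = 0"
    "integrable M (\<lambda>\<omega>. (Y \<omega>)\<^sup>2)" "expectation (\<lambda>\<omega>. (Y \<omega>)\<^sup>2) = measure \<Lambda> B"
proof -
  have [measurable]: "(\<lambda>\<omega>. emeasure (Q \<omega>) B) \<in> borel_measurable M"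
    using poisson_random_measureD(2)[OF Q B(1)] .
  then have [measurable]: "(\<lambda>\<omega>. measure (Q \<omega>) B) \<in> borel_measurable M"
    by (simp add: measure_def)
  have "(\<integral>\<^sup>+ \<omega>. ennreal (measure (Q \<omega>) B) \<partial>M) = (\<integral>\<^sup>+ \<omega>. emeasure (Q \<omega>) B \<partial>M)"
    using poisson_count(1)[OF Q B]
    by (intro nn_integral_cong_AE) (auto simp: emeasure_eq_ennreal_measure)
  also have "\<dots> = ennreal (measure \<Lambda> B)"
    using poisson_count_mean[OF Q B(1)] B(2) by (simp add: emeasure_eq_ennreal_measure)
  finally have "has_bochner_integral M (\<lambda>\<omega>. measure (Q \<omega>) B) (measure \<Lambda> B)"
    by (intro has_bochner_integral_nn_integral) auto
  then have i: "integrable M (\<lambda>\<omega>. measure (Q \<omega>) B)" "expectation (\<lambda>\<omega>. measure (Q \<omega>) B) = measure \<Lambda> B"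
    by (auto simp: has_bochner_integral_iff)
  then show "integrable M Y" "expectation Y = 0" by (simp_all add: Y_def prob_space)
  have "(\<integral>\<^sup>+ \<omega>. ennreal ((Y \<omega>)\<^sup>2) \<partial>M) = (\<integral>\<^sup>+ \<omega>. ennreal ((enn2real (emeasure (Q \<omega>) B) - measure \<Lambda> B)\<^sup>2) \<partial>M)"
    by (simp add: Y_def measure_def)
  also have "\<dots> = (\<Sum>k. ennreal ((real k - measure \<Lambda> B)\<^sup>2 * (measure \<Lambda> B ^ k / fact k * exp (- measure \<Lambda> B))))"
    by (subst poisson_count(2)[OF Q B, of "\<lambda>x. ennreal ((enn2real x - measure \<Lambda> B)\<^sup>2)"])
       (simp_all add: ennreal_mult[symmetric] ennreal_of_nat_eq_real_of_nat)
  also have "\<dots> = ennreal (measure \<Lambda> B)"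
    by (intro suminf_ennreal_eq poisson_weight_sums) auto
  finally have "has_bochner_integral M (\<lambda>\<omega>. (Y \<omega>)\<^sup>2) (measure \<Lambda> B)"
    by (intro has_bochner_integral_nn_integral) (auto simp: Y_def)
  then show "integrable M (\<lambda>\<omega>. (Y \<omega>)\<^sup>2)" "expectation (\<lambda>\<omega>. (Y \<omega>)\<^sup>2) = measure \<Lambda> B"
    by (auto simp: has_bochner_integral_iff)
qed

lemma poisson_count_uncorrelated:
  assumes Q: "poisson_random_measure M Q \<Lambda>"
    and B: "B \<in> sets \<Lambda>" "emeasure \<Lambda> B < \<infinity>" and C: "C \<in> sets \<Lambda>" "emeasure \<Lambda> C < \<infinity>"
    and disj: "B \<inter> C = {}"
  shows "expectation (\<lambda>\<omega>. (measure (Q \<omega>) B - measure \<Lambda> B) * (measure (Q \<omega>) C - measure \<Lambda> C)) = 0"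
proof -
  let ?D = "\<lambda>n::nat. if n = 0 then B else C"
  let ?Y = "\<lambda>n \<omega>. enn2real (emeasure (Q \<omega>) (?D n)) - measure \<Lambda> (?D n)"
  have "disjoint_family_on ?D {0, 1}" using disj by (auto simp: disjoint_family_on_def)
  moreover have "\<forall>i\<in>{0,1}. ?D i \<in> sets \<Lambda>" using B C by auto
  ultimately have ind: "indep_vars (\<lambda>_. borel) (\<lambda>i \<omega>. emeasure (Q \<omega>) (?D i)) {0, 1}"
    using Q unfolding poisson_random_measure_def
    by (elim conjE allE[where x = "{0, 1::nat}"] allE[where x = ?D]) auto
  have "indep_vars (\<lambda>_. borel) ?Y {0, 1}"
    by (rule indep_vars_compose2[OF ind]) measurable
  moreover have "integrable M (?Y i)" for i
    using poisson_count_centered(1)[OF Q, of "?D i"] B C by (auto simp: measure_def)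
  ultimately have "expectation (\<lambda>\<omega>. \<Prod>i\<in>{0,1}. ?Y i \<omega>) = (\<Prod>i\<in>{0,1}. expectation (?Y i))"
    by (intro indep_vars_lebesgue_integral) auto
  also have "\<dots> = 0"
    using poisson_count_centered(2)[OF Q B] by (simp add: measure_def)
  finally show ?thesis by (simp add: measure_def)
qed

text \<open>
  Counts of disjoint sets are uncorrelated, so only the diagonal of the squared sum survives.
\<close>

lemma poisson_variance_simple:
  fixes c :: "'i \<Rightarrow> real"
  assumes Q: "poisson_random_measure M Q \<Lambda>" and I: "finite I"
    and B: "\<And>i. i \<in> I \<Longrightarrow> B i \<in> sets \<Lambda>" "\<And>i. i \<in> I \<Longrightarrow> emeasure \<Lambda> (B i) < \<infinity>"
    and disj: "disjoint_family_on B I"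
  shows "(\<integral>\<^sup>+ \<omega>. ennreal (((\<Sum>i\<in>I. c i * measure (Q \<omega>) (B i)) - (\<Sum>i\<in>I. c i * measure \<Lambda> (B i)))\<^sup>2) \<partial>M)
    = ennreal (\<Sum>i\<in>I. (c i)\<^sup>2 * measure \<Lambda> (B i))"
proof -
  let ?Y = "\<lambda>i \<omega>. measure (Q \<omega>) (B i) - measure \<Lambda> (B i)"
  have Ym: "?Y i \<in> borel_measurable M" if "i \<in> I" for i
    using poisson_count_centered(1)[OF Q B(1,2)] that by blast
  have prod: "integrable M (\<lambda>\<omega>. ?Y i \<omega> * ?Y j \<omega>)" if ij: "i \<in> I" "j \<in> I" for i j
  proof (rule Bochner_Integration.integrable_bound)
    show "integrable M (\<lambda>\<omega>. (?Y i \<omega>)\<^sup>2 + (?Y j \<omega>)\<^sup>2)"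
      using poisson_count_centered(3)[OF Q B(1,2)] ij by (intro Bochner_Integration.integrable_add) auto
    show "(\<lambda>\<omega>. ?Y i \<omega> * ?Y j \<omega>) \<in> borel_measurable M"
      using Ym ij by (intro borel_measurable_times) auto
    have "\<bar>x * y\<bar> \<le> x\<^sup>2 + y\<^sup>2" for x y :: real
    proof -
      have "2 * (\<bar>x\<bar> * \<bar>y\<bar>) \<le> \<bar>x\<bar>\<^sup>2 + \<bar>y\<bar>\<^sup>2" using sum_squares_bound[of "\<bar>x\<bar>" "\<bar>y\<bar>"] by simp
      moreover have "0 \<le> \<bar>x\<bar> * \<bar>y\<bar>" by simp
      ultimately show ?thesis unfolding abs_mult power2_abs by linarith
    qed
    then show "AE \<omega> in M. norm (?Y i \<omega> * ?Y j \<omega>) \<le> norm ((?Y i \<omega>)\<^sup>2 + (?Y j \<omega>)\<^sup>2)"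
      by (intro AE_I2) (simp only: real_norm_def, rule order_trans, assumption, rule abs_ge_self)
  qed
  have cov: "expectation (\<lambda>\<omega>. ?Y i \<omega> * ?Y j \<omega>) = (if i = j then measure \<Lambda> (B i) else 0)"
    if ij: "i \<in> I" "j \<in> I" for i j
  proof (cases "i = j")
    case True
    then show ?thesis using poisson_count_centered(4)[OF Q B(1,2)] ij by (simp add: power2_eq_square)
  next
    case False
    then show ?thesis using poisson_count_uncorrelated[OF Q B(1,2) B(1,2), of i j] ij disj
      by (auto simp: disjoint_family_on_def)
  qed
  have sq: "((\<Sum>i\<in>I. c i * measure (Q \<omega>) (B i)) - (\<Sum>i\<in>I. c i * measure \<Lambda> (B i)))\<^sup>2 =
      (\<Sum>i\<in>I. \<Sum>j\<in>I. c i * c j * (?Y i \<omega> * ?Y j \<omega>))" for \<omega>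
    unfolding sum_subtractf[symmetric] right_diff_distrib[symmetric]
    by (simp add: power2_eq_square sum_product mult_ac)
  have int: "integrable M (\<lambda>\<omega>. \<Sum>i\<in>I. \<Sum>j\<in>I. c i * c j * (?Y i \<omega> * ?Y j \<omega>))"
    by (intro Bochner_Integration.integrable_sum integrable_mult_right prod)
  have "expectation (\<lambda>\<omega>. \<Sum>i\<in>I. \<Sum>j\<in>I. c i * c j * (?Y i \<omega> * ?Y j \<omega>)) =
      (\<Sum>i\<in>I. \<Sum>j\<in>I. c i * c j * expectation (\<lambda>\<omega>. ?Y i \<omega> * ?Y j \<omega>))"
    using prod by (subst Bochner_Integration.integral_sum)
      (auto intro!: Bochner_Integration.integrable_sum sum.cong simp: Bochner_Integration.integral_sum)
  also have "\<dots> = (\<Sum>i\<in>I. (c i)\<^sup>2 * measure \<Lambda> (B i))"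
    using I by (auto intro!: sum.cong simp: cov if_distrib[of "(*) _"] sum.delta power2_eq_square cong: if_cong)
  finally have E: "expectation (\<lambda>\<omega>. \<Sum>i\<in>I. \<Sum>j\<in>I. c i * c j * (?Y i \<omega> * ?Y j \<omega>)) =
    (\<Sum>i\<in>I. (c i)\<^sup>2 * measure \<Lambda> (B i))" .
  show ?thesis
    unfolding E[symmetric] sq
    by (rule nn_integral_eq_integral[OF int]) (auto simp flip: sq)
qed

end

lemma simple_function_integrals:
  fixes s :: "'b \<Rightarrow> real"
  assumes s: "simple_function \<Lambda> s"
  defines "I \<equiv> s ` space \<Lambda> - {0}" and "B \<equiv> \<lambda>y. s -` {y} \<inter> space \<Lambda>"
  shows "finite I" "\<And>y. B y \<in> sets \<Lambda>" "disjoint_family_on B I"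
    "\<And>N. sets N = sets \<Lambda> \<Longrightarrow> (\<And>y. y \<in> I \<Longrightarrow> emeasure N (B y) < \<infinity>) \<Longrightarrow>
      integral\<^sup>L N s = (\<Sum>y\<in>I. y * measure N (B y))"
    "(\<And>y. y \<in> I \<Longrightarrow> emeasure \<Lambda> (B y) < \<infinity>) \<Longrightarrow>
      (\<integral>\<^sup>+ x. ennreal ((s x)\<^sup>2) \<partial>\<Lambda>) = ennreal (\<Sum>y\<in>I. y\<^sup>2 * measure \<Lambda> (B y))"
proof -
  show I: "finite I" using simple_functionD(1)[OF s] by (simp add: I_def)
  show B: "B y \<in> sets \<Lambda>" for y using simple_functionD(2)[OF s] by (simp add: B_def)
  show "disjoint_family_on B I" by (auto simp: disjoint_family_on_def B_def)
  have eq: "h (s x) = (\<Sum>y\<in>I. h y * indicator (B y) x)" if "x \<in> space \<Lambda>" "h 0 = 0" for x and h :: "real \<Rightarrow> real"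
  proof (cases "s x = 0")
    case True
    then have "(\<Sum>y\<in>I. h y * indicator (B y) x) = 0"
      by (intro sum.neutral) (auto simp: I_def B_def indicator_def)
    then show ?thesis using True that by simp
  next
    case False
    then have "(\<Sum>y\<in>I. h y * indicator (B y) x) = (\<Sum>y\<in>{s x}. h y * indicator (B y) x)"
      using I that by (intro sum.mono_neutral_right) (auto simp: I_def B_def indicator_def)
    then show ?thesis using that by (simp add: B_def)
  qed
  show "integral\<^sup>L N s = (\<Sum>y\<in>I. y * measure N (B y))"
    if N: "sets N = sets \<Lambda>" "\<And>y. y \<in> I \<Longrightarrow> emeasure N (B y) < \<infinity>" for N
  proof -
    have sp: "space N = space \<Lambda>" by (rule sets_eq_imp_space_eq[OF N(1)])
    have "integral\<^sup>L N s = (\<integral> x. (\<Sum>y\<in>I. y * indicator (B y) x) \<partial>N)"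
      using eq[of _ "\<lambda>x. x"] sp by (intro Bochner_Integration.integral_cong) auto
    also have "\<dots> = (\<Sum>y\<in>I. \<integral> x. y * indicator (B y) x \<partial>N)"
      using N B by (intro Bochner_Integration.integral_sum) auto
    also have "\<dots> = (\<Sum>y\<in>I. y * measure N (B y))"
      using sp by (intro sum.cong) (auto simp: B_def Int_absorb2)
    finally show ?thesis .
  qed
  show "(\<integral>\<^sup>+ x. ennreal ((s x)\<^sup>2) \<partial>\<Lambda>) = ennreal (\<Sum>y\<in>I. y\<^sup>2 * measure \<Lambda> (B y))"
    if fin: "\<And>y. y \<in> I \<Longrightarrow> emeasure \<Lambda> (B y) < \<infinity>"
  proof -
    have "(\<integral>\<^sup>+ x. ennreal ((s x)\<^sup>2) \<partial>\<Lambda>) = (\<integral>\<^sup>+ x. ennreal (\<Sum>y\<in>I. y\<^sup>2 * indicator (B y) x) \<partial>\<Lambda>)"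
      using eq[of _ "\<lambda>x. x\<^sup>2"] by (intro nn_integral_cong) auto
    also have "\<dots> = (\<integral>\<^sup>+ x. (\<Sum>y\<in>I. ennreal (y\<^sup>2) * indicator (B y) x) \<partial>\<Lambda>)"
      by (intro nn_integral_cong)
         (subst sum_ennreal[symmetric], auto simp: ennreal_mult intro!: sum.cong simp flip: ennreal_indicator)
    also have "\<dots> = (\<Sum>y\<in>I. ennreal (y\<^sup>2) * emeasure \<Lambda> (B y))"
      using B by (subst nn_integral_sum) (auto simp: nn_integral_cmult_indicator)
    also have "\<dots> = (\<Sum>y\<in>I. ennreal (y\<^sup>2 * measure \<Lambda> (B y)))"
      using fin by (intro sum.cong) (auto simp: emeasure_eq_ennreal_measure ennreal_mult less_top)
    finally show ?thesis by (simp add: sum_ennreal)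
  qed
qed

text \<open>
  For simple functions the two sides agree. Dominated convergence, applied to almost every realisation
  of the measure, and Fatou's lemma carry the inequality over to the limit of an approximating sequence.
\<close>

lemma (in prob_space) poisson_L2_bound:
  fixes g :: "'b \<Rightarrow> real"
  assumes Q: "poisson_random_measure M Q \<Lambda>"
    and g: "integrable \<Lambda> g" "(\<integral>\<^sup>+ x. ennreal ((g x)\<^sup>2) \<partial>\<Lambda>) < \<infinity>"
  shows "(\<integral>\<^sup>+ \<omega>. ennreal ((integral\<^sup>L (Q \<omega>) g - integral\<^sup>L \<Lambda> g)\<^sup>2) \<partial>M) \<le> (\<integral>\<^sup>+ x. ennreal ((g x)\<^sup>2) \<partial>\<Lambda>)"
proof -
  have [measurable]: "g \<in> borel_measurable \<Lambda>" using g by auto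
  obtain s where s: "\<And>i. simple_function \<Lambda> (s i)" "\<And>i. emeasure \<Lambda> {y \<in> space \<Lambda>. s i y \<noteq> 0} \<noteq> \<infinity>"
      "\<And>x. x \<in> space \<Lambda> \<Longrightarrow> (\<lambda>i. s i x) \<longlonglongrightarrow> g x"
      "\<And>x i. x \<in> space \<Lambda> \<Longrightarrow> norm (s i x) \<le> 2 * norm (g x)"
    using integrable_implies_simple_function_sequence[OF g(1)] by blast
  have [measurable]: "s i \<in> borel_measurable \<Lambda>" for i by (rule borel_measurable_simple_function[OF s(1)])
  let ?D = "\<lambda>h \<omega>. ennreal ((integral\<^sup>L (Q \<omega>) h - integral\<^sup>L \<Lambda> h)\<^sup>2)"
  have [measurable]: "(\<lambda>\<omega>. integral\<^sup>L (Q \<omega>) (s i)) \<in> borel_measurable M" for i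
    by (rule poisson_integral_measurable[OF Q]) simp
  have simple: "(\<integral>\<^sup>+ \<omega>. ?D (s i) \<omega> \<partial>M) = (\<integral>\<^sup>+ x. ennreal ((s i x)\<^sup>2) \<partial>\<Lambda>)" for i
  proof -
    let ?I = "s i ` space \<Lambda> - {0}" and ?B = "\<lambda>y. s i -` {y} \<inter> space \<Lambda>"
    note S = simple_function_integrals[OF s(1)[of i]]
    have fin: "emeasure \<Lambda> (?B y) < \<infinity>" if "y \<in> ?I" for y
    proof -
      have "emeasure \<Lambda> (?B y) \<le> emeasure \<Lambda> {y \<in> space \<Lambda>. s i y \<noteq> 0}"
        using that by (intro emeasure_mono) auto
      then show ?thesis using s(2)[of i] by (auto simp: less_top intro: le_less_trans)
    qed
    have "AE \<omega> in M. \<forall>y\<in>?I. emeasure (Q \<omega>) (?B y) < \<infinity>"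
      using S(1) by (intro AE_finite_allI poisson_count(1)[OF Q S(2) fin]) auto
    with AE_space have "AE \<omega> in M. integral\<^sup>L (Q \<omega>) (s i) = (\<Sum>y\<in>?I. y * measure (Q \<omega>) (?B y))"
      by eventually_elim (rule S(4), use poisson_random_measureD(1)[OF Q] in auto)
    moreover have "integral\<^sup>L \<Lambda> (s i) = (\<Sum>y\<in>?I. y * measure \<Lambda> (?B y))"
      by (rule S(4)) (use fin in auto)
    ultimately have "(\<integral>\<^sup>+ \<omega>. ?D (s i) \<omega> \<partial>M) = (\<integral>\<^sup>+ \<omega>. ennreal (((\<Sum>y\<in>?I. y * measure (Q \<omega>) (?B y)) -
        (\<Sum>y\<in>?I. y * measure \<Lambda> (?B y)))\<^sup>2) \<partial>M)"
      by (intro nn_integral_cong_AE) auto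
    also have "\<dots> = ennreal (\<Sum>y\<in>?I. y\<^sup>2 * measure \<Lambda> (?B y))"
      by (rule poisson_variance_simple[OF Q S(1,2) fin S(3)])
    also have "\<dots> = (\<integral>\<^sup>+ x. ennreal ((s i x)\<^sup>2) \<partial>\<Lambda>)"
      by (rule S(5)[symmetric]) (use fin in auto)
    finally show ?thesis .
  qed
  have conv: "(\<lambda>i. integral\<^sup>L N (s i)) \<longlonglongrightarrow> integral\<^sup>L N g" if N: "sets N = sets \<Lambda>" "integrable N g" for N
  proof (rule integral_dominated_convergence[where w = "\<lambda>x. 2 * norm (g x)"])
    note [measurable_cong] = N(1)
    show "g \<in> borel_measurable N" "s i \<in> borel_measurable N" for i by measurable
    show "integrable N (\<lambda>x. 2 * norm (g x))" using N by auto
    show "AE x in N. (\<lambda>i. s i x) \<longlonglongrightarrow> g x" "AE x in N. norm (s i x) \<le> 2 * norm (g x)" for i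
      using s(3,4) sets_eq_imp_space_eq[OF N(1)] by auto
  qed
  have "AE \<omega> in M. (\<lambda>i. ?D (s i) \<omega>) \<longlonglongrightarrow> ?D g \<omega>"
    using AE_space poisson_AE_integrable[OF Q g(1)]
    by eventually_elim (intro tendsto_ennrealI tendsto_power tendsto_diff conv[OF _ g(1)] conv, use poisson_random_measureD(1)[OF Q] in auto)
  then have "AE \<omega> in M. ?D g \<omega> = liminf (\<lambda>i. ?D (s i) \<omega>)"
    by eventually_elim (rule lim_imp_Liminf[symmetric], simp)
  then have "(\<integral>\<^sup>+ \<omega>. ?D g \<omega> \<partial>M) = (\<integral>\<^sup>+ \<omega>. liminf (\<lambda>i. ?D (s i) \<omega>) \<partial>M)"
    by (rule nn_integral_cong_AE)
  also have "\<dots> \<le> liminf (\<lambda>i. \<integral>\<^sup>+ \<omega>. ?D (s i) \<omega> \<partial>M)"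
    by (rule nn_integral_liminf) measurable
  also have "\<dots> = liminf (\<lambda>i. \<integral>\<^sup>+ x. ennreal ((s i x)\<^sup>2) \<partial>\<Lambda>)"
    unfolding simple ..
  also have "\<dots> = (\<integral>\<^sup>+ x. ennreal ((g x)\<^sup>2) \<partial>\<Lambda>)"
  proof (rule lim_imp_Liminf, simp, rule nn_integral_dominated_convergence[where w = "\<lambda>x. 4 * ennreal ((g x)\<^sup>2)"])
    show "(\<integral>\<^sup>+ x. 4 * ennreal ((g x)\<^sup>2) \<partial>\<Lambda>) < \<infinity>"
      using g(2) by (subst nn_integral_cmult) (auto simp: ennreal_mult_less_top)
    show "AE x in \<Lambda>. (\<lambda>i. ennreal ((s i x)\<^sup>2)) \<longlonglongrightarrow> ennreal ((g x)\<^sup>2)"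
      using s(3) by (intro AE_I2 tendsto_ennrealI tendsto_power)
    show "AE x in \<Lambda>. ennreal ((s i x)\<^sup>2) \<le> 4 * ennreal ((g x)\<^sup>2)" for i
    proof (rule AE_I2)
      fix x assume "x \<in> space \<Lambda>"
      then have "(s i x)\<^sup>2 \<le> (2 * g x)\<^sup>2" using s(4)[of x i] unfolding abs_le_square_iff[symmetric] by (simp add: abs_mult)
      then have "ennreal ((s i x)\<^sup>2) \<le> ennreal (4 * (g x)\<^sup>2)" by (intro ennreal_leI) (simp add: power_mult_distrib)
      then show "ennreal ((s i x)\<^sup>2) \<le> 4 * ennreal ((g x)\<^sup>2)" by (simp add: ennreal_mult)
    qed
  qed auto
  finally show ?thesis .
qed

section \<open>Finite dimensional distributions\<close>

text \<open>
  Approximating the coordinates by simple functions avoids comparing the product \<open>\<sigma>\<close>-algebra with the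
  Borel sets of the product topology: for simple coordinates the composition takes finitely many values,
  and continuity passes to the limit.
\<close>

lemma borel_measurable_continuous_fdd:
  fixes y :: "'t \<Rightarrow> 'w \<Rightarrow> 'a::euclidean_space"
  assumes J: "finite J" and y: "\<And>t. t \<in> J \<Longrightarrow> y t \<in> borel_measurable M"
    and h: "continuous_map (product_topology (\<lambda>_. euclidean) J) euclideanreal h"
  shows "(\<lambda>\<omega>. h (\<lambda>t\<in>J. y t \<omega>)) \<in> borel_measurable M"
proof -
  have "\<forall>t\<in>J. \<exists>F. (\<forall>i. simple_function M (F i)) \<and> (\<forall>x\<in>space M. (\<lambda>i. F i x) \<longlonglongrightarrow> y t x)"
    using borel_measurable_implies_sequence_metric[OF y, of _ 0] by blast
  from bchoice[OF this] obtain G where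
    G: "\<And>t i. t \<in> J \<Longrightarrow> simple_function M (G t i)"
      "\<And>t \<omega>. t \<in> J \<Longrightarrow> \<omega> \<in> space M \<Longrightarrow> (\<lambda>i. G t i \<omega>) \<longlonglongrightarrow> y t \<omega>"
    by blast
  have "simple_function M (\<lambda>\<omega>. \<lambda>t\<in>J. G t i \<omega>)" for i
    unfolding simple_function_def
  proof (intro conjI ballI)
    show "finite ((\<lambda>\<omega>. \<lambda>t\<in>J. G t i \<omega>) ` space M)"
    proof (rule finite_subset)
      show "(\<lambda>\<omega>. \<lambda>t\<in>J. G t i \<omega>) ` space M \<subseteq> (\<Pi>\<^sub>E t\<in>J. G t i ` space M)" by auto
      show "finite (\<Pi>\<^sub>E t\<in>J. G t i ` space M)"
        using J simple_functionD(1)[OF G(1)] by (intro finite_PiE) auto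
    qed
    fix x assume "x \<in> (\<lambda>\<omega>. \<lambda>t\<in>J. G t i \<omega>) ` space M"
    then have "x \<in> extensional J" by auto
    then have "(\<lambda>\<omega>. \<lambda>t\<in>J. G t i \<omega>) -` {x} \<inter> space M = {\<omega>\<in>space M. \<forall>t\<in>J. G t i \<omega> = x t}"
      by (auto intro!: extensionalityI[of _ J])
    also have "\<dots> \<in> sets M"
    proof (rule sets.sets_Collect_finite_All[OF _ J])
      fix t assume "t \<in> J"
      from simple_functionD(2)[OF G(1)[OF this, of i], of "{x t}"]
      show "{\<omega>\<in>space M. G t i \<omega> = x t} \<in> sets M"
        by (rule back_subst) auto
    qed
    finally show "(\<lambda>\<omega>. \<lambda>t\<in>J. G t i \<omega>) -` {x} \<inter> space M \<in> sets M" .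
  qed
  then have "simple_function M (h \<circ> (\<lambda>\<omega>. \<lambda>t\<in>J. G t i \<omega>))" for i
    by (rule simple_function_compose)
  then have m: "(\<lambda>\<omega>. h (\<lambda>t\<in>J. G t i \<omega>)) \<in> borel_measurable M" for i
    using borel_measurable_simple_function by (fastforce simp: comp_def)
  show ?thesis
  proof (rule borel_measurable_LIMSEQ_metric[OF m])
    fix \<omega> assume \<omega>: "\<omega> \<in> space M"
    have "limitin (product_topology (\<lambda>_. euclidean) J) (\<lambda>i. \<lambda>t\<in>J. G t i \<omega>) (\<lambda>t\<in>J. y t \<omega>) sequentially"
      using G(2)[OF _ \<omega>] by (auto simp: limitin_componentwise)
    from continuous_map_limit[OF h this]
    show "(\<lambda>i. h (\<lambda>t\<in>J. G t i \<omega>)) \<longlonglongrightarrow> h (\<lambda>t\<in>J. y t \<omega>)"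
      by (simp add: comp_def)
  qed
qed

lemma continuous_map_product_near_zero:
  fixes h :: "('t \<Rightarrow> 'a::real_normed_vector) \<Rightarrow> real"
  assumes J: "finite J" and e: "e > 0"
    and h: "continuous_map (product_topology (\<lambda>_. euclidean) J) euclideanreal h"
  obtains \<delta> where "\<delta> > 0"
    "\<And>x. x \<in> J \<rightarrow>\<^sub>E UNIV \<Longrightarrow> (\<And>t. t \<in> J \<Longrightarrow> norm (x t) \<le> \<delta>) \<Longrightarrow> \<bar>h x - h (\<lambda>t\<in>J. 0)\<bar> < e"
proof -
  let ?X = "product_topology (\<lambda>_. euclidean) J :: ('t \<Rightarrow> 'a) topology"
  let ?S = "{x \<in> topspace ?X. h x \<in> ball (h (\<lambda>t\<in>J. 0)) e}"
  have "openin ?X ?S" by (rule openin_continuous_map_preimage[OF h]) simp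
  moreover have "(\<lambda>t\<in>J. 0) \<in> ?S" using e by (simp add: topspace_product_topology)
  ultimately obtain V where V: "\<forall>t\<in>J. openin euclidean (V t)" "(\<lambda>t\<in>J. 0) \<in> Pi\<^sub>E J V" "Pi\<^sub>E J V \<subseteq> ?S"
    unfolding openin_product_topology_alt by blast
  have "\<forall>t\<in>J. \<exists>d>0. cball 0 d \<subseteq> V t"
  proof
    fix t assume t: "t \<in> J"
    then have "0 \<in> V t" using V(2) by (auto simp: PiE_iff)
    with V(1) t show "\<exists>d>0. cball 0 d \<subseteq> V t" by (auto simp: open_contains_cball)
  qed
  from bchoice[OF this] obtain d where d: "\<forall>t\<in>J. d t > 0 \<and> cball 0 (d t) \<subseteq> V t" by auto
  let ?\<delta> = "Min (insert 1 (d ` J))"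
  show ?thesis
  proof (rule that[of ?\<delta>])
    show "?\<delta> > 0" using J d by (subst Min_gr_iff) auto
    fix x :: "'t \<Rightarrow> 'a" assume x: "x \<in> J \<rightarrow>\<^sub>E UNIV" "\<And>t. t \<in> J \<Longrightarrow> norm (x t) \<le> ?\<delta>"
    have "x t \<in> V t" if t: "t \<in> J" for t
    proof -
      have "?\<delta> \<le> d t" using J t by (intro Min_le) auto
      then have "x t \<in> cball 0 (d t)" using x(2)[OF t] by simp
      with d t show ?thesis by blast
    qed
    with x(1) have "x \<in> Pi\<^sub>E J V" by (auto simp: PiE_iff)
    with V(3) have "h x \<in> ball (h (\<lambda>t\<in>J. 0)) e" by blast
    then show "\<bar>h x - h (\<lambda>t\<in>J. 0)\<bar> < e" by (simp add: dist_real_def abs_minus_commute)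
  qed
qed

text \<open>
  A bounded test function differs from its value at the origin by little where all finitely many
  coordinates are small, and by at most twice its bound on the complement, whose probability vanishes.
\<close>

lemma (in prob_space) fdd_converges_zeroI:
  fixes Y :: "'i \<Rightarrow> real \<Rightarrow> 'a \<Rightarrow> 'c::euclidean_space"
  assumes meas: "\<And>i t. t \<in> I \<Longrightarrow> Y i t \<in> borel_measurable M"
    and conv: "\<And>t e. t \<in> I \<Longrightarrow> e > 0 \<Longrightarrow> ((\<lambda>i. prob {\<omega>\<in>space M. norm (Y i t \<omega>) > e}) \<longlongrightarrow> 0) F"
  shows "fdd_converges M I Y (\<lambda>t \<omega>. 0) F"
  unfolding fdd_converges_def
proof (intro allI impI)
  fix J and h :: "(real \<Rightarrow> 'c) \<Rightarrow> real"
  assume J: "finite J" "J \<subseteq> I" and h: "continuous_map (product_topology (\<lambda>_. euclidean) J) euclideanreal h"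
    and bdd: "bounded (h ` (J \<rightarrow>\<^sub>E UNIV))"
  obtain C where C: "\<And>x. x \<in> J \<rightarrow>\<^sub>E UNIV \<Longrightarrow> \<bar>h x\<bar> \<le> C"
    using bdd unfolding bounded_iff by auto
  let ?Y = "\<lambda>i \<omega>. \<lambda>t\<in>J. Y i t \<omega>" and ?z = "\<lambda>t\<in>J. 0 :: 'c"
  have C0: "C \<ge> 0" using C[of ?z] by fastforce
  have hm[measurable]: "(\<lambda>\<omega>. h (?Y i \<omega>)) \<in> borel_measurable M" for i
    using J meas by (intro borel_measurable_continuous_fdd[OF _ _ h]) auto
  have int: "integrable M (\<lambda>\<omega>. h (?Y i \<omega>))" for i
    by (rule integrable_const_bound[where B = C]) (auto intro!: C)
  have "((\<lambda>i. expectation (\<lambda>\<omega>. h (?Y i \<omega>))) \<longlongrightarrow> h ?z) F"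
  proof (rule tendstoI)
    fix e :: real assume e: "e > 0"
    obtain \<delta> where \<delta>: "\<delta> > 0"
      "\<And>x. x \<in> J \<rightarrow>\<^sub>E UNIV \<Longrightarrow> (\<And>t. t \<in> J \<Longrightarrow> norm (x t) \<le> \<delta>) \<Longrightarrow> \<bar>h x - h ?z\<bar> < e / 2"
      using continuous_map_product_near_zero[OF J(1) _ h, of "e / 2"] e by auto
    let ?A = "\<lambda>i t. {\<omega>\<in>space M. norm (Y i t \<omega>) > \<delta>}"
    have A: "?A i t \<in> sets M" if "t \<in> J" for i t
    proof -
      have [measurable]: "Y i t \<in> borel_measurable M" using meas J that by auto
      show ?thesis by measurable
    qed
    have bound: "\<bar>expectation (\<lambda>\<omega>. h (?Y i \<omega>)) - h ?z\<bar> \<le> e / 2 + 2 * C * (\<Sum>t\<in>J. prob (?A i t))" for i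
    proof -
      have iA: "integrable M (indicator (?A i t) :: _ \<Rightarrow> real)" if "t \<in> J" for t
        using A[OF that] by (simp add: less_top[symmetric])
      have "\<bar>expectation (\<lambda>\<omega>. h (?Y i \<omega>)) - h ?z\<bar> = \<bar>expectation (\<lambda>\<omega>. h (?Y i \<omega>) - h ?z)\<bar>"
        using int by (simp add: prob_space)
      also have "\<dots> \<le> expectation (\<lambda>\<omega>. \<bar>h (?Y i \<omega>) - h ?z\<bar>)" by (rule integral_abs_bound)
      also have "\<dots> \<le> expectation (\<lambda>\<omega>. e / 2 + 2 * C * (\<Sum>t\<in>J. indicator (?A i t) \<omega>))"
      proof (rule integral_mono)
        show "integrable M (\<lambda>\<omega>. \<bar>h (?Y i \<omega>) - h ?z\<bar>)" using int by auto
        show "integrable M (\<lambda>\<omega>. e / 2 + 2 * C * (\<Sum>t\<in>J. indicator (?A i t) \<omega>))"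
          using iA by (intro Bochner_Integration.integrable_add integrable_mult_right Bochner_Integration.integrable_sum) auto
        fix \<omega> assume \<omega>: "\<omega> \<in> space M"
        show "\<bar>h (?Y i \<omega>) - h ?z\<bar> \<le> e / 2 + 2 * C * (\<Sum>t\<in>J. indicator (?A i t) \<omega>)"
        proof (cases "\<forall>t\<in>J. norm (Y i t \<omega>) \<le> \<delta>")
          case True
          then have "\<bar>h (?Y i \<omega>) - h ?z\<bar> < e / 2" by (intro \<delta>(2)) auto
          moreover have "0 \<le> 2 * C * (\<Sum>t\<in>J. indicator (?A i t) \<omega>)"
            using C0 by (intro mult_nonneg_nonneg sum_nonneg) auto
          ultimately show ?thesis by linarith
        next
          case False
          then obtain t where t: "t \<in> J" "norm (Y i t \<omega>) > \<delta>" by auto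
          have "(1::real) = indicator (?A i t) \<omega>" using t \<omega> by simp
          also have "\<dots> \<le> (\<Sum>t\<in>J. indicator (?A i t) \<omega>)" using J(1) t by (intro member_le_sum) auto
          finally have "2 * C * 1 \<le> 2 * C * (\<Sum>t\<in>J. indicator (?A i t) \<omega>)"
            using C0 by (intro mult_left_mono) auto
          moreover have "\<bar>h (?Y i \<omega>) - h ?z\<bar> \<le> C + C"
            using C[of "?Y i \<omega>"] C[of ?z] by auto
          ultimately show ?thesis using e by linarith
        qed
      qed
      also have "\<dots> = e / 2 + 2 * C * (\<Sum>t\<in>J. prob (?A i t))"
      proof -
        have "expectation (\<lambda>\<omega>. \<Sum>t\<in>J. indicator (?A i t) \<omega> :: real) = (\<Sum>t\<in>J. prob (?A i t))"
          using iA A by (subst Bochner_Integration.integral_sum) (auto intro!: sum.cong arg_cong[where f = prob])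
        moreover have "integrable M (\<lambda>\<omega>. \<Sum>t\<in>J. indicator (?A i t) \<omega> :: real)"
          using iA by (intro Bochner_Integration.integrable_sum) auto
        ultimately show ?thesis by (simp add: prob_space)
      qed
      finally show ?thesis .
    qed
    have "((\<lambda>i. 2 * C * (\<Sum>t\<in>J. prob (?A i t))) \<longlongrightarrow> 2 * C * (\<Sum>t\<in>J. 0)) F"
      using J \<delta>(1) by (intro tendsto_mult tendsto_const tendsto_sum conv) auto
    then have "eventually (\<lambda>i. 2 * C * (\<Sum>t\<in>J. prob (?A i t)) < e / 2) F"
      using e by (intro order_tendstoD(2)) auto
    then show "eventually (\<lambda>i. dist (expectation (\<lambda>\<omega>. h (?Y i \<omega>))) (h ?z) < e) F"
    proof eventually_elim
      case (elim i)
      then show ?case using bound[of i] by (simp add: dist_real_def)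
    qed
  qed
  then show "((\<lambda>i. expectation (\<lambda>\<omega>. h (?Y i \<omega>))) \<longlongrightarrow> expectation (\<lambda>\<omega>. h ?z)) F"
    by (simp add: prob_space)
qed

section \<open>Shot noise measures\<close>

lemma borel_measurable_shot_noise:
  assumes U: "U \<in> M \<rightarrow>\<^sub>M S"
    and H: "(\<lambda>(r, u). H r u) \<in> (restrict_space borel {0<..} \<Otimes>\<^sub>M S) \<rightarrow>\<^sub>M borel"
  shows "(\<lambda>(r::real, \<omega>). H r (U \<omega>)) \<in> (restrict_space borel {0<..} \<Otimes>\<^sub>M M) \<rightarrow>\<^sub>M borel"
proof -
  have "(\<lambda>x. (fst x, U (snd x))) \<in>
      (restrict_space borel {0<..} \<Otimes>\<^sub>M M) \<rightarrow>\<^sub>M (restrict_space borel {0<..} \<Otimes>\<^sub>M S)"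
    using U by measurable
  from measurable_compose[OF this H] show ?thesis by (simp add: case_prod_beta)
qed

text \<open>
  The shot noise measure is the image of Lebesgue measure times the probability measure under
  \<open>(r, \<omega>) \<mapsto> H r (U \<omega>)\<close>, restricted to the complement of the origin. The claim is the change of
  variables formula together with Tonelli's theorem.
\<close>

lemma nn_integral_shot_noise_measure:
  fixes H :: "real \<Rightarrow> 'u \<Rightarrow> 'a::euclidean_space"
  assumes M: "prob_space M" and U: "U \<in> M \<rightarrow>\<^sub>M S"
    and H: "(\<lambda>(r, u). H r u) \<in> (restrict_space borel {0<..} \<Otimes>\<^sub>M S) \<rightarrow>\<^sub>M borel"
    and I: "I \<in> sets borel" "I \<subseteq> {0<..}" and g: "g \<in> borel_measurable borel"
  shows "(\<integral>\<^sup>+ z. g z \<partial>shot_noise_measure M H U I) =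
    (\<integral>\<^sup>+ r \<in> I. (\<integral>\<^sup>+ \<omega>. g (H r (U \<omega>)) * indicator (- {0}) (H r (U \<omega>)) \<partial>M) \<partial>lborel)"
proof -
  interpret prob_space M by fact
  let ?R = "restrict_space lborel I"
  let ?F = "\<lambda>(r, \<omega>). H r (U \<omega>)"
  let ?K = "restrict_space (distr (?R \<Otimes>\<^sub>M M) borel ?F) (- {0})"
  have [measurable]: "?F \<in> (?R \<Otimes>\<^sub>M M) \<rightarrow>\<^sub>M borel"
  proof -
    have "(\<lambda>x. x) \<in> ?R \<rightarrow>\<^sub>M restrict_space borel {0<..}"
      using I by (intro measurable_restrict_space2 measurable_restrict_space1) (auto simp: space_restrict_space)
    then have "(\<lambda>x. (fst x, snd x)) \<in> (?R \<Otimes>\<^sub>M M) \<rightarrow>\<^sub>M (restrict_space borel {0<..} \<Otimes>\<^sub>M M)"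
      by (intro measurable_Pair) (auto intro: measurable_compose[OF measurable_fst])
    from measurable_compose[OF this borel_measurable_shot_noise[OF U H]] show ?thesis by simp
  qed
  have K: "shot_noise_measure M H U I = ?K"
  proof (rule measure_eqI)
    show s: "sets (shot_noise_measure M H U I) = sets ?K"
      by (simp add: sets_shot_noise_measure cong: sets_restrict_space_cong)
    fix B assume "B \<in> sets (shot_noise_measure M H U I)"
    then have B: "B \<in> sets (punctured_borel :: 'a measure)" by (simp add: sets_shot_noise_measure)
    then have Bb[measurable]: "B \<in> sets borel" and "B \<subseteq> - {0}" by (auto simp: sets_restrict_space_iff)
    then have "emeasure ?K B = emeasure (?R \<Otimes>\<^sub>M M) (?F -` B \<inter> space (?R \<Otimes>\<^sub>M M))"
      by (subst emeasure_restrict_space) (auto simp: emeasure_distr)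
    also have "\<dots> = (\<integral>\<^sup>+ r. emeasure M (Pair r -` (?F -` B \<inter> space (?R \<Otimes>\<^sub>M M))) \<partial>?R)"
      by (rule emeasure_pair_measure_alt) measurable
    also have "\<dots> = (\<integral>\<^sup>+ r. emeasure M {\<omega> \<in> space M. H r (U \<omega>) \<in> B} \<partial>?R)"
      by (intro nn_integral_cong arg_cong[where f = "emeasure M"]) (auto simp: space_pair_measure)
    also have "\<dots> = emeasure (shot_noise_measure M H U I) B"
      using I by (subst emeasure_shot_noise_measure[OF M U H I B]) (simp add: nn_integral_restrict_space)
    finally show "emeasure (shot_noise_measure M H U I) B = emeasure ?K B" by simp
  qed
  have [measurable]: "- {0::'a} \<in> sets borel" by simp
  note [measurable] = g
  have "(\<integral>\<^sup>+ z. g z \<partial>shot_noise_measure M H U I) = (\<integral>\<^sup>+ z. g z * indicator (- {0}) z \<partial>distr (?R \<Otimes>\<^sub>M M) borel ?F)"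
    unfolding K by (rule nn_integral_restrict_space) simp
  also have "\<dots> = (\<integral>\<^sup>+ x. g (?F x) * indicator (- {0}) (?F x) \<partial>(?R \<Otimes>\<^sub>M M))"
    by (rule nn_integral_distr) measurable
  also have "\<dots> = (\<integral>\<^sup>+ r. (\<integral>\<^sup>+ \<omega>. g (?F (r, \<omega>)) * indicator (- {0}) (?F (r, \<omega>)) \<partial>M) \<partial>?R)"
    by (rule nn_integral_fst[symmetric]) measurable
  also have "\<dots> = (\<integral>\<^sup>+ r \<in> I. (\<integral>\<^sup>+ \<omega>. g (H r (U \<omega>)) * indicator (- {0}) (H r (U \<omega>)) \<partial>M) \<partial>lborel)"
    using I by (simp add: nn_integral_restrict_space)
  finally show ?thesis .
qed

lemma emeasure_shot_noise_measure_Un: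
  fixes H :: "real \<Rightarrow> 'u \<Rightarrow> 'a::euclidean_space"
  assumes M: "prob_space M" and U: "U \<in> M \<rightarrow>\<^sub>M S"
    and H: "(\<lambda>(r, u). H r u) \<in> (restrict_space borel {0<..} \<Otimes>\<^sub>M S) \<rightarrow>\<^sub>M borel"
    and I: "I \<in> sets borel" "I \<subseteq> {0<..}" and J: "J \<in> sets borel" "J \<subseteq> {0<..}"
    and disj: "I \<inter> J = {}" and B: "B \<in> sets punctured_borel"
  shows "emeasure (shot_noise_measure M H U (I \<union> J)) B =
    emeasure (shot_noise_measure M H U I) B + emeasure (shot_noise_measure M H U J) B"
proof -
  interpret prob_space M by fact
  let ?R = "restrict_space lborel {0<..}" and ?p = "\<lambda>r. emeasure M {\<omega> \<in> space M. H r (U \<omega>) \<in> B}"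
  let ?F = "\<lambda>(r, \<omega>). H r (U \<omega>)"
  have F: "?F \<in> (restrict_space borel {0<..} \<Otimes>\<^sub>M M) \<rightarrow>\<^sub>M borel"
    by (rule borel_measurable_shot_noise[OF U H])
  have "B \<in> sets borel" using B by (auto simp: sets_restrict_space_iff)
  from measurable_sets[OF F this]
  have "(\<lambda>r. emeasure M (Pair r -` (?F -` B \<inter> space (restrict_space borel {0<..} \<Otimes>\<^sub>M M))))
      \<in> borel_measurable (restrict_space borel {0<..})"
    by (rule measurable_emeasure_Pair)
  also have "?this \<longleftrightarrow> ?p \<in> borel_measurable (restrict_space borel {0<..})"
    by (intro measurable_cong arg_cong[where f = "emeasure M"]) (auto simp: space_pair_measure)
  finally have p: "?p \<in> borel_measurable ?R"
    by (simp cong: measurable_cong_sets sets_restrict_space_cong)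
  have R: "emeasure (shot_noise_measure M H U A) B = (\<integral>\<^sup>+ r. ?p r * indicator A r \<partial>?R)"
    if A: "A \<in> sets borel" "A \<subseteq> {0<..}" for A
  proof -
    have "emeasure (shot_noise_measure M H U A) B = (\<integral>\<^sup>+ r. (?p r * indicator A r) * indicator {0<..} r \<partial>lborel)"
      using A(2) unfolding emeasure_shot_noise_measure[OF M U H A B]
      by (intro nn_integral_cong) (auto simp: indicator_def)
    then show ?thesis by (simp add: nn_integral_restrict_space)
  qed
  have ind: "(indicator A :: real \<Rightarrow> ennreal) \<in> borel_measurable ?R" if "A \<in> sets borel" for A
    using that by (intro measurable_restrict_space1) simp
  have "(\<integral>\<^sup>+ r. ?p r * indicator (I \<union> J) r \<partial>?R) = (\<integral>\<^sup>+ r. ?p r * indicator I r + ?p r * indicator J r \<partial>?R)"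
    using disj by (intro nn_integral_cong) (auto simp: indicator_def)
  also have "\<dots> = (\<integral>\<^sup>+ r. ?p r * indicator I r \<partial>?R) + (\<integral>\<^sup>+ r. ?p r * indicator J r \<partial>?R)"
    by (intro nn_integral_add borel_measurable_times_ennreal p ind I J)
  finally show ?thesis using I J by (simp add: R)
qed

section \<open>The integrand of the stochastic integral\<close>

lemma borel_measurable_punctured:
  assumes "sets N = sets punctured_borel" and "h \<in> borel_measurable borel"
  shows "h \<in> borel_measurable N"
  using measurable_restrict_space1[OF assms(2), of "- {0}"] assms(1) by (simp cong: measurable_cong_sets)

text \<open>
  The norm on matrices, taken as vectors of rows, is the Frobenius norm. The bound per component keeps
  the dimension out of the variance estimate of each coordinate.
\<close>

lemma norm_matrix_vector_component_le:
  fixes A :: "real^'n^'m"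
  shows "\<bar>(A *v z) $ i\<bar> \<le> norm A * norm z"
proof -
  have "\<bar>(A *v z) $ i\<bar> \<le> norm (A $ i) * norm z"
    by (simp add: matrix_vector_mul_component Cauchy_Schwarz_ineq2)
  also have "\<dots> \<le> norm A * norm z" by (intro mult_right_mono Finite_Cartesian_Product.norm_nth_le) auto
  finally show ?thesis .
qed

lemma le_one_plus_square: "y \<le> 1 + y\<^sup>2" for y :: real
  using sum_squares_bound[of 1 y] by (cases "0 \<le> y") (auto intro: order_trans[of y 0])

lemma norm_matrix_vector_le:
  fixes A :: "real^'n^'m"
  shows "norm (A *v z) \<le> real CARD('m) * (norm A * norm z)"
proof -
  have "norm (A *v z) \<le> (\<Sum>i\<in>UNIV. \<bar>(A *v z) $ i\<bar>)" by (rule norm_le_l1_cart)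
  also have "\<dots> \<le> (\<Sum>i\<in>(UNIV::'m set). norm A * norm z)"
    by (intro sum_mono norm_matrix_vector_component_le)
  finally show ?thesis by simp
qed

lemma borel_measurable_matrix_vector_mult[measurable (raw)]:
  fixes A :: "'x \<Rightarrow> real^'n^'m"
  assumes A: "A \<in> borel_measurable M" and z: "z \<in> borel_measurable M"
  shows "(\<lambda>x. A x *v z x) \<in> borel_measurable M"
proof (rule borel_measurable_continuous_Pair[OF A z, of "(*v)"])
  show "continuous_on UNIV (\<lambda>x::(real^'n^'m) \<times> (real^'n). fst x *v snd x)"
    unfolding matrix_vector_mult_def
    by (intro continuous_on_vec_lambda continuous_on_sum continuous_on_mult continuous_on_component
        continuous_on_fst continuous_on_snd continuous_on_id)
qed

text \<open>
  Chebyshev's inequality bounds the mass away from the origin, and the sets involved exhaust the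
  punctured space.
\<close>

lemma sigma_finite_second_moment:
  fixes N :: "('a::euclidean_space) measure"
  assumes N: "sets N = sets punctured_borel" and m2: "(\<integral>\<^sup>+ z. ennreal ((norm z)\<^sup>2) \<partial>N) < \<infinity>"
  shows "0 < \<epsilon> \<Longrightarrow> emeasure N {z. \<epsilon> < norm z} < \<infinity>" "sigma_finite_measure N"
proof -
  have sp: "space N = - {0}" using sets_eq_imp_space_eq[OF N] by (simp add: space_restrict_space)
  have A: "{z::'a. \<epsilon> < norm z} \<in> sets N" if "0 < \<epsilon>" for \<epsilon> :: real
    using that unfolding N by (auto simp: sets_restrict_space_iff)
  note [measurable] = borel_measurable_punctured[OF N]
  show fin: "emeasure N {z. \<epsilon> < norm z} < \<infinity>" if e: "0 < \<epsilon>" for \<epsilon>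
  proof -
    have "emeasure N {z. \<epsilon> < norm z} = (\<integral>\<^sup>+ z. indicator {z. \<epsilon> < norm z} z \<partial>N)" using A[OF e] by simp
    also have "\<dots> \<le> (\<integral>\<^sup>+ z. ennreal (1 / \<epsilon>\<^sup>2) * ennreal ((norm z)\<^sup>2) \<partial>N)"
    proof (rule nn_integral_mono)
      fix z :: 'a
      have "1 \<le> 1 / \<epsilon>\<^sup>2 * (norm z)\<^sup>2" if "\<epsilon> < norm z"
        using power_mono[of \<epsilon> "norm z" 2] that e by (simp add: field_simps)
      then show "indicator {z. \<epsilon> < norm z} z \<le> ennreal (1 / \<epsilon>\<^sup>2) * ennreal ((norm z)\<^sup>2)"
        by (auto simp: indicator_def ennreal_mult[symmetric] simp flip: ennreal_1 intro!: ennreal_leI)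
    qed
    also have "\<dots> = ennreal (1 / \<epsilon>\<^sup>2) * (\<integral>\<^sup>+ z. ennreal ((norm z)\<^sup>2) \<partial>N)"
      by (rule nn_integral_cmult) measurable
    also have "\<dots> < \<infinity>" using m2 by (simp add: ennreal_mult_less_top)
    finally show ?thesis .
  qed
  show "sigma_finite_measure N"
  proof
    let ?A = "\<lambda>k::nat. {z::'a. 1 / real (Suc k) < norm z}"
    have "(\<Union>k. ?A k) = space N"
    proof (intro set_eqI iffI)
      fix z assume "z \<in> space N"
      then have "0 < norm z" by (simp add: sp)
      from reals_Archimedean[OF this] show "z \<in> (\<Union>k. ?A k)" by (auto simp: inverse_eq_divide)
    next
      fix z :: 'a assume "z \<in> (\<Union>k. ?A k)"
      then obtain k where "1 / real (Suc k) < norm z" by blast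
      moreover have "0 < 1 / real (Suc k)" by simp
      ultimately have "0 < norm z" by linarith
      then show "z \<in> space N" by (simp add: sp)
    qed
    moreover have "emeasure N (?A k) \<noteq> \<infinity>" for k using fin[of "1 / real (Suc k)"] by simp
    ultimately show "\<exists>A. countable A \<and> A \<subseteq> sets N \<and> \<Union>A = space N \<and> (\<forall>a\<in>A. emeasure N a \<noteq> \<infinity>)"
      using A by (intro exI[of _ "range ?A"]) auto
  qed
qed

lemma time_intensity_sets:
  assumes "sets N = sets punctured_borel"
  shows "sets (time_intensity N \<T>) = sets (punctured_borel \<Otimes>\<^sub>M restrict_space borel \<T>)"
  unfolding time_intensity_def
  by (intro sets_pair_measure_cong assms) (simp cong: sets_restrict_space_cong)

lemma kernel_measurable:
  fixes g :: "real \<Rightarrow> real^'d^'d" and N :: "(real^'d) measure"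
  assumes N: "sets N = sets punctured_borel" and g: "g \<in> borel_measurable (restrict_space borel \<T>)"
  shows "(\<lambda>x. g (snd x)) \<in> borel_measurable (time_intensity N \<T>)"
    "(\<lambda>x. fst x) \<in> borel_measurable (time_intensity N \<T>)"
    "(\<lambda>(z, s). g s *v z) \<in> borel_measurable (time_intensity N \<T>)"
    "A \<in> sets borel \<Longrightarrow> E \<in> sets borel \<Longrightarrow> A \<times> E \<inter> space (time_intensity N \<T>) \<in> sets (time_intensity N \<T>)"
    "A \<in> sets borel \<Longrightarrow> E \<in> sets borel \<Longrightarrow>
      (\<lambda>x. indicator (A \<times> E) x :: real) \<in> borel_measurable (time_intensity N \<T>)"
proof -
  have "g \<in> borel_measurable (restrict_space lborel \<T>)"
    using g by (simp cong: measurable_cong_sets sets_restrict_space_cong)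
  from measurable_compose[OF measurable_snd this]
  show 1: "(\<lambda>x. g (snd x)) \<in> borel_measurable (time_intensity N \<T>)"
    by (simp add: time_intensity_def)
  have "(\<lambda>z. z) \<in> borel_measurable N" by (rule borel_measurable_punctured[OF N]) simp
  from measurable_compose[OF measurable_fst this]
  show 2: "(\<lambda>x. fst x) \<in> borel_measurable (time_intensity N \<T>)"
    by (simp add: time_intensity_def)
  show "(\<lambda>(z, s). g s *v z) \<in> borel_measurable (time_intensity N \<T>)"
    using borel_measurable_matrix_vector_mult[OF 1 2] by (simp add: case_prod_beta)
  show 3: "A \<times> E \<inter> space (time_intensity N \<T>) \<in> sets (time_intensity N \<T>)" if "A \<in> sets borel" "E \<in> sets borel"
  proof -
    have "A \<inter> space N \<in> sets N"
      using borel_measurable_punctured[OF N, of "indicator A :: _ \<Rightarrow> real"] that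
      by (simp add: borel_measurable_indicator_iff)
    moreover have "E \<inter> \<T> \<in> sets (restrict_space lborel \<T>)"
      using that by (auto simp: sets_restrict_space)
    ultimately have "(A \<inter> space N) \<times> (E \<inter> \<T>) \<in> sets (time_intensity N \<T>)"
      unfolding time_intensity_def by (rule pair_measureI)
    also have "(A \<inter> space N) \<times> (E \<inter> \<T>) = A \<times> E \<inter> space (time_intensity N \<T>)"
      by (auto simp: time_intensity_def space_pair_measure space_restrict_space)
    finally show ?thesis .
  qed
  show "(\<lambda>x. indicator (A \<times> E) x :: real) \<in> borel_measurable (time_intensity N \<T>)" if "A \<in> sets borel" "E \<in> sets borel"
    using 3[OF that] by (simp add: borel_measurable_indicator_iff)
qed

lemma norm_gt_borel: "{z::'a::real_normed_vector. \<epsilon> < norm z} \<in> sets borel"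
  "{z::'a. \<epsilon> < norm z \<and> norm z \<le> c} \<in> sets borel"
  by measurable

lemma truncated_levy_integral_measurable:
  fixes g :: "real \<Rightarrow> real^'d^'d" and N :: "(real^'d) measure"
  assumes N: "sets N = sets punctured_borel" and g: "g \<in> borel_measurable (restrict_space borel \<T>)"
    and Q: "poisson_random_measure M Q (time_intensity N \<T>)" and E: "E \<in> sets borel"
  shows "truncated_levy_integral \<T> Q N g \<epsilon> E \<in> borel_measurable M"
proof -
  have "(\<lambda>\<omega>. \<integral> x. indicator ({z. \<epsilon> < norm z} \<times> E) x *\<^sub>R (case x of (z, s) \<Rightarrow> g s *v z) \<partial>Q \<omega>) \<in> borel_measurable M"
    using kernel_measurable[OF N g] E norm_gt_borel
    by (intro poisson_integral_measurable[OF Q] borel_measurable_scaleR) auto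
  then have "(\<lambda>\<omega>. truncated_levy_integral \<T> Q N g \<epsilon> E \<omega>) \<in> borel_measurable M"
    unfolding truncated_levy_integral_def set_lebesgue_integral_def
    by (rule borel_measurable_diff) simp
  then show ?thesis by simp
qed

section \<open>Exhaustions along which an integral diverges\<close>

text \<open>
  The positive part of \<open>u\<close> has infinite integral, so it can be collected far ahead of the rest: the
  \<open>k\<close>-th set is \<open>Tn k\<close> enlarged by the part of a much later \<open>Tn (J k)\<close> on which \<open>u\<close> is positive, with
  \<open>J k\<close> so large that the surplus outweighs the integral of \<open>\<bar>u\<bar>\<close> over \<open>Tn k\<close>.
\<close>

lemma exists_exhaustion_diverging_pos:
  fixes u :: "real \<Rightarrow> real" and Tn :: "nat \<Rightarrow> real set"
  assumes \<T>: "\<T> \<in> sets borel" and u: "u \<in> borel_measurable (restrict_space lborel \<T>)"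
    and Tn: "incseq Tn" "(\<Union>n. Tn n) = \<T>" "\<And>n. Tn n \<in> sets borel" "\<And>n. emeasure lborel (Tn n) < \<infinity>"
    and loc: "\<And>n. integrable (restrict_space lborel \<T>) (\<lambda>s. indicator (Tn n) s * u s)"
    and inf: "(\<integral>\<^sup>+ s. ennreal (u s) \<partial>restrict_space lborel \<T>) = \<infinity>"
  obtains E :: "nat \<Rightarrow> real set" where "\<And>k. E k \<in> sets borel" "\<And>k. emeasure lborel (E k) < \<infinity>" "incseq E" "(\<Union>k. E k) = \<T>"
    "\<And>k. real k \<le> (\<integral> s. indicator (E k) s * u s \<partial>restrict_space lborel \<T>)"
proof -
  let ?L = "restrict_space lborel \<T>"
  let ?P = "{s \<in> \<T>. 0 < u s}"
  note [measurable] = u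
  have L: "sets ?L = sets (restrict_space borel \<T>)" "space ?L = \<T>"
    by (simp_all add: space_restrict_space cong: sets_restrict_space_cong)
  have "{s \<in> space ?L. 0 < u s} \<in> sets ?L" by measurable
  then have P: "?P \<in> sets borel" using \<T> by (simp add: L sets_restrict_space_iff)
  have ind: "(indicator A :: real \<Rightarrow> real) \<in> borel_measurable ?L" if "A \<in> sets borel" for A
    using that by (intro measurable_restrict_space1) simp
  have int_sub: "integrable ?L (\<lambda>s. indicator A s * u s)" if "A \<in> sets borel" "A \<subseteq> Tn n" for A n
  proof (rule Bochner_Integration.integrable_bound[OF loc[of n]])
    show "(\<lambda>s. indicator A s * u s) \<in> borel_measurable ?L" using ind[OF that(1)] by measurable
    show "AE s in ?L. norm (indicator A s * u s) \<le> norm (indicator (Tn n) s * u s)"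
      using that by (intro AE_I2) (auto simp: indicator_def)
  qed
  define a where "a j = (\<integral> s. indicator (Tn j \<inter> ?P) s * u s \<partial>?L)" for j
  define b where "b k = (\<integral> s. \<bar>indicator (Tn k) s * u s\<bar> \<partial>?L)" for k
  have a_mono: "a i \<le> a j" if "i \<le> j" for i j
    unfolding a_def using that incseqD[OF Tn(1) that] Tn(3) P
    by (intro integral_mono int_sub) (auto simp: indicator_def)
  have "(SUP j. \<integral>\<^sup>+ s. ennreal (indicator (Tn j \<inter> ?P) s * u s) \<partial>?L) = (\<integral>\<^sup>+ s. (SUP j. ennreal (indicator (Tn j \<inter> ?P) s * u s)) \<partial>?L)"
  proof (rule nn_integral_monotone_convergence_SUP[symmetric])
    show "incseq (\<lambda>j s. ennreal (indicator (Tn j \<inter> ?P) s * u s))"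
      using Tn(1) by (auto simp: incseq_def le_fun_def indicator_def intro!: ennreal_leI) 
    show "(\<lambda>s. ennreal (indicator (Tn j \<inter> ?P) s * u s)) \<in> borel_measurable ?L" for j
      using ind[of "Tn j \<inter> ?P"] Tn(3) P by measurable
  qed
  also have "\<dots> = (\<integral>\<^sup>+ s. ennreal (u s) \<partial>?L)"
  proof (rule nn_integral_cong)
    fix s assume "s \<in> space ?L"
    then obtain j where j: "s \<in> Tn j" "s \<in> \<T>" using Tn(2) L by auto
    show "(SUP j. ennreal (indicator (Tn j \<inter> ?P) s * u s)) = ennreal (u s)"
    proof (rule antisym)
      show "(SUP j. ennreal (indicator (Tn j \<inter> ?P) s * u s)) \<le> ennreal (u s)"
        by (intro SUP_least) (auto simp: indicator_def)
      show "ennreal (u s) \<le> (SUP j. ennreal (indicator (Tn j \<inter> ?P) s * u s))"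
        using j by (intro SUP_upper2[of j]) (auto simp: indicator_def ennreal_neg)
    qed
  qed
  finally have sup: "(SUP j. \<integral>\<^sup>+ s. ennreal (indicator (Tn j \<inter> ?P) s * u s) \<partial>?L) = \<infinity>"
    using inf by simp
  have "(\<integral>\<^sup>+ s. ennreal (indicator (Tn j \<inter> ?P) s * u s) \<partial>?L) = ennreal (a j)" for j
    unfolding a_def using Tn(3) P
    by (intro nn_integral_eq_integral int_sub[of _ j] AE_I2) (auto simp: indicator_def)
  with sup have sup: "(SUP j. ennreal (a j)) = \<infinity>" by simp
  have "\<exists>j. real k + b k \<le> a j" for k
  proof (rule ccontr)
    assume "\<not> (\<exists>j. real k + b k \<le> a j)"
    then have "(SUP j. ennreal (a j)) \<le> ennreal (real k + b k)"
      by (intro SUP_least ennreal_leI) (auto simp: not_le intro: less_imp_le)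
    then have "(\<infinity>::ennreal) \<le> ennreal (real k + b k)" unfolding sup .
    then show False by (simp add: top_unique)
  qed
  then obtain j where j: "\<And>k. real k + b k \<le> a (j k)" by metis
  \<comment> \<open>partial sums make the chosen indices monotone without losing the lower bound\<close>
  define J where "J k = (\<Sum>i\<le>k. j i)" for k
  have Jmono: "J k \<le> J l" if "k \<le> l" for k l unfolding J_def using that by (intro sum_mono2) auto
  have Jj: "j k \<le> J k" for k unfolding J_def by (intro member_le_sum) auto
  define E where "E k = (Tn (J k) \<inter> ?P) \<union> Tn k" for k
  show ?thesis
  proof (rule that[of E])
    show Eb: "E k \<in> sets borel" for k unfolding E_def using Tn(3) P by auto
    show "emeasure lborel (E k) < \<infinity>" for k
    proof -
      have "E k \<subseteq> Tn (J k) \<union> Tn k" by (auto simp: E_def)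
      then have "emeasure lborel (E k) \<le> emeasure lborel (Tn (J k) \<union> Tn k)"
        using Tn(3) by (intro emeasure_mono) auto
      also have "\<dots> \<le> emeasure lborel (Tn (J k)) + emeasure lborel (Tn k)"
        using Tn(3) by (intro emeasure_subadditive) auto
      also have "\<dots> < \<infinity>" using Tn(4) by simp
      finally show ?thesis .
    qed
    show "incseq E"
    proof (rule incseq_SucI)
      fix k
      show "E k \<subseteq> E (Suc k)"
        using incseqD[OF Tn(1) Jmono[of k "Suc k"]] incseqD[OF Tn(1), of k "Suc k"] by (auto simp: E_def)
    qed
    show "(\<Union>k. E k) = \<T>" using Tn(2) by (auto simp: E_def)
    show "real k \<le> (\<integral> s. indicator (E k) s * u s \<partial>?L)" for k
    proof -
      let ?R = "Tn k - (Tn (J k) \<inter> ?P)"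
      have R: "?R \<in> sets borel" "?R \<subseteq> Tn k" using Tn(3) P by auto
      have i1: "integrable ?L (\<lambda>s. indicator (Tn (J k) \<inter> ?P) s * u s)"
        using Tn(3) P by (intro int_sub[of _ "J k"]) auto
      have i2: "integrable ?L (\<lambda>s. indicator ?R s * u s)" by (rule int_sub[OF R])
      have "- b k \<le> (\<integral> s. indicator ?R s * u s \<partial>?L)"
      proof -
        have "\<bar>\<integral> s. indicator ?R s * u s \<partial>?L\<bar> \<le> (\<integral> s. \<bar>indicator ?R s * u s\<bar> \<partial>?L)" by (rule integral_abs_bound)
        also have "\<dots> \<le> b k" unfolding b_def
          using i2 loc[of k] by (intro integral_mono) (auto simp: indicator_def)
        finally show ?thesis by linarith
      qed
      moreover have "(\<integral> s. indicator (E k) s * u s \<partial>?L) = a (J k) + (\<integral> s. indicator ?R s * u s \<partial>?L)"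
        unfolding a_def Bochner_Integration.integral_add[OF i1 i2, symmetric]
        by (intro Bochner_Integration.integral_cong) (auto simp: E_def indicator_def)
      ultimately show ?thesis using j[of k] a_mono[OF Jj[of k]] by linarith
    qed
  qed
qed

lemma exists_exhaustion_diverging:
  fixes u :: "real \<Rightarrow> real" and Tn :: "nat \<Rightarrow> real set"
  assumes \<T>: "\<T> \<in> sets borel" and u: "u \<in> borel_measurable (restrict_space lborel \<T>)"
    and Tn: "incseq Tn" "(\<Union>n. Tn n) = \<T>" "\<And>n. Tn n \<in> sets borel" "\<And>n. emeasure lborel (Tn n) < \<infinity>"
    and loc: "\<And>n. integrable (restrict_space lborel \<T>) (\<lambda>s. indicator (Tn n) s * u s)"
    and not: "\<not> integrable (restrict_space lborel \<T>) u"
  obtains E :: "nat \<Rightarrow> real set" where "\<And>k. E k \<in> sets borel" "\<And>k. emeasure lborel (E k) < \<infinity>" "incseq E" "(\<Union>k. E k) = \<T>"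
    "\<And>k. real k \<le> \<bar>\<integral> s. indicator (E k) s * u s \<partial>restrict_space lborel \<T>\<bar>"
proof -
  let ?L = "restrict_space lborel \<T>"
  from not u consider "(\<integral>\<^sup>+ s. ennreal (u s) \<partial>?L) = \<infinity>" | "(\<integral>\<^sup>+ s. ennreal (- u s) \<partial>?L) = \<infinity>"
    by (auto simp: real_integrable_def)
  then show ?thesis
  proof cases
    case 1
    show ?thesis
      by (rule exists_exhaustion_diverging_pos[OF \<T> u Tn loc 1])
         (rule that, auto intro: order_trans[OF _ abs_ge_self])
  next
    case 2
    have loc': "integrable ?L (\<lambda>s. indicator (Tn n) s * - u s)" for n using loc[of n] by simp
    have u': "(\<lambda>s. - u s) \<in> borel_measurable ?L" using u by simp
    show ?thesis
    proof (rule exists_exhaustion_diverging_pos[OF \<T> u' Tn loc' 2])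
      fix E :: "nat \<Rightarrow> real set"
      assume E: "\<And>k. E k \<in> sets borel" "\<And>k. emeasure lborel (E k) < \<infinity>" "incseq E" "(\<Union>k. E k) = \<T>"
        "\<And>k. real k \<le> (\<integral> s. indicator (E k) s * - u s \<partial>?L)"
      show ?thesis
      proof (rule that[OF E(1-4)])
        show "real k \<le> \<bar>\<integral> s. indicator (E k) s * u s \<partial>?L\<bar>" for k using E(5)[of k] by simp
      qed
    qed
  qed
qed

section \<open>The drift seminorm\<close>

text \<open>
  On the subspace of vectors \<open>v\<close> with \<open>s \<mapsto> g(s) v\<close> integrable, \<open>v \<mapsto> \<integral>\<parallel>g(s) v\<parallel>\<close> is a seminorm. In terms
  of an orthonormal basis of that subspace it is dominated by a fixed linear combination of the absolute values of the coordinates.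
\<close>

lemma integral_norm_matrix_vector_tendsto_0:
  fixes g :: "real \<Rightarrow> real^'d^'d" and c :: "nat \<Rightarrow> real^'d"
  assumes c: "c \<longlonglongrightarrow> 0" and int: "eventually (\<lambda>m. integrable L (\<lambda>s. g s *v c m)) sequentially"
  shows "(\<lambda>m. \<integral> s. norm (g s *v c m) \<partial>L) \<longlonglongrightarrow> 0"
proof -
  let ?V = "{v. integrable L (\<lambda>s. g s *v v)}"
  have "subspace ?V"
    by (auto simp: subspace_def matrix_vector_right_distrib matrix_vector_mult_scaleR)
  from orthonormal_basis_subspace[OF this] obtain B where B: "B \<subseteq> ?V" "pairwise orthogonal B"
    "\<And>x. x \<in> B \<Longrightarrow> norm x = 1" "independent B" "span B = ?V" by metis
  have fB: "finite B" using B(4) by (rule independent_imp_finite)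
  let ?p = "\<lambda>b. \<integral> s. norm (g s *v b) \<partial>L"
  have bound: "?p v \<le> (\<Sum>b\<in>B. \<bar>b \<bullet> v\<bar> * ?p b)" if v: "integrable L (\<lambda>s. g s *v v)" for v
  proof -
    have "(\<Sum>b\<in>B. (b \<bullet> v) *\<^sub>R b) = v"
      using orthonormal_basis_expand[OF B(2,3) _ fB, of v] v B(5) by (auto simp: inner_commute)
    then have e: "g s *v v = (\<Sum>b\<in>B. (b \<bullet> v) *\<^sub>R (g s *v b))" for s
      using linear_sum[OF matrix_vector_mul_linear[of "g s"], of "\<lambda>b. (b \<bullet> v) *\<^sub>R b" B]
      by (simp add: matrix_vector_mult_scaleR)
    have ib: "integrable L (\<lambda>s. g s *v b)" if "b \<in> B" for b using B(1) that by auto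
    have "?p v \<le> (\<integral> s. (\<Sum>b\<in>B. \<bar>b \<bullet> v\<bar> * norm (g s *v b)) \<partial>L)"
    proof (rule integral_mono)
      show "integrable L (\<lambda>s. norm (g s *v v))" using v by auto
      show "integrable L (\<lambda>s. \<Sum>b\<in>B. \<bar>b \<bullet> v\<bar> * norm (g s *v b))" using ib by auto
      show "norm (g s *v v) \<le> (\<Sum>b\<in>B. \<bar>b \<bullet> v\<bar> * norm (g s *v b))" for s
        unfolding e by (rule sum_norm_le) simp
    qed
    also have "\<dots> = (\<Sum>b\<in>B. \<bar>b \<bullet> v\<bar> * ?p b)"
      using ib by (subst Bochner_Integration.integral_sum) auto
    finally show ?thesis .
  qed
  have "(\<lambda>m. \<Sum>b\<in>B. \<bar>b \<bullet> c m\<bar> * ?p b) \<longlonglongrightarrow> (\<Sum>b\<in>B. \<bar>b \<bullet> 0\<bar> * ?p b)"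
    by (intro tendsto_intros c)
  then have lim: "(\<lambda>m. \<Sum>b\<in>B. \<bar>b \<bullet> c m\<bar> * ?p b) \<longlonglongrightarrow> 0" by simp
  show ?thesis
  proof (rule tendsto_sandwich[OF _ _ tendsto_const lim])
    show "eventually (\<lambda>m. 0 \<le> ?p (c m)) sequentially" by simp
    show "eventually (\<lambda>m. ?p (c m) \<le> (\<Sum>b\<in>B. \<bar>b \<bullet> c m\<bar> * ?p b)) sequentially"
      using int by eventually_elim (rule bound)
  qed
qed

section \<open>Square integrable Poisson noise\<close>

text \<open>
  The situation of the residual process at a fixed time \<open>t\<close>: the intensity \<open>N\<close> in space has a second
  moment over the whole punctured space, including the large jumps, and the kernel \<open>g\<close> is square
  integrable in time.
\<close>

locale square_integrable_noise = prob_space M for M :: "'w measure" +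
  fixes \<T> :: "real set" and N :: "(real^'d) measure"
    and Q :: "'w \<Rightarrow> ((real^'d) \<times> real) measure" and g :: "real \<Rightarrow> real^'d^'d"
  assumes time_borel: "\<T> \<in> sets borel"
    and sets_N: "sets N = sets punctured_borel"
    and second_moment: "(\<integral>\<^sup>+ z. ennreal ((norm z)\<^sup>2) \<partial>N) < \<infinity>"
    and kernel_borel: "g \<in> borel_measurable (restrict_space borel \<T>)"
    and kernel_L2: "(\<integral>\<^sup>+ s. ennreal ((norm (g s))\<^sup>2) \<partial>restrict_space lborel \<T>) < \<infinity>"
    and poisson: "poisson_random_measure M Q (time_intensity N \<T>)"
begin

abbreviation "Leb \<equiv> restrict_space lborel \<T>"
abbreviation "\<Lambda> \<equiv> time_intensity N \<T>"

definition energy :: ennreal where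
  "energy = (\<integral>\<^sup>+ z. ennreal ((norm z)\<^sup>2) \<partial>N) * (\<integral>\<^sup>+ s. ennreal ((norm (g s))\<^sup>2) \<partial>Leb)"

text \<open>
  The mean per unit of time of the jumps that the integral leaves uncompensated.
\<close>

definition big_jump_mean :: "real^'d" where
  "big_jump_mean = (\<integral> z. indicator {z. 1 < norm z} z *\<^sub>R z \<partial>N)"

abbreviation jump_kernel :: "((real^'d) \<times> real) set \<Rightarrow> (real^'d) \<times> real \<Rightarrow> real^'d" where
  "jump_kernel A x \<equiv> indicator A x *\<^sub>R (case x of (z, s) \<Rightarrow> g s *v z)"

text \<open>
  Unlike in the truncated integral, all jumps are compensated, so that the variance formula applies.
\<close>

definition compensated :: "real \<Rightarrow> real set \<Rightarrow> 'w \<Rightarrow> real^'d" where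
  "compensated \<epsilon> E \<omega> = integral\<^sup>L (Q \<omega>) (jump_kernel ({z. \<epsilon> < norm z} \<times> E))
     - integral\<^sup>L \<Lambda> (jump_kernel ({z. \<epsilon> < norm z} \<times> E))"

lemma energy_finite: "energy < \<infinity>"
  unfolding energy_def using second_moment kernel_L2 by (simp add: ennreal_mult_less_top)

lemma Leb_sigma_finite: "sigma_finite_measure Leb"
  using time_borel by (intro sigma_finite_measure_restrict_space) (auto intro: sigma_finite_lborel)

lemma kernel_borel_Leb [measurable]: "g \<in> borel_measurable Leb"
  using kernel_borel by (simp cong: measurable_cong_sets sets_restrict_space_cong)

lemma borel_measurable_N: "h \<in> borel_measurable borel \<Longrightarrow> h \<in> borel_measurable N"
  by (rule borel_measurable_punctured[OF sets_N])

lemma norm_borel_N [measurable]: "(\<lambda>z. norm z) \<in> borel_measurable N"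
  by (rule borel_measurable_N) simp

lemma jump_kernel_measurable:
  assumes "A \<in> sets borel" "E \<in> sets borel"
  shows "jump_kernel (A \<times> E) \<in> borel_measurable \<Lambda>"
  by (intro borel_measurable_scaleR kernel_measurable(3,5)[OF sets_N kernel_borel] assms)

lemma nn_integral_energy:
  "(\<integral>\<^sup>+ x. ennreal ((norm (g (snd x)) * norm (fst x))\<^sup>2) \<partial>\<Lambda>) = energy"
proof -
  interpret L: sigma_finite_measure Leb by (rule Leb_sigma_finite)
  note [measurable] = kernel_measurable(1,2)[OF sets_N kernel_borel]
  have "(\<lambda>x. ennreal ((norm (g (snd x)) * norm (fst x))\<^sup>2)) \<in> borel_measurable \<Lambda>" by measurable
  then have "(\<integral>\<^sup>+ x. ennreal ((norm (g (snd x)) * norm (fst x))\<^sup>2) \<partial>\<Lambda>) =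
      (\<integral>\<^sup>+ z. \<integral>\<^sup>+ s. ennreal ((norm (g s) * norm z)\<^sup>2) \<partial>Leb \<partial>N)"
    unfolding time_intensity_def by (subst L.nn_integral_fst[symmetric]) simp_all
  also have "\<dots> = (\<integral>\<^sup>+ z. ennreal ((norm z)\<^sup>2) * (\<integral>\<^sup>+ s. ennreal ((norm (g s))\<^sup>2) \<partial>Leb) \<partial>N)"
    by (intro nn_integral_cong, subst nn_integral_cmult[symmetric])
       (auto simp: power_mult_distrib ennreal_mult mult.commute)
  also have "\<dots> = energy" unfolding energy_def by (rule nn_integral_multc) measurable
  finally show ?thesis .
qed

text \<open>
  On a set of finite intensity, square integrability gives integrability, by \<open>y \<le> 1 + y\<^sup>2\<close>.
\<close>

lemma jump_kernel_integrable:
  assumes A: "A \<in> sets borel" "A \<subseteq> {z. \<epsilon> < norm z}" "0 < \<epsilon>"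
    and E: "E \<in> sets borel" "emeasure lborel E < \<infinity>"
  shows "integrable \<Lambda> (jump_kernel (A \<times> E))"
proof (rule Bochner_Integration.integrable_bound)
  interpret L: sigma_finite_measure Leb by (rule Leb_sigma_finite)
  note [measurable] = kernel_measurable(1,2)[OF sets_N kernel_borel]
  let ?i = "\<lambda>x. indicator ({z. \<epsilon> < norm z} \<times> E) x :: real"
  let ?q = "\<lambda>x. (norm (g (snd x)) * norm (fst x))\<^sup>2"
  have s: "{z. \<epsilon> < norm z} \<in> sets N"
    using A(3) unfolding sets_N by (auto simp: sets_restrict_space_iff)
  have "emeasure \<Lambda> ({z. \<epsilon> < norm z} \<times> E \<inter> space \<Lambda>) = emeasure \<Lambda> ({z. \<epsilon> < norm z} \<times> (E \<inter> \<T>))"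
    using sets.sets_into_space[OF s]
    by (intro arg_cong[where f = "emeasure \<Lambda>"])
       (auto simp: time_intensity_def space_pair_measure space_restrict_space)
  also have "\<dots> = emeasure N {z. \<epsilon> < norm z} * emeasure Leb (E \<inter> \<T>)"
    unfolding time_intensity_def using s E by (intro L.emeasure_pair_measure_Times) (auto simp: sets_restrict_space)
  also have "emeasure Leb (E \<inter> \<T>) = emeasure lborel (E \<inter> \<T>)"
    using time_borel by (intro emeasure_restrict_space) auto
  also have "emeasure N {z. \<epsilon> < norm z} * emeasure lborel (E \<inter> \<T>) < \<infinity>"
    using sigma_finite_second_moment(1)[OF sets_N second_moment A(3)]
      emeasure_mono[of "E \<inter> \<T>" E lborel] E by (auto simp: ennreal_mult_less_top intro: le_less_trans)
  finally have "integrable \<Lambda> ?i"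
    using kernel_measurable(4)[OF sets_N kernel_borel norm_gt_borel(1) E(1)]
    by (subst integrable_indicator_iff) auto
  moreover have "integrable \<Lambda> ?q"
    using nn_integral_energy energy_finite by (intro integrableI_nonneg) auto
  ultimately show "integrable \<Lambda> (\<lambda>x. real CARD('d) * (?i x + ?q x))" by auto
  show "jump_kernel (A \<times> E) \<in> borel_measurable \<Lambda>" by (rule jump_kernel_measurable[OF A(1) E(1)])
  have "norm (jump_kernel (A \<times> E) x) \<le> real CARD('d) * (?i x + ?q x)" for x
  proof (cases "x \<in> A \<times> E")
    case True
    then have "?i x = 1" using A(2) by auto
    have "norm (jump_kernel (A \<times> E) x) \<le> real CARD('d) * (norm (g (snd x)) * norm (fst x))"
      using True norm_matrix_vector_le by (auto split: prod.split)
    also have "\<dots> \<le> real CARD('d) * (1 + ?q x)"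
    proof (intro mult_left_mono)
      show "norm (g (snd x)) * norm (fst x) \<le> 1 + ?q x" by (rule le_one_plus_square)
    qed simp
    finally show ?thesis using \<open>?i x = 1\<close> by simp
  qed (auto simp: indicator_def)
  then show "AE x in \<Lambda>. norm (jump_kernel (A \<times> E) x) \<le> norm (real CARD('d) * (?i x + ?q x))"
    by (intro AE_I2) (auto intro: order_trans[OF _ abs_ge_self])
qed

text \<open>
  The factor \<open>CARD('d)\<close> comes from applying the scalar variance bound to each coordinate.
\<close>

lemma compensated_L2:
  assumes \<epsilon>: "0 < \<epsilon>" and E: "E \<in> sets borel" "emeasure lborel E < \<infinity>"
  shows "(\<integral>\<^sup>+ \<omega>. ennreal ((norm (compensated \<epsilon> E \<omega>))\<^sup>2) \<partial>M) \<le> of_nat CARD('d) * energy"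
proof -
  let ?W = "jump_kernel ({z. \<epsilon> < norm z} \<times> E)"
  have int: "integrable \<Lambda> ?W" by (rule jump_kernel_integrable[OF norm_gt_borel(1) _ \<epsilon> E]) auto
  have Wm: "?W \<in> borel_measurable \<Lambda>" using int by auto
  have inti: "integrable \<Lambda> (\<lambda>x. ?W x $ i)" for i
    by (rule integrable_bounded_linear[OF bounded_linear_vec_nth int])
  have comp: "integral\<^sup>L R (\<lambda>x. ?W x $ i) = integral\<^sup>L R ?W $ i" if "integrable R ?W" for R i
    by (rule integral_bounded_linear[OF bounded_linear_vec_nth that])
  have sq: "(\<integral>\<^sup>+ x. ennreal ((?W x $ i)\<^sup>2) \<partial>\<Lambda>) \<le> energy" for i
    unfolding nn_integral_energy[symmetric]
  proof (intro nn_integral_mono ennreal_leI)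
    fix x
    have "\<bar>?W x $ i\<bar> \<le> \<bar>norm (g (snd x)) * norm (fst x)\<bar>"
      using norm_matrix_vector_component_le[of "g (snd x)" "fst x" i]
      by (cases "x \<in> {z. \<epsilon> < norm z} \<times> E") (auto simp: case_prod_beta)
    then show "(?W x $ i)\<^sup>2 \<le> (norm (g (snd x)) * norm (fst x))\<^sup>2" by (simp only: abs_le_square_iff)
  qed
  let ?D = "\<lambda>i \<omega>. integral\<^sup>L (Q \<omega>) (\<lambda>x. ?W x $ i) - integral\<^sup>L \<Lambda> (\<lambda>x. ?W x $ i)"
  have D: "(\<lambda>\<omega>. ?D i \<omega>) \<in> borel_measurable M" for i
    using inti[of i] by (intro borel_measurable_diff poisson_integral_measurable[OF poisson]) auto
  have "AE \<omega> in M. ennreal ((norm (compensated \<epsilon> E \<omega>))\<^sup>2) = (\<Sum>i\<in>UNIV. ennreal ((?D i \<omega>)\<^sup>2))"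
    using poisson_AE_integrable[OF poisson int]
  proof eventually_elim
    case (elim \<omega>)
    have "(norm (compensated \<epsilon> E \<omega>))\<^sup>2 = (\<Sum>i\<in>UNIV. (compensated \<epsilon> E \<omega> $ i)\<^sup>2)"
      unfolding power2_norm_eq_inner inner_vec_def by (simp add: power2_eq_square)
    also have "\<dots> = (\<Sum>i\<in>UNIV. (?D i \<omega>)\<^sup>2)"
      unfolding comp[OF elim] comp[OF int] by (simp add: compensated_def)
    finally show ?case by (simp add: sum_ennreal)
  qed
  then have "(\<integral>\<^sup>+ \<omega>. ennreal ((norm (compensated \<epsilon> E \<omega>))\<^sup>2) \<partial>M) = (\<integral>\<^sup>+ \<omega>. (\<Sum>i\<in>UNIV. ennreal ((?D i \<omega>)\<^sup>2)) \<partial>M)"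
    by (rule nn_integral_cong_AE)
  also have "\<dots> = (\<Sum>i\<in>UNIV. \<integral>\<^sup>+ \<omega>. ennreal ((?D i \<omega>)\<^sup>2) \<partial>M)"
    using D by (intro nn_integral_sum) (auto intro!: measurable_compose[OF D] )
  also have "\<dots> \<le> (\<Sum>i\<in>(UNIV::'d set). energy)"
  proof (rule sum_mono)
    fix i
    have "(\<integral>\<^sup>+ x. ennreal ((?W x $ i)\<^sup>2) \<partial>\<Lambda>) < \<infinity>" using sq[of i] energy_finite by (rule le_less_trans)
    from poisson_L2_bound[OF poisson inti this] sq[of i]
    show "(\<integral>\<^sup>+ \<omega>. ennreal ((?D i \<omega>)\<^sup>2) \<partial>M) \<le> energy" by (rule order_trans)
  qed
  finally show ?thesis by simp
qed

lemma compensated_measurable: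
  assumes "E \<in> sets borel"
  shows "compensated \<epsilon> E \<in> borel_measurable M"
proof -
  have "(\<lambda>\<omega>. compensated \<epsilon> E \<omega>) \<in> borel_measurable M"
    unfolding compensated_def
    by (intro borel_measurable_diff poisson_integral_measurable[OF poisson] jump_kernel_measurable norm_gt_borel assms) simp
  then show ?thesis by simp
qed

lemma compensated_tail:
  assumes \<epsilon>: "0 < \<epsilon>" and E: "E \<in> sets borel" "emeasure lborel E < \<infinity>" and r: "0 < r"
  shows "prob {\<omega>\<in>space M. r < norm (compensated \<epsilon> E \<omega>)} \<le> real CARD('d) * enn2real energy / r\<^sup>2"
proof -
  note [measurable] = compensated_measurable[OF E(1)]
  let ?A = "{\<omega>\<in>space M. r < norm (compensated \<epsilon> E \<omega>)}"
  have "emeasure M ?A = (\<integral>\<^sup>+ \<omega>. indicator ?A \<omega> \<partial>M)" by simp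
  also have "\<dots> \<le> (\<integral>\<^sup>+ \<omega>. ennreal (1 / r\<^sup>2) * ennreal ((norm (compensated \<epsilon> E \<omega>))\<^sup>2) \<partial>M)"
  proof (rule nn_integral_mono)
    fix \<omega>
    have "1 \<le> 1 / r\<^sup>2 * (norm (compensated \<epsilon> E \<omega>))\<^sup>2" if "r < norm (compensated \<epsilon> E \<omega>)"
      using power_mono[of r "norm (compensated \<epsilon> E \<omega>)" 2] that r by (simp add: field_simps)
    then show "indicator ?A \<omega> \<le> ennreal (1 / r\<^sup>2) * ennreal ((norm (compensated \<epsilon> E \<omega>))\<^sup>2)"
      by (auto simp: indicator_def ennreal_mult[symmetric] simp flip: ennreal_1 intro!: ennreal_leI)
  qed
  also have "\<dots> = ennreal (1 / r\<^sup>2) * (\<integral>\<^sup>+ \<omega>. ennreal ((norm (compensated \<epsilon> E \<omega>))\<^sup>2) \<partial>M)"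
    by (rule nn_integral_cmult) measurable
  also have "\<dots> \<le> ennreal (1 / r\<^sup>2) * (of_nat CARD('d) * energy)"
    by (intro mult_left_mono compensated_L2[OF \<epsilon> E]) auto
  also have "energy = ennreal (enn2real energy)" using energy_finite by simp
  also have "ennreal (1 / r\<^sup>2) * (of_nat CARD('d) * ennreal (enn2real energy)) = ennreal (real CARD('d) * enn2real energy / r\<^sup>2)"
    by (simp add: ennreal_of_nat_eq_real_of_nat ennreal_mult[symmetric])
  finally show ?thesis by (simp add: emeasure_eq_measure)
qed

lemma big_jump_integrable: "integrable N (\<lambda>z. indicator {z. 1 < norm z} z *\<^sub>R z)"
  and norm_big_jump_mean_le: "norm big_jump_mean \<le> enn2real (\<integral>\<^sup>+ z. ennreal ((norm z)\<^sup>2) \<partial>N)"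
proof -
  have sq: "has_bochner_integral N (\<lambda>z. (norm z)\<^sup>2) (enn2real (\<integral>\<^sup>+ z. ennreal ((norm z)\<^sup>2) \<partial>N))"
    using second_moment by (intro has_bochner_integral_nn_integral) auto
  have le: "norm (indicator {z. 1 < norm z} z *\<^sub>R z) \<le> (norm z)\<^sup>2" for z :: "real^'d"
  proof (cases "1 < norm z")
    case True
    then have "norm z * 1 \<le> norm z * norm z" by (intro mult_left_mono) auto
    then show ?thesis by (simp add: indicator_def power2_eq_square)
  qed simp
  show int: "integrable N (\<lambda>z. indicator {z. 1 < norm z} z *\<^sub>R z)"
  proof (rule Bochner_Integration.integrable_bound)
    show "integrable N (\<lambda>z. (norm z)\<^sup>2)" using sq by (simp add: has_bochner_integral_iff)
    have "(\<lambda>z::real^'d. indicator {z. 1 < norm z} z *\<^sub>R z) \<in> borel_measurable borel" by measurable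
    then show "(\<lambda>z. indicator {z. 1 < norm z} z *\<^sub>R z) \<in> borel_measurable N" by (rule borel_measurable_N)
    show "AE z in N. norm (indicator {z. 1 < norm z} z *\<^sub>R z) \<le> norm ((norm z)\<^sup>2)" using le by simp
  qed
  have "norm big_jump_mean \<le> (\<integral> z. norm (indicator {z. 1 < norm z} z *\<^sub>R z) \<partial>N)"
    unfolding big_jump_mean_def by (rule integral_norm_bound)
  also have "\<dots> \<le> (\<integral> z. (norm z)\<^sup>2 \<partial>N)"
    using integrable_norm[OF int] sq le by (intro integral_mono) (simp_all add: has_bochner_integral_iff)
  finally show "norm big_jump_mean \<le> enn2real (\<integral>\<^sup>+ z. ennreal ((norm z)\<^sup>2) \<partial>N)"
    using sq by (simp add: has_bochner_integral_iff)
qed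

text \<open>
  The two compensators differ by the jumps with \<open>\<parallel>z\<parallel> > 1\<close>, provided that the cutoff does not exceed one;
  Fubini's theorem integrates \<open>z\<close> out first.
\<close>

lemma truncated_decomposition:
  assumes \<epsilon>: "0 < \<epsilon>" "\<epsilon> \<le> 1" and E: "E \<in> sets borel" "emeasure lborel E < \<infinity>"
  shows "truncated_levy_integral \<T> Q N g \<epsilon> E \<omega> =
    compensated \<epsilon> E \<omega> + (\<integral> s. indicator E s *\<^sub>R (g s *v big_jump_mean) \<partial>Leb)"
proof -
  let ?A = "{z. \<epsilon> < norm z} :: (real^'d) set" and ?B = "{z. \<epsilon> < norm z \<and> norm z \<le> 1} :: (real^'d) set"
    and ?C = "{z. 1 < norm z} :: (real^'d) set"
  have iB: "integrable \<Lambda> (jump_kernel (?B \<times> E))"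
    by (rule jump_kernel_integrable[OF norm_gt_borel(2) _ \<epsilon>(1) E]) auto
  have iC: "integrable \<Lambda> (jump_kernel (?C \<times> E))"
    by (rule jump_kernel_integrable[OF norm_gt_borel(1) _ _ E, of 1 1]) auto
  have "integral\<^sup>L \<Lambda> (jump_kernel (?A \<times> E)) = (\<integral> x. jump_kernel (?B \<times> E) x + jump_kernel (?C \<times> E) x \<partial>\<Lambda>)"
    using \<epsilon>(2) by (intro Bochner_Integration.integral_cong) (auto simp: indicator_def)
  also have "\<dots> = integral\<^sup>L \<Lambda> (jump_kernel (?B \<times> E)) + integral\<^sup>L \<Lambda> (jump_kernel (?C \<times> E))"
    by (rule Bochner_Integration.integral_add[OF iB iC])
  also have "integral\<^sup>L \<Lambda> (jump_kernel (?C \<times> E)) = (\<integral> s. indicator E s *\<^sub>R (g s *v big_jump_mean) \<partial>Leb)"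
  proof -
    interpret L: sigma_finite_measure Leb by (rule Leb_sigma_finite)
    interpret N: sigma_finite_measure N by (rule sigma_finite_second_moment(2)[OF sets_N second_moment])
    interpret P: pair_sigma_finite N Leb ..
    have eq: "jump_kernel (?C \<times> E) = (\<lambda>(z, s). indicator E s *\<^sub>R (g s *v (indicator ?C z *\<^sub>R z)))"
      by (auto simp: fun_eq_iff indicator_def)
    have "integral\<^sup>L \<Lambda> (jump_kernel (?C \<times> E)) =
        (\<integral> s. (\<integral> z. indicator E s *\<^sub>R (g s *v (indicator ?C z *\<^sub>R z)) \<partial>N) \<partial>Leb)"
      using iC unfolding eq time_intensity_def by (rule P.integral_snd[symmetric])
    also have "\<dots> = (\<integral> s. indicator E s *\<^sub>R (g s *v big_jump_mean) \<partial>Leb)"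
    proof (rule Bochner_Integration.integral_cong[OF refl])
      fix s
      have "bounded_linear (\<lambda>z. indicator E s *\<^sub>R (g s *v z))"
        by (intro bounded_linear_const_scaleR matrix_vector_mul_bounded_linear)
      from integral_bounded_linear[OF this big_jump_integrable]
      show "(\<integral> z. indicator E s *\<^sub>R (g s *v (indicator ?C z *\<^sub>R z)) \<partial>N) = indicator E s *\<^sub>R (g s *v big_jump_mean)"
        by (simp add: big_jump_mean_def)
    qed
    finally show ?thesis .
  qed
  finally show ?thesis
    unfolding truncated_levy_integral_def compensated_def set_lebesgue_integral_def by simp
qed

end

section \<open>Existence of the integral and integrability of the drift\<close>

abbreviation cutoff :: "nat \<Rightarrow> real" where
  "cutoff j \<equiv> inverse (real (Suc j))"

lemma cutoff_le_1: "cutoff j \<le> 1"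
  by (simp add: field_simps)

lemma decseq_cutoff: "decseq cutoff"
  by (rule decseq_SucI) (simp add: field_simps)

lemma levy_integralD:
  fixes g :: "real \<Rightarrow> real^'d^'d"
  assumes "levy_integral M \<T> Q N A g Z"
  shows "Z \<in> borel_measurable M"
    and "(\<And>j. E j \<in> sets borel) \<Longrightarrow> (\<And>j. emeasure lborel (E j) < \<infinity>) \<Longrightarrow> incseq E \<Longrightarrow> (\<Union>j. E j) = A \<Longrightarrow>
      (\<And>j. 0 < \<epsilon> j) \<Longrightarrow> decseq \<epsilon> \<Longrightarrow> \<epsilon> \<longlonglongrightarrow> 0 \<Longrightarrow>
      (\<forall>j. AE \<omega> in M. set_integrable (Q \<omega>) ({z. \<epsilon> j < norm z} \<times> E j) (\<lambda>(z, s). g s *v z)) \<and>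
      (\<forall>j. set_integrable (time_intensity N \<T>) ({z. \<epsilon> j < norm z \<and> norm z \<le> 1} \<times> E j) (\<lambda>(z, s). g s *v z)) \<and>
      (\<forall>e>0. (\<lambda>j. measure M {\<omega>\<in>space M. dist (truncated_levy_integral \<T> Q N g (\<epsilon> j) (E j) \<omega>) (Z \<omega>) > e}) \<longlonglongrightarrow> 0)"
  using assms unfolding levy_integral_def converges_in_probability_def by blast+

lemma (in prob_space) norm_tail_tendsto_0:
  fixes Z :: "'a \<Rightarrow> 'c::euclidean_space"
  assumes [measurable]: "Z \<in> borel_measurable M"
  shows "(\<lambda>n. prob {\<omega>\<in>space M. real n < norm (Z \<omega>)}) \<longlonglongrightarrow> 0"
proof -
  let ?A = "\<lambda>n. {\<omega>\<in>space M. real n < norm (Z \<omega>)}"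
  have "(\<lambda>n. prob (?A n)) \<longlonglongrightarrow> prob (\<Inter>n. ?A n)"
    by (intro finite_Lim_measure_decseq) (auto simp: decseq_def)
  moreover have "(\<Inter>n. ?A n) = {}"
  proof -
    have "\<exists>n. norm (Z \<omega>) \<le> real n" for \<omega> by (rule real_arch_simple)
    then show ?thesis by auto (meson not_less)
  qed
  ultimately show ?thesis by simp
qed

context square_integrable_noise
begin

lemma kernel_locally_integrable:
  assumes E: "E \<in> sets borel" "emeasure lborel E < \<infinity>"
  shows "integrable Leb (\<lambda>s. indicator E s *\<^sub>R (g s *v v))"
proof (rule Bochner_Integration.integrable_bound)
  have "emeasure Leb (E \<inter> \<T>) = emeasure lborel (E \<inter> \<T>)"
    using time_borel by (intro emeasure_restrict_space) auto
  also have "\<dots> < \<infinity>" using emeasure_mono[of "E \<inter> \<T>" E lborel] E by (auto intro: le_less_trans)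
  finally have 1: "integrable Leb (\<lambda>s. indicator E s :: real)"
    using E by (subst integrable_indicator_iff) (auto simp: space_restrict_space sets_restrict_space)
  have 2: "integrable Leb (\<lambda>s. (norm (g s))\<^sup>2)" using kernel_L2 by (intro integrableI_nonneg) auto
  show "integrable Leb (\<lambda>s. real CARD('d) * ((indicator E s + (norm (g s))\<^sup>2) * norm v))"
    using 1 2 by auto
  have "(indicator E :: real \<Rightarrow> real) \<in> borel_measurable Leb"
    using E by (intro measurable_restrict_space1) simp
  then show "(\<lambda>s. indicator E s *\<^sub>R (g s *v v)) \<in> borel_measurable Leb" by measurable
  have "norm (indicator E s *\<^sub>R (g s *v v)) \<le> real CARD('d) * ((indicator E s + (norm (g s))\<^sup>2) * norm v)" for s
  proof (cases "s \<in> E")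
    case True
    have "norm (g s *v v) \<le> real CARD('d) * (norm (g s) * norm v)" by (rule norm_matrix_vector_le)
    also have "\<dots> \<le> real CARD('d) * ((1 + (norm (g s))\<^sup>2) * norm v)"
      by (intro mult_left_mono mult_right_mono le_one_plus_square) auto
    finally show ?thesis using True by simp
  qed simp
  then show "AE s in Leb. norm (indicator E s *\<^sub>R (g s *v v)) \<le> norm (real CARD('d) * ((indicator E s + (norm (g s))\<^sup>2) * norm v))"
    unfolding real_norm_def by (intro AE_I2 order_trans[OF _ abs_ge_self])
qed

text \<open>
  If a component of the drift density were not integrable, there would be an exhaustion along which the
  drift diverges. The truncated integrals converge in probability along it and their compensated parts
  are bounded in \<open>L\<^sup>2\<close>, so the drift, being a difference of tight sequences, would have to stay bounded.
\<close>

lemma kernel_mean_integrable: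
  assumes Z: "levy_integral M \<T> Q N \<T> g Z"
    and Tn: "incseq Tn" "(\<Union>n. Tn n) = \<T>" "\<And>n. Tn n \<in> sets borel" "\<And>n. emeasure lborel (Tn n) < \<infinity>"
  shows "integrable Leb (\<lambda>s. g s *v big_jump_mean)"
proof -
  let ?c = big_jump_mean
  have comp: "integrable Leb (\<lambda>s. (g s *v ?c) $ i)" for i
  proof (rule ccontr)
    assume not: "\<not> integrable Leb (\<lambda>s. (g s *v ?c) $ i)"
    have "(\<lambda>s. (g s *v ?c) \<bullet> axis i 1) \<in> borel_measurable Leb"
      by (intro borel_measurable_inner borel_measurable_matrix_vector_mult kernel_borel_Leb) simp_all
    then have meas: "(\<lambda>s. (g s *v ?c) $ i) \<in> borel_measurable Leb"
      by (simp add: cart_eq_inner_axis)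
    have loc: "integrable Leb (\<lambda>s. indicator E s * (g s *v ?c) $ i)"
      "(\<integral> s. indicator E s * (g s *v ?c) $ i \<partial>Leb) = (\<integral> s. indicator E s *\<^sub>R (g s *v ?c) \<partial>Leb) $ i"
      if "E \<in> sets borel" "emeasure lborel E < \<infinity>" for E
      using integrable_bounded_linear[OF bounded_linear_vec_nth[of i] kernel_locally_integrable[OF that, of ?c]]
        integral_bounded_linear[OF bounded_linear_vec_nth[of i] kernel_locally_integrable[OF that, of ?c]]
      by simp_all
    obtain E where E: "\<And>k. E k \<in> sets borel" "\<And>k. emeasure lborel (E k) < \<infinity>" "incseq E" "(\<Union>k. E k) = \<T>"
      "\<And>k. real k \<le> \<bar>\<integral> s. indicator (E k) s * (g s *v ?c) $ i \<partial>Leb\<bar>"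
      by (rule exists_exhaustion_diverging[OF time_borel meas Tn loc(1)[OF Tn(3,4)] not], rule that)
    let ?D = "\<lambda>k. \<integral> s. indicator (E k) s *\<^sub>R (g s *v ?c) \<partial>Leb"
    have D: "real k \<le> norm (?D k)" for k
      using E(5)[of k] component_le_norm_cart[of "?D k" i] loc(2)[OF E(1,2)[of k]] by linarith
    let ?I = "\<lambda>k. truncated_levy_integral \<T> Q N g (cutoff k) (E k)"
    have conv: "(\<lambda>k. prob {\<omega>\<in>space M. dist (?I k \<omega>) (Z \<omega>) > 1}) \<longlonglongrightarrow> 0"
      using levy_integralD(2)[OF Z, of E cutoff] E(1-4) decseq_cutoff LIMSEQ_inverse_real_of_nat by simp
    have Zm[measurable]: "Z \<in> borel_measurable M" by (rule levy_integralD(1)[OF Z])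
    let ?K = "real CARD('d) * enn2real energy"
    have "eventually (\<lambda>n. prob {\<omega>\<in>space M. real n < norm (Z \<omega>)} < 1/4) sequentially"
      using order_tendstoD(2)[OF norm_tail_tendsto_0[OF Zm], of "1/4"] by simp
    moreover have "eventually (\<lambda>n. real n > 4 * ?K \<and> n \<ge> 1) sequentially"
      by (intro eventually_conj eventually_ge_at_top) (use filterlim_real_sequentially in \<open>auto simp: filterlim_at_top_dense\<close>)
    ultimately have "eventually (\<lambda>n. prob {\<omega>\<in>space M. real n < norm (Z \<omega>)} < 1/4 \<and> real n > 4 * ?K \<and> n \<ge> 1) sequentially"
      by (rule eventually_conj)
    then obtain n where n: "prob {\<omega>\<in>space M. real n < norm (Z \<omega>)} < 1/4" "real n > 4 * ?K" "n \<ge> 1"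
      by (auto simp: eventually_sequentially)
    have n0: "0 < real n" using n(3) by simp
    have Kn: "?K / (real n)\<^sup>2 < 1/4"
    proof -
      have "4 * ?K < real n * 1" using n(2) by simp
      also have "\<dots> \<le> real n * real n" using n(3) by (intro mult_left_mono) auto
      finally show ?thesis using n0 by (simp add: field_simps power2_eq_square)
    qed
    have "eventually (\<lambda>k. prob {\<omega>\<in>space M. dist (?I k \<omega>) (Z \<omega>) > 1} < 1/4 \<and> k > 2 * n + 1) sequentially"
      by (intro eventually_conj eventually_gt_at_top order_tendstoD(2)[OF conv]) simp
    then obtain k where k: "prob {\<omega>\<in>space M. dist (?I k \<omega>) (Z \<omega>) > 1} < 1/4" "k > 2 * n + 1"
      by (auto simp: eventually_sequentially)
    let ?A = "{\<omega>\<in>space M. dist (?I k \<omega>) (Z \<omega>) > 1}" and ?B = "{\<omega>\<in>space M. real n < norm (Z \<omega>)}"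
      and ?C = "{\<omega>\<in>space M. real n < norm (compensated (cutoff k) (E k) \<omega>)}"
    have [measurable]: "?I k \<in> borel_measurable M"
      by (rule truncated_levy_integral_measurable[OF sets_N kernel_borel poisson E(1)])
    have [measurable]: "compensated (cutoff k) (E k) \<in> borel_measurable M"
      by (rule compensated_measurable[OF E(1)])
    have C: "prob ?C < 1/4"
      by (rule le_less_trans[OF compensated_tail[OF _ E(1,2) n0] Kn]) simp
    \<comment> \<open>a drift larger than \<open>2 n + 1\<close> forces one of three events, each of probability below \<open>1/4\<close>\<close>
    have "space M \<subseteq> ?A \<union> ?B \<union> ?C"
    proof
      fix \<omega> assume \<omega>: "\<omega> \<in> space M"
      have "?I k \<omega> = compensated (cutoff k) (E k) \<omega> + ?D k"
        by (rule truncated_decomposition[OF _ cutoff_le_1 E(1,2)]) simp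
      then have D_eq: "(?I k \<omega> - Z \<omega>) + Z \<omega> - compensated (cutoff k) (E k) \<omega> = ?D k" by simp
      have "norm (?D k) \<le> dist (?I k \<omega>) (Z \<omega>) + norm (Z \<omega>) + norm (compensated (cutoff k) (E k) \<omega>)"
        unfolding D_eq[symmetric] dist_norm
        by (intro order_trans[OF norm_triangle_ineq4] add_right_mono norm_triangle_ineq)
      moreover have "real k > 2 * real n + 1" using k(2) by linarith
      ultimately have "1 < dist (?I k \<omega>) (Z \<omega>) \<or> real n < norm (Z \<omega>) \<or> real n < norm (compensated (cutoff k) (E k) \<omega>)"
        using D[of k] by linarith
      then show "\<omega> \<in> ?A \<union> ?B \<union> ?C" using \<omega> by auto
    qed
    then have "prob (space M) \<le> prob (?A \<union> ?B \<union> ?C)" by (intro finite_measure_mono) measurable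
    also have "\<dots> \<le> prob (?A \<union> ?B) + prob ?C" by (rule measure_Un_le) measurable
    also have "\<dots> \<le> prob ?A + prob ?B + prob ?C" by (intro add_right_mono measure_Un_le) measurable
    finally show False using k(1) n(1) C by (simp add: prob_space)
  qed
  have "(\<Sum>i\<in>UNIV. (g s *v ?c) $ i *\<^sub>R axis i 1) = g s *v ?c" for s
    using basis_expansion[of "g s *v ?c"] by (simp only: scalar_mult_eq_scaleR)
  moreover have "integrable Leb (\<lambda>s. \<Sum>i\<in>UNIV. (g s *v ?c) $ i *\<^sub>R axis i (1::real))"
    by (intro Bochner_Integration.integrable_sum integrable_scaleR_left comp)
  ultimately show ?thesis by (simp only:)
qed

lemma truncated_tail:
  assumes \<epsilon>: "0 < \<epsilon>" "\<epsilon> \<le> 1" and E: "E \<in> sets borel" "emeasure lborel E < \<infinity>" and r: "0 < r"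
    and int: "integrable Leb (\<lambda>s. g s *v big_jump_mean)"
    and small: "(\<integral> s. norm (g s *v big_jump_mean) \<partial>Leb) \<le> r"
  shows "prob {\<omega>\<in>space M. 2 * r < norm (truncated_levy_integral \<T> Q N g \<epsilon> E \<omega>)} \<le> real CARD('d) * enn2real energy / r\<^sup>2"
proof -
  have [measurable]: "compensated \<epsilon> E \<in> borel_measurable M"
    by (rule compensated_measurable[OF E(1)])
  let ?D = "\<integral> s. indicator E s *\<^sub>R (g s *v big_jump_mean) \<partial>Leb"
  have "norm ?D \<le> (\<integral> s. norm (indicator E s *\<^sub>R (g s *v big_jump_mean)) \<partial>Leb)" by (rule integral_norm_bound)
  also have "\<dots> \<le> (\<integral> s. norm (g s *v big_jump_mean) \<partial>Leb)"
    by (intro integral_mono integrable_norm int kernel_locally_integrable E) (auto simp: indicator_def)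
  finally have D: "norm ?D \<le> r" using small by simp
  have "prob {\<omega>\<in>space M. 2 * r < norm (truncated_levy_integral \<T> Q N g \<epsilon> E \<omega>)} \<le> prob {\<omega>\<in>space M. r < norm (compensated \<epsilon> E \<omega>)}"
  proof (rule finite_measure_mono)
    show "{\<omega>\<in>space M. r < norm (compensated \<epsilon> E \<omega>)} \<in> sets M" by measurable
    show "{\<omega>\<in>space M. 2 * r < norm (truncated_levy_integral \<T> Q N g \<epsilon> E \<omega>)} \<subseteq> {\<omega>\<in>space M. r < norm (compensated \<epsilon> E \<omega>)}"
    proof safe
      fix \<omega> assume "2 * r < norm (truncated_levy_integral \<T> Q N g \<epsilon> E \<omega>)"
      with D norm_triangle_ineq[of "compensated \<epsilon> E \<omega>" ?D] show "r < norm (compensated \<epsilon> E \<omega>)"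
        unfolding truncated_decomposition[OF \<epsilon> E] by linarith
    qed
  qed
  also have "\<dots> \<le> real CARD('d) * enn2real energy / r\<^sup>2" by (rule compensated_tail[OF \<epsilon>(1) E r])
  finally show ?thesis .
qed

end

section \<open>Additivity of truncated integrals\<close>

lemma truncated_levy_integral_diff:
  fixes g :: "real \<Rightarrow> real^'d^'d" and N :: "(real^'d) measure"
  assumes N: "sets N = sets punctured_borel" and g: "g \<in> borel_measurable (restrict_space borel \<T>)"
    and Q: "sets (Q \<omega>) = sets (time_intensity N \<T>)"
    and E: "E \<in> sets borel" "F \<in> sets borel" "E \<subseteq> F" "F \<subseteq> \<T>" and \<epsilon>: "0 < \<epsilon>"
    and i: "set_integrable (Q \<omega>) ({z. \<epsilon> < norm z} \<times> F) (\<lambda>(z, s). g s *v z)"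
      "set_integrable (time_intensity N \<T>) ({z. \<epsilon> < norm z \<and> norm z \<le> 1} \<times> F) (\<lambda>(z, s). g s *v z)"
  shows "set_integrable (Q \<omega>) ({z. \<epsilon> < norm z} \<times> (F - E)) (\<lambda>(z, s). g s *v z)"
    "set_integrable (time_intensity N \<T>) ({z. \<epsilon> < norm z \<and> norm z \<le> 1} \<times> (F - E)) (\<lambda>(z, s). g s *v z)"
    "truncated_levy_integral \<T> Q N g \<epsilon> (F - E) \<omega> =
      truncated_levy_integral \<T> Q N g \<epsilon> F \<omega> - truncated_levy_integral \<T> Q N g \<epsilon> E \<omega>"
proof -
  have sp: "space N = - {0}" using sets_eq_imp_space_eq[OF N] by (simp add: space_restrict_space)
  have box: "A \<times> G \<in> sets (time_intensity N \<T>)" if "A \<in> sets borel" "A \<subseteq> {z. \<epsilon> < norm z}" "G \<in> sets borel" "G \<subseteq> \<T>" for A G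
  proof -
    have "A \<times> G \<inter> space (time_intensity N \<T>) = A \<times> G"
      using that \<epsilon> sp by (auto simp: time_intensity_def space_pair_measure space_restrict_space)
    with kernel_measurable(4)[OF N g that(1,3)] show ?thesis by simp
  qed
  have split: "(set_integrable R (A \<times> (F - E)) h) \<and>
      (LINT x:A \<times> F|R. h x) = (LINT x:A \<times> E|R. h x) + (LINT x:A \<times> (F - E)|R. h x)"
    if A: "A \<in> sets borel" "A \<subseteq> {z. \<epsilon> < norm z}" and R: "sets R = sets (time_intensity N \<T>)"
      and h: "set_integrable R (A \<times> F) h" for A R and h :: "(real^'d) \<times> real \<Rightarrow> real^'d"
  proof -
    have 1: "set_integrable R (A \<times> E) h"
      using E by (intro set_integrable_subset[OF h]) (auto simp: R intro!: box A)
    have 2: "set_integrable R (A \<times> (F - E)) h"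
      using E by (intro set_integrable_subset[OF h]) (auto simp: R intro!: box A)
    have "A \<times> F = A \<times> E \<union> A \<times> (F - E)" using E(3) by auto
    then show ?thesis using set_integral_Un[OF _ 1 2] 2 by auto
  qed
  have A: "{z::real^'d. \<epsilon> < norm z \<and> norm z \<le> 1} \<subseteq> {z. \<epsilon> < norm z}" by auto
  note s1 = split[OF norm_gt_borel(1) order_refl Q i(1)] and s2 = split[OF norm_gt_borel(2) A refl i(2)]
  show "set_integrable (Q \<omega>) ({z. \<epsilon> < norm z} \<times> (F - E)) (\<lambda>(z, s). g s *v z)"
    "set_integrable (time_intensity N \<T>) ({z. \<epsilon> < norm z \<and> norm z \<le> 1} \<times> (F - E)) (\<lambda>(z, s). g s *v z)"
    using s1 s2 by auto
  show "truncated_levy_integral \<T> Q N g \<epsilon> (F - E) \<omega> =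
      truncated_levy_integral \<T> Q N g \<epsilon> F \<omega> - truncated_levy_integral \<T> Q N g \<epsilon> E \<omega>"
    unfolding truncated_levy_integral_def using s1 s2 by (simp add: algebra_simps)
qed

lemma time_intensity_superposition:
  fixes N N1 N2 :: "('a::euclidean_space) measure"
  assumes \<T>: "\<T> \<in> sets borel"
    and sets: "sets N = sets punctured_borel" "sets N1 = sets punctured_borel" "sets N2 = sets punctured_borel"
    and add: "\<And>B. B \<in> sets punctured_borel \<Longrightarrow> emeasure N B = emeasure N1 B + emeasure N2 B"
    and B: "B \<in> sets (time_intensity N \<T>)"
  shows "emeasure (time_intensity N \<T>) B = emeasure (time_intensity N1 \<T>) B + emeasure (time_intensity N2 \<T>) B"
proof -
  interpret L: sigma_finite_measure "restrict_space lborel \<T>"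
    using \<T> by (intro sigma_finite_measure_restrict_space) (auto intro: sigma_finite_lborel)
  let ?s = "\<lambda>z. emeasure (restrict_space lborel \<T>) (Pair z -` B)"
  have e: "emeasure (time_intensity R \<T>) B = (\<integral>\<^sup>+ z. ?s z \<partial>R)" if "sets R = sets punctured_borel" for R
  proof -
    have "B \<in> sets (time_intensity R \<T>)"
      using B by (simp only: time_intensity_sets[OF sets(1)] time_intensity_sets[OF that])
    then show ?thesis unfolding time_intensity_def by (rule L.emeasure_pair_measure_alt)
  qed
  have "?s \<in> borel_measurable N"
    using B unfolding time_intensity_def by (rule L.measurable_emeasure_Pair)
  then have "(\<integral>\<^sup>+ z. ?s z \<partial>N) = (\<integral>\<^sup>+ z. ?s z \<partial>N1) + (\<integral>\<^sup>+ z. ?s z \<partial>N2)"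
    using sets add by (intro nn_integral_superposition) auto
  then show ?thesis by (simp add: e sets)
qed

lemma truncated_levy_integral_superposition:
  fixes g :: "real \<Rightarrow> real^'d^'d" and N N1 N2 :: "(real^'d) measure"
  assumes \<T>: "\<T> \<in> sets borel"
    and sets: "sets N = sets punctured_borel" "sets N1 = sets punctured_borel" "sets N2 = sets punctured_borel"
    and add: "\<And>B. B \<in> sets punctured_borel \<Longrightarrow> emeasure N B = emeasure N1 B + emeasure N2 B"
    and Q: "sets (Q \<omega>) = sets (time_intensity N \<T>)" "sets (Q1 \<omega>) = sets (time_intensity N1 \<T>)"
      "sets (Q2 \<omega>) = sets (time_intensity N2 \<T>)"
    and addQ: "\<And>B. B \<in> sets (time_intensity N \<T>) \<Longrightarrow> emeasure (Q \<omega>) B = emeasure (Q1 \<omega>) B + emeasure (Q2 \<omega>) B"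
    and i: "set_integrable (Q \<omega>) ({z. \<epsilon> < norm z} \<times> E) (\<lambda>(z, s). g s *v z)"
      "set_integrable (time_intensity N \<T>) ({z. \<epsilon> < norm z \<and> norm z \<le> 1} \<times> E) (\<lambda>(z, s). g s *v z)"
  shows "truncated_levy_integral \<T> Q N g \<epsilon> E \<omega> =
    truncated_levy_integral \<T> Q1 N1 g \<epsilon> E \<omega> + truncated_levy_integral \<T> Q2 N2 g \<epsilon> E \<omega>"
proof -
  have s: "sets (time_intensity N1 \<T>) = sets (time_intensity N \<T>)" "sets (time_intensity N2 \<T>) = sets (time_intensity N \<T>)"
    by (simp_all add: time_intensity_sets sets)
  have 1: "integral\<^sup>L (Q \<omega>) h = integral\<^sup>L (Q1 \<omega>) h + integral\<^sup>L (Q2 \<omega>) h" if "integrable (Q \<omega>) h" for h :: "_ \<Rightarrow> real^'d"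
    by (rule integral_superposition(3)[OF _ _ _ that]) (auto simp: Q s addQ)
  have 2: "integral\<^sup>L (time_intensity N \<T>) h = integral\<^sup>L (time_intensity N1 \<T>) h + integral\<^sup>L (time_intensity N2 \<T>) h"
    if "integrable (time_intensity N \<T>) h" for h :: "_ \<Rightarrow> real^'d"
    by (rule integral_superposition(3)[OF s time_intensity_superposition[OF \<T> sets add] that])
  show ?thesis
    unfolding truncated_levy_integral_def set_lebesgue_integral_def
    using 1[OF i(1)[unfolded set_integrable_def]] 2[OF i(2)[unfolded set_integrable_def]] by simp
qed

section \<open>Passage to the limit\<close>

text \<open>
  Otherwise bad pairs \<open>(n, j)\<close> could be picked so that both indices increase strictly, and the
  corresponding time windows and cutoffs would be a sequence along which the definition of the integral
  demands convergence.
\<close>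

lemma levy_integral_net:
  fixes g :: "real \<Rightarrow> real^'d^'d"
  assumes Z: "levy_integral M \<T> Q N \<T> g Z"
    and Tn: "incseq Tn" "(\<Union>n. Tn n) = \<T>" "\<And>n. Tn n \<in> sets borel" "\<And>n. emeasure lborel (Tn n) < \<infinity>"
    and e: "0 < e" and \<eta>: "0 < \<eta>"
  shows "\<exists>n0. \<forall>n\<ge>n0. \<forall>j\<ge>n0.
    measure M {\<omega>\<in>space M. dist (truncated_levy_integral \<T> Q N g (cutoff j) (Tn n) \<omega>) (Z \<omega>) > e} < \<eta>"
proof (rule ccontr)
  let ?P = "\<lambda>n j. measure M {\<omega>\<in>space M. dist (truncated_levy_integral \<T> Q N g (cutoff j) (Tn n) \<omega>) (Z \<omega>) > e}"
  assume "\<not> (\<exists>n0. \<forall>n\<ge>n0. \<forall>j\<ge>n0. ?P n j < \<eta>)"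
  then have "\<forall>k. \<exists>n j. k \<le> n \<and> k \<le> j \<and> \<eta> \<le> ?P n j" by (meson not_less)
  from choice[OF this] obtain n where "\<forall>k. \<exists>j. k \<le> n k \<and> k \<le> j \<and> \<eta> \<le> ?P (n k) j" ..
  from choice[OF this] obtain j where "\<forall>k. k \<le> n k \<and> k \<le> j k \<and> \<eta> \<le> ?P (n k) (j k)" ..
  then have nj: "\<And>k. k \<le> n k" "\<And>k. k \<le> j k" "\<And>k. \<eta> \<le> ?P (n k) (j k)" by auto
  define q where "q = rec_nat 0 (\<lambda>_ x. Suc (max (n x) (j x)))"
  have q: "q (Suc k) = Suc (max (n (q k)) (j (q k)))" for k by (simp add: q_def)
  have sn: "strict_mono (\<lambda>k. n (q k))"
    using nj(1)[of "q (Suc _)"] by (intro strict_monoI_Suc) (auto simp: q intro: less_le_trans[OF _ nj(1)])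
  have sj: "strict_mono (\<lambda>k. j (q k))"
    by (intro strict_monoI_Suc) (auto simp: q intro: less_le_trans[OF _ nj(2)])
  have "(\<lambda>k. ?P (n (q k)) (j (q k))) \<longlonglongrightarrow> 0"
  proof -
    have "incseq (\<lambda>k. Tn (n (q k)))"
      using incseqD[OF Tn(1)] strict_mono_mono[OF sn] by (auto simp: incseq_def mono_def)
    moreover have "(\<Union>k. Tn (n (q k))) = \<T>"
    proof
      show "(\<Union>k. Tn (n (q k))) \<subseteq> \<T>" using Tn(2) by auto
      show "\<T> \<subseteq> (\<Union>k. Tn (n (q k)))"
        using Tn(2) incseqD[OF Tn(1) seq_suble[OF sn]] by fastforce
    qed
    moreover have "decseq (\<lambda>k. cutoff (j (q k)))"
      using decseq_cutoff strict_mono_mono[OF sj] by (auto simp: decseq_def mono_def)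
    moreover have "(\<lambda>k. cutoff (j (q k))) \<longlonglongrightarrow> 0"
      using LIMSEQ_subseq_LIMSEQ[OF LIMSEQ_inverse_real_of_nat sj] by (simp add: comp_def)
    ultimately show ?thesis
      using levy_integralD(2)[OF Z, of "\<lambda>k. Tn (n (q k))" "\<lambda>k. cutoff (j (q k))"] Tn(3,4) e by simp
  qed
  from order_tendstoD(2)[OF this \<eta>] show False
    using nj(3) by (auto simp: eventually_sequentially not_less[symmetric])
qed

lemma (in prob_space) levy_integral_tail_le:
  fixes g :: "real \<Rightarrow> real^'d^'d" and N :: "(real^'d) measure"
  assumes N: "sets N = sets punctured_borel" and g: "g \<in> borel_measurable (restrict_space borel \<T>)"
    and Q: "poisson_random_measure M Q (time_intensity N \<T>)"
    and Z: "levy_integral M \<T> Q N A g Z"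
    and E: "\<And>j. E j \<in> sets borel" "\<And>j. emeasure lborel (E j) < \<infinity>" "incseq E" "(\<Union>j. E j) = A"
    and e: "0 < e"
    and tail: "eventually (\<lambda>j. prob {\<omega>\<in>space M. e / 2 < norm (truncated_levy_integral \<T> Q N g (cutoff j) (E j) \<omega>)} \<le> \<eta>) sequentially"
  shows "prob {\<omega>\<in>space M. e < norm (Z \<omega>)} \<le> \<eta>"
proof -
  let ?I = "\<lambda>j. truncated_levy_integral \<T> Q N g (cutoff j) (E j)"
  let ?D = "\<lambda>j. {\<omega>\<in>space M. dist (?I j \<omega>) (Z \<omega>) > e / 2}" and ?B = "\<lambda>j. {\<omega>\<in>space M. e / 2 < norm (?I j \<omega>)}"
  have [measurable]: "Z \<in> borel_measurable M" by (rule levy_integralD(1)[OF Z])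
  have [measurable]: "?I j \<in> borel_measurable M" for j
    by (rule truncated_levy_integral_measurable[OF N g Q E(1)])
  have "(\<lambda>j. prob (?D j)) \<longlonglongrightarrow> 0"
    by (rule levy_integralD(2)[OF Z E _ decseq_cutoff LIMSEQ_inverse_real_of_nat,
          THEN conjunct2, THEN conjunct2, rule_format]) (use e in simp_all)
  then have "(\<lambda>j. prob (?D j) + \<eta>) \<longlonglongrightarrow> 0 + \<eta>" by (intro tendsto_intros)
  moreover have "eventually (\<lambda>j. prob {\<omega>\<in>space M. e < norm (Z \<omega>)} \<le> prob (?D j) + \<eta>) sequentially"
    using tail
  proof eventually_elim
    case (elim j)
    have "{\<omega>\<in>space M. e < norm (Z \<omega>)} \<subseteq> ?D j \<union> ?B j"
    proof safe
      fix \<omega> assume w: "e < norm (Z \<omega>)" "\<not> e / 2 < norm (?I j \<omega>)"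
      have "norm (Z \<omega>) \<le> dist (?I j \<omega>) (Z \<omega>) + norm (?I j \<omega>)"
        using norm_triangle_ineq4[of "?I j \<omega>" "?I j \<omega> - Z \<omega>"] by (simp add: dist_norm)
      with w show "e / 2 < dist (?I j \<omega>) (Z \<omega>)" by linarith
    qed
    then have "prob {\<omega>\<in>space M. e < norm (Z \<omega>)} \<le> prob (?D j \<union> ?B j)"
      by (intro finite_measure_mono) measurable
    also have "\<dots> \<le> prob (?D j) + prob (?B j)" by (intro measure_Un_le) measurable
    finally show ?case using elim by linarith
  qed
  ultimately show ?thesis by (intro tendsto_lowerbound[of _ "0 + \<eta>" sequentially, simplified]) auto
qed

text \<open>
  The bound does not depend on the cutoff and the time set, since neither does the second moment of the
  compensated part, and since the drift over any time set is at most \<open>\<integral>\<parallel>g(s) c\<^sub>m\<parallel> ds\<close>. The integrals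
  \<open>Z m\<close> enter only through their existence, which makes that last integral finite.
\<close>

lemma (in prob_space) residual_tail_uniform:
  fixes g :: "real \<Rightarrow> real^'d^'d" and N :: "nat \<Rightarrow> (real^'d) measure"
  assumes \<T>: "\<T> \<in> sets borel" and N: "\<And>m. sets (N m) = sets punctured_borel"
    and m2: "(\<lambda>m. \<integral>\<^sup>+ z. ennreal ((norm z)\<^sup>2) \<partial>N m) \<longlonglongrightarrow> 0"
    and g: "g \<in> borel_measurable (restrict_space borel \<T>)"
    and gL2: "(\<integral>\<^sup>+ s. ennreal ((norm (g s))\<^sup>2) \<partial>restrict_space lborel \<T>) < \<infinity>"
    and Q: "\<And>m. poisson_random_measure M (Q m) (time_intensity (N m) \<T>)"
    and Z: "\<And>m. levy_integral M \<T> (Q m) (N m) \<T> g (Z m)"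
    and Tn: "incseq Tn" "(\<Union>n. Tn n) = \<T>" "\<And>n. Tn n \<in> sets borel" "\<And>n. emeasure lborel (Tn n) < \<infinity>"
    and e: "0 < e" and \<eta>: "0 < \<eta>"
  shows "\<exists>m0. \<forall>m\<ge>m0. \<forall>j E. E \<in> sets borel \<longrightarrow> emeasure lborel E < \<infinity> \<longrightarrow>
    prob {\<omega>\<in>space M. e < norm (truncated_levy_integral \<T> (Q m) (N m) g (cutoff j) E \<omega>)} < \<eta>"
proof -
  let ?c2 = "\<lambda>m. \<integral>\<^sup>+ z. ennreal ((norm z)\<^sup>2) \<partial>N m"
  let ?F = "\<integral>\<^sup>+ s. ennreal ((norm (g s))\<^sup>2) \<partial>restrict_space lborel \<T>"
  let ?c = "\<lambda>m. \<integral> z. indicator {z. 1 < norm z} z *\<^sub>R z \<partial>N m"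
  let ?p = "\<lambda>m. \<integral> s. norm (g s *v ?c m) \<partial>restrict_space lborel \<T>"
  let ?K = "\<lambda>m. real CARD('d) * enn2real (?c2 m * ?F) / (e / 2)\<^sup>2"
  have "eventually (\<lambda>m. ?c2 m < \<infinity>) sequentially" using order_tendstoD(2)[OF m2, of \<infinity>] by simp
  then have noise: "eventually (\<lambda>m. square_integrable_noise M \<T> (N m) (Q m) g) sequentially"
  proof eventually_elim
    case (elim m)
    then show ?case
      by (intro square_integrable_noise.intro prob_space_axioms square_integrable_noise_axioms.intro \<T> N g gL2 Q)
  qed
  have c2: "(\<lambda>m. enn2real (?c2 m)) \<longlonglongrightarrow> 0"
    using m2 by (intro tendsto_enn2real) simp_all
  have "?c \<longlonglongrightarrow> 0"
  proof (rule Lim_null_comparison[OF _ c2])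
    show "eventually (\<lambda>m. norm (?c m) \<le> enn2real (?c2 m)) sequentially"
      using noise
    proof eventually_elim
      case (elim m)
      interpret R: square_integrable_noise M \<T> "N m" "Q m" g by fact
      show ?case using R.norm_big_jump_mean_le unfolding R.big_jump_mean_def .
    qed
  qed
  moreover have int: "eventually (\<lambda>m. integrable (restrict_space lborel \<T>) (\<lambda>s. g s *v ?c m)) sequentially"
    using noise
  proof eventually_elim
    case (elim m)
    interpret R: square_integrable_noise M \<T> "N m" "Q m" g by fact
    show ?case using R.kernel_mean_integrable[OF Z Tn] unfolding R.big_jump_mean_def .
  qed
  ultimately have p: "?p \<longlonglongrightarrow> 0" by (rule integral_norm_matrix_vector_tendsto_0)
  have "(\<lambda>m. real CARD('d) * (enn2real (?c2 m) * enn2real ?F) / (e / 2)\<^sup>2) \<longlonglongrightarrow> real CARD('d) * (0 * enn2real ?F) / (e / 2)\<^sup>2"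
    using e by (intro tendsto_intros c2) auto
  then have K: "?K \<longlonglongrightarrow> 0" by (simp add: enn2real_mult)
  have "eventually (\<lambda>m. ?p m < e / 2) sequentially" "eventually (\<lambda>m. ?K m < \<eta>) sequentially"
    using order_tendstoD(2)[OF p, of "e / 2"] order_tendstoD(2)[OF K \<eta>] e by auto
  with noise int have "eventually (\<lambda>m. \<forall>j E. E \<in> sets borel \<longrightarrow> emeasure lborel E < \<infinity> \<longrightarrow>
    prob {\<omega>\<in>space M. e < norm (truncated_levy_integral \<T> (Q m) (N m) g (cutoff j) E \<omega>)} < \<eta>) sequentially"
  proof eventually_elim
    case (elim m)
    interpret R: square_integrable_noise M \<T> "N m" "Q m" g by fact
    show ?case
    proof (intro allI impI)
      fix j and E :: "real set" assume E: "E \<in> sets borel" "emeasure lborel E < \<infinity>"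
      have "prob {\<omega>\<in>space M. 2 * (e / 2) < norm (truncated_levy_integral \<T> (Q m) (N m) g (cutoff j) E \<omega>)} \<le> ?K m"
        using elim e unfolding R.big_jump_mean_def[symmetric] R.energy_def[symmetric]
        by (intro R.truncated_tail cutoff_le_1 E) auto
      with elim show "prob {\<omega>\<in>space M. e < norm (truncated_levy_integral \<T> (Q m) (N m) g (cutoff j) E \<omega>)} < \<eta>"
        by simp
    qed
  qed
  then show ?thesis by (auto simp: eventually_sequentially)
qed

theorem proposition3p3:
  fixes M :: "'w measure" and S :: "'u measure"
    and T :: real and \<T> :: "real set"
    and \<nu> :: "(real^'d) measure"
    and H :: "real \<Rightarrow> 'u \<Rightarrow> real^'d" and U :: "'w \<Rightarrow> 'u"
    and f :: "real \<Rightarrow> real \<Rightarrow> real^'d^'d"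
    and L X :: "real \<Rightarrow> 'w \<Rightarrow> real^'d"
    and \<mu> :: "'w \<Rightarrow> ((real^'d) \<times> real) measure"
    and \<mu>m \<mu>r :: "nat \<Rightarrow> 'w \<Rightarrow> ((real^'d) \<times> real) measure"
    and Tn :: "nat \<Rightarrow> real set"
    and Q :: "nat \<Rightarrow> real \<Rightarrow> 'w \<Rightarrow> real^'d"
    and R :: "nat \<Rightarrow> nat \<Rightarrow> real \<Rightarrow> 'w \<Rightarrow> real^'d"
  defines "\<nu>m \<equiv> \<lambda>m::nat. shot_noise_measure M H U {0<..real m}"
    and "\<nu>r \<equiv> \<lambda>m::nat. shot_noise_measure M H U {real m<..}"
  assumes M: "prob_space M"
    and T: "T > 0"
    and \<T>: "is_interval \<T>"
    and \<nu>: "levy_measure \<nu>"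
    and \<nu>_infinite: "emeasure \<nu> (space \<nu>) = \<infinity>"
    and U: "U \<in> M \<rightarrow>\<^sub>M S"
    and H: "(\<lambda>(r, u). H r u) \<in> (restrict_space borel {0<..} \<Otimes>\<^sub>M S) \<rightarrow>\<^sub>M borel"
    and shot_noise: "\<And>B. B \<in> sets punctured_borel \<Longrightarrow>
      emeasure \<nu> B = (\<integral>\<^sup>+ r \<in> {0<..}. emeasure M {\<omega> \<in> space M. H r (U \<omega>) \<in> B} \<partial>lborel)"
    and H_mono: "\<And>u. u \<in> space S \<Longrightarrow> antimono_on {0<..} (\<lambda>r. norm (H r u))"
    and \<nu>m_mass: "\<And>m. emeasure (\<nu>m m) (space (\<nu>m m)) = of_nat m"
    and f: "(\<lambda>(t, s). f t s) \<in> borel_measurable (restrict_space borel ({0..T} \<times> \<T>))"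
    and L: "levy_process M \<T> L" "levy_khintchine M \<T> L \<nu>"
    and \<mu>: "jump_measure_of M \<T> L \<mu>" "poisson_random_measure M \<mu> (time_intensity \<nu> \<T>)"
    and X: "\<And>t. t \<in> {0..T} \<Longrightarrow> levy_integral M \<T> \<mu> \<nu> \<T> (f t) (X t)"
    and split: "\<And>m. AE \<omega> in M. \<forall>B \<in> sets (time_intensity \<nu> \<T>).
      emeasure (\<mu> \<omega>) B = emeasure (\<mu>m m \<omega>) B + emeasure (\<mu>r m \<omega>) B"
    and \<mu>m: "\<And>m. poisson_random_measure M (\<mu>m m) (time_intensity (\<nu>m m) \<T>)"
    and \<mu>r: "\<And>m. poisson_random_measure M (\<mu>r m) (time_intensity (\<nu>r m) \<T>)"
    and indep: "\<And>m. indep_random_measures M (time_intensity \<nu> \<T>) (\<mu>m m) (\<mu>r m)"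
    and Tn: "incseq Tn" "(\<Union>n. Tn n) = \<T>"
      "\<And>n. connected (Tn n)" "\<And>n. openin (top_of_set \<T>) (Tn n)"
      "\<And>n. emeasure lborel (Tn n) < \<infinity>"
    and Q: "\<And>m t. t \<in> {0..T} \<Longrightarrow> levy_integral M \<T> (\<mu>r m) (\<nu>r m) \<T> (f t) (Q m t)"
    and R: "\<And>m n t. t \<in> {0..T} \<Longrightarrow>
      levy_integral M \<T> (\<mu>m m) (\<nu>m m) (\<T> - Tn n) (f t) (R m n t)"
    and a: "\<And>t. t \<in> {0..T} \<Longrightarrow>
      esssup (restrict_space lborel \<T>) (\<lambda>s. ereal (norm (f t s))) < \<infinity>"
    and b: "\<And>t. t \<in> {0..T} \<Longrightarrow> (\<integral>\<^sup>+ s \<in> \<T>. ennreal ((norm (f t s))\<^sup>2) \<partial>lborel) < \<infinity>"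
    and c: "(\<lambda>m::nat. \<integral>\<^sup>+ r \<in> {real m<..}.
      (\<integral>\<^sup>+ \<omega>. ennreal ((norm (H r (U \<omega>)))\<^sup>2) \<partial>M) \<partial>lborel) \<longlonglongrightarrow> 0"
  shows "fdd_converges M {0..T} (\<lambda>(m, n). Q m) (\<lambda>t \<omega>. 0) (filtercomap (\<lambda>(m, n). min m n) at_top)
    \<and> fdd_converges M {0..T} (\<lambda>(m, n). R m n) (\<lambda>t \<omega>. 0) (filtercomap (\<lambda>(m, n). min m n) at_top)"
proof -
  interpret prob_space M by (rule M)
  have Tb: "Tn n \<in> sets borel" for n
    by (intro real_interval_borel_measurable) (simp add: is_interval_connected_1 Tn(3))
  have \<T>b: "\<T> \<in> sets borel" by (rule real_interval_borel_measurable[OF \<T>])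
  note Tn' = Tn(1,2) Tb Tn(5)
  have s: "sets \<nu> = sets punctured_borel" "sets (\<nu>m m) = sets punctured_borel" "sets (\<nu>r m) = sets punctured_borel" for m
    using \<nu> by (simp_all add: levy_measure_def \<nu>m_def \<nu>r_def sets_shot_noise_measure)
  have add: "emeasure \<nu> B = emeasure (\<nu>m m) B + emeasure (\<nu>r m) B" if B: "B \<in> sets punctured_borel" for B m
  proof -
    have "emeasure \<nu> B = emeasure (shot_noise_measure M H U {0<..}) B"
      using shot_noise[OF B] emeasure_shot_noise_measure[OF M U H _ _ B, of "{0<..}"] by simp
    also have "{0<..} = {0<..real m} \<union> {real m<..}" by auto
    also have "emeasure (shot_noise_measure M H U ({0<..real m} \<union> {real m<..})) B = emeasure (\<nu>m m) B + emeasure (\<nu>r m) B"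
      unfolding \<nu>m_def \<nu>r_def by (rule emeasure_shot_noise_measure_Un[OF M U H _ _ _ _ _ B]) auto
    finally show ?thesis .
  qed
  have m2: "(\<lambda>m. \<integral>\<^sup>+ z. ennreal ((norm z)\<^sup>2) \<partial>\<nu>r m) \<longlonglongrightarrow> 0"
  proof -
    have "(\<integral>\<^sup>+ z. ennreal ((norm z)\<^sup>2) \<partial>\<nu>r m) =
        (\<integral>\<^sup>+ r \<in> {real m<..}. (\<integral>\<^sup>+ \<omega>. ennreal ((norm (H r (U \<omega>)))\<^sup>2) * indicator (- {0}) (H r (U \<omega>)) \<partial>M) \<partial>lborel)" for m
      unfolding \<nu>r_def by (rule nn_integral_shot_noise_measure[OF M U H]) auto
    moreover have "ennreal ((norm z)\<^sup>2) * indicator (- {0}) z = ennreal ((norm z)\<^sup>2)" for z :: "real^'d"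
      by (cases "z = 0") auto
    ultimately show ?thesis using c by simp
  qed
  have ft: "f t \<in> borel_measurable (restrict_space borel \<T>)" if t: "t \<in> {0..T}" for t
  proof -
    have "(\<lambda>s. (t, s)) \<in> restrict_space borel \<T> \<rightarrow>\<^sub>M restrict_space borel ({0..T} \<times> \<T>)"
      using t by (intro measurable_restrict_space2 measurable_restrict_space1) (auto simp: space_restrict_space)
    from measurable_compose[OF this f] show ?thesis by simp
  qed
  have fL2: "(\<integral>\<^sup>+ s. ennreal ((norm (f t s))\<^sup>2) \<partial>restrict_space lborel \<T>) < \<infinity>" if t: "t \<in> {0..T}" for t
    using b[OF t] \<T>b by (subst nn_integral_restrict_space) auto
  have residual: "\<exists>m0. \<forall>m\<ge>m0. \<forall>j E. E \<in> sets borel \<longrightarrow> emeasure lborel E < \<infinity> \<longrightarrow>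
      prob {\<omega>\<in>space M. e < norm (truncated_levy_integral \<T> (\<mu>r m) (\<nu>r m) (f t) (cutoff j) E \<omega>)} < \<eta>"
    if t: "t \<in> {0..T}" and "0 < e" "0 < \<eta>" for t e \<eta>
    by (rule residual_tail_uniform[OF \<T>b s(3) m2 ft[OF t] fL2[OF t] \<mu>r Q[OF t] Tn' that(2,3)])
  have Qt: "\<exists>m0. \<forall>m\<ge>m0. prob {\<omega>\<in>space M. e < norm (Q m t \<omega>)} \<le> \<eta>"
    if t: "t \<in> {0..T}" and e: "0 < e" and \<eta>: "0 < \<eta>" for t e \<eta>
  proof -
    from residual[OF t _ \<eta>, of "e / 2"] e obtain m0 where m0:
      "\<And>m j E. m0 \<le> m \<Longrightarrow> E \<in> sets borel \<Longrightarrow> emeasure lborel E < \<infinity> \<Longrightarrow>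
      prob {\<omega>\<in>space M. e / 2 < norm (truncated_levy_integral \<T> (\<mu>r m) (\<nu>r m) (f t) (cutoff j) E \<omega>)} < \<eta>"
      by auto
    show ?thesis
    proof (intro exI allI impI)
      fix m assume m: "m0 \<le> m"
      show "prob {\<omega>\<in>space M. e < norm (Q m t \<omega>)} \<le> \<eta>"
        by (rule levy_integral_tail_le[OF s(3) ft[OF t] \<mu>r Q[OF t] Tb Tn(5,1,2) e])
           (intro always_eventually allI less_imp_le m0 m Tb Tn(5))
    qed
  qed
  have Rt: "\<exists>k0. \<forall>m\<ge>k0. \<forall>n\<ge>k0. prob {\<omega>\<in>space M. e < norm (R m n t \<omega>)} \<le> \<eta>"
    if t: "t \<in> {0..T}" and e: "0 < e" and \<eta>: "0 < \<eta>" for t e \<eta>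
  proof -
    let ?I = "\<lambda>j E. truncated_levy_integral \<T> \<mu> \<nu> (f t) (cutoff j) E"
    let ?Im = "\<lambda>m j E. truncated_levy_integral \<T> (\<mu>m m) (\<nu>m m) (f t) (cutoff j) E"
    let ?Ir = "\<lambda>m j E. truncated_levy_integral \<T> (\<mu>r m) (\<nu>r m) (f t) (cutoff j) E"
    from residual[OF t, of "e / 6" "\<eta> / 3"] e \<eta> obtain m0 where m0:
      "\<And>m j E. m0 \<le> m \<Longrightarrow> E \<in> sets borel \<Longrightarrow> emeasure lborel E < \<infinity> \<Longrightarrow>
        prob {\<omega>\<in>space M. e / 6 < norm (?Ir m j E \<omega>)} < \<eta> / 3"
      by auto
    from levy_integral_net[OF X[OF t] Tn', of "e / 6" "\<eta> / 3"] e \<eta> obtain n0 where n0: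
      "\<And>n j. n0 \<le> n \<Longrightarrow> n0 \<le> j \<Longrightarrow> prob {\<omega>\<in>space M. dist (?I j (Tn n) \<omega>) (X t \<omega>) > e / 6} < \<eta> / 3"
      by auto
    have X_int: "\<forall>j. AE \<omega> in M. set_integrable (\<mu> \<omega>) ({z. cutoff j < norm z} \<times> Tn j) (\<lambda>(z, s). f t s *v z)"
      "\<forall>j. set_integrable (time_intensity \<nu> \<T>) ({z. cutoff j < norm z \<and> norm z \<le> 1} \<times> Tn j) (\<lambda>(z, s). f t s *v z)"
      using levy_integralD(2)[OF X[OF t], of Tn cutoff] Tn' decseq_cutoff LIMSEQ_inverse_real_of_nat by auto
    have Xm[measurable]: "X t \<in> borel_measurable M" by (rule levy_integralD(1)[OF X[OF t]])
    have Im[measurable]: "?I j E \<in> borel_measurable M" if "E \<in> sets borel" for j E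
      by (rule truncated_levy_integral_measurable[OF s(1) ft[OF t] \<mu>(2) that])
    have Irm[measurable]: "?Ir m j E \<in> borel_measurable M" if "E \<in> sets borel" for m j E
      by (rule truncated_levy_integral_measurable[OF s(3) ft[OF t] \<mu>r that])
    show ?thesis
    proof (intro exI allI impI)
      fix m n assume m: "max m0 n0 \<le> m" and n: "max m0 n0 \<le> n"
      let ?E = "\<lambda>j. Tn j - Tn n"
      have E: "?E j \<in> sets borel" "emeasure lborel (?E j) < \<infinity>" for j
        using Tb emeasure_mono[of "?E j" "Tn j" lborel] Tn(5)[of j] by (auto intro: le_less_trans)
      \<comment> \<open>the integral against \<open>\<mu>m m\<close> is an increment of truncated versions of \<open>X t\<close> minus the residual
        integral; three thresholds \<open>e / 6\<close> add up to \<open>e / 2\<close>\<close>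
      have "prob {\<omega>\<in>space M. e / 2 < norm (?Im m j (?E j) \<omega>)} \<le> \<eta>" if j: "n \<le> j" for j
      proof -
        let ?A = "{\<omega>\<in>space M. dist (?I j (Tn j) \<omega>) (X t \<omega>) > e / 6}"
          and ?B = "{\<omega>\<in>space M. dist (?I j (Tn n) \<omega>) (X t \<omega>) > e / 6}"
          and ?C = "{\<omega>\<in>space M. e / 6 < norm (?Ir m j (?E j) \<omega>)}"
        have ABC[measurable]: "?A \<in> sets M" "?B \<in> sets M" "?C \<in> sets M"
          using Im[OF Tb, of j j] Im[OF Tb, of j n] Irm[OF E(1), of m j j] by measurable
        have "AE \<omega> in M. \<omega> \<in> {\<omega>\<in>space M. e / 2 < norm (?Im m j (?E j) \<omega>)} \<longrightarrow> \<omega> \<in> ?A \<union> ?B \<union> ?C"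
          using X_int(1)[rule_format, of j] split[of m] AE_space
        proof eventually_elim
          case (elim \<omega>)
          note D = truncated_levy_integral_diff[where Q = \<mu> and \<omega> = \<omega> and \<epsilon> = "cutoff j", OF s(1) ft[OF t] poisson_random_measureD(1)[OF \<mu>(2) elim(3)]
              Tb[of n] Tb[of j] incseqD[OF Tn(1) j] _ _ elim(1) X_int(2)[rule_format]]
          have sub: "Tn j \<subseteq> \<T>" using Tn(2) by auto
          have "?I j (?E j) \<omega> = ?Im m j (?E j) \<omega> + ?Ir m j (?E j) \<omega>"
          proof (rule truncated_levy_integral_superposition[OF \<T>b s(1) s(2) s(3) add])
            show "sets (\<mu> \<omega>) = sets (time_intensity \<nu> \<T>)" "sets (\<mu>m m \<omega>) = sets (time_intensity (\<nu>m m) \<T>)"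
              "sets (\<mu>r m \<omega>) = sets (time_intensity (\<nu>r m) \<T>)"
              using poisson_random_measureD(1)[OF \<mu>(2)] poisson_random_measureD(1)[OF \<mu>m]
                poisson_random_measureD(1)[OF \<mu>r] elim(3) by auto
          qed (use elim(2) D(1,2) sub in auto)
          then have "?Im m j (?E j) \<omega> = ?I j (?E j) \<omega> - ?Ir m j (?E j) \<omega>" by simp
          also have "\<dots> = (?I j (Tn j) \<omega> - X t \<omega>) - (?I j (Tn n) \<omega> - X t \<omega>) - ?Ir m j (?E j) \<omega>"
            using D(3) sub by simp
          also have "norm \<dots> \<le> norm (?I j (Tn j) \<omega> - X t \<omega>) + norm (?I j (Tn n) \<omega> - X t \<omega>) + norm (?Ir m j (?E j) \<omega>)"
            by (intro order_trans[OF norm_triangle_ineq4] add_right_mono norm_triangle_ineq4)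
          finally have "norm (?Im m j (?E j) \<omega>) \<le> dist (?I j (Tn j) \<omega>) (X t \<omega>) + dist (?I j (Tn n) \<omega>) (X t \<omega>) + norm (?Ir m j (?E j) \<omega>)"
            by (simp only: dist_norm)
          then have "e / 2 < norm (?Im m j (?E j) \<omega>) \<Longrightarrow> e / 6 < dist (?I j (Tn j) \<omega>) (X t \<omega>) \<or>
              e / 6 < dist (?I j (Tn n) \<omega>) (X t \<omega>) \<or> e / 6 < norm (?Ir m j (?E j) \<omega>)"
            by linarith
          then show ?case by blast
        qed
        then have "prob {\<omega>\<in>space M. e / 2 < norm (?Im m j (?E j) \<omega>)} \<le> prob (?A \<union> ?B \<union> ?C)"
          by (rule finite_measure_mono_AE) (intro sets.Un ABC)
        also have "\<dots> \<le> prob (?A \<union> ?B) + prob ?C" by (intro measure_Un_le sets.Un ABC)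
        also have "\<dots> \<le> prob ?A + prob ?B + prob ?C" by (intro add_right_mono measure_Un_le ABC)
        also have "\<dots> \<le> \<eta>"
        proof -
          have le: "n0 \<le> j" "n0 \<le> n" "m0 \<le> m" using m n j by auto
          have "prob ?A < \<eta> / 3" by (rule n0[OF le(1,1)])
          moreover have "prob ?B < \<eta> / 3" by (rule n0[OF le(2,1)])
          moreover have "prob ?C < \<eta> / 3" by (rule m0[OF le(3) E])
          ultimately show ?thesis by linarith
        qed
        finally show ?thesis .
      qed
      then have "eventually (\<lambda>j. prob {\<omega>\<in>space M. e / 2 < norm (?Im m j (?E j) \<omega>)} \<le> \<eta>) sequentially"
        by (auto simp: eventually_sequentially)
      moreover have "incseq ?E" using Tn(1) by (auto simp: incseq_def)
      moreover have "(\<Union>j. ?E j) = \<T> - Tn n" using Tn(2) by auto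
      ultimately show "prob {\<omega>\<in>space M. e < norm (R m n t \<omega>)} \<le> \<eta>"
        by (intro levy_integral_tail_le[OF s(2) ft[OF t] \<mu>m R[OF t] E _ _ e])
    qed
  qed
  let ?F = "filtercomap (\<lambda>(m, n). min m n) at_top :: (nat \<times> nat) filter"
  have F: "eventually P ?F" if "\<forall>m\<ge>k. \<forall>n\<ge>k. P (m, n)" for P and k :: nat
    unfolding eventually_filtercomap_at_top_linorder using that by (intro exI[of _ k]) auto
  have conv: "((\<lambda>(m, n). p m n) \<longlongrightarrow> 0) ?F"
    if p: "\<And>\<eta>. 0 < \<eta> \<Longrightarrow> \<exists>k. \<forall>m\<ge>k. \<forall>n\<ge>k. p m n \<le> \<eta>" "\<And>m n. 0 \<le> p m n" for p :: "nat \<Rightarrow> nat \<Rightarrow> real"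
  proof (rule tendstoI)
    fix \<eta> :: real assume "0 < \<eta>"
    then obtain k where k: "\<forall>m\<ge>k. \<forall>n\<ge>k. p m n \<le> \<eta> / 2" using p(1)[of "\<eta> / 2"] by auto
    show "eventually (\<lambda>x. dist (case x of (m, n) \<Rightarrow> p m n) 0 < \<eta>) ?F"
    proof (intro F[of k] allI impI)
      fix m n assume "k \<le> m" "k \<le> n"
      then have "p m n \<le> \<eta> / 2" using k by blast
      with p(2)[of m n] \<open>0 < \<eta>\<close> show "dist (case (m, n) of (m, n) \<Rightarrow> p m n) 0 < \<eta>" by simp
    qed
  qed
  show ?thesis
  proof
    show "fdd_converges M {0..T} (\<lambda>(m, n). Q m) (\<lambda>t \<omega>. 0) ?F"
    proof (rule fdd_converges_zeroI)
      show "(case i of (m, n) \<Rightarrow> Q m) t \<in> borel_measurable M" if "t \<in> {0..T}" for i t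
        using levy_integralD(1)[OF Q[OF that]] by (cases i) simp
      show "((\<lambda>i. prob {\<omega>\<in>space M. e < norm ((case i of (m, n) \<Rightarrow> Q m) t \<omega>)}) \<longlongrightarrow> 0) ?F"
        if "t \<in> {0..T}" "0 < e" for t e
      proof -
        have "((\<lambda>(m, n). prob {\<omega>\<in>space M. e < norm (Q m t \<omega>)}) \<longlongrightarrow> 0) ?F"
        proof (rule conv)
          show "\<exists>k. \<forall>m\<ge>k. \<forall>n\<ge>k. prob {\<omega>\<in>space M. e < norm (Q m t \<omega>)} \<le> \<eta>" if "0 < \<eta>" for \<eta>
            using Qt[OF \<open>t \<in> {0..T}\<close> \<open>0 < e\<close> that] by blast
        qed simp
        then show ?thesis by (simp add: case_prod_unfold)
      qed
    qed
    show "fdd_converges M {0..T} (\<lambda>(m, n). R m n) (\<lambda>t \<omega>. 0) ?F"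
    proof (rule fdd_converges_zeroI)
      show "(case i of (m, n) \<Rightarrow> R m n) t \<in> borel_measurable M" if "t \<in> {0..T}" for i t
        using levy_integralD(1)[OF R[OF that]] by (cases i) simp
      show "((\<lambda>i. prob {\<omega>\<in>space M. e < norm ((case i of (m, n) \<Rightarrow> R m n) t \<omega>)}) \<longlongrightarrow> 0) ?F"
        if "t \<in> {0..T}" "0 < e" for t e
      proof -
        have "((\<lambda>(m, n). prob {\<omega>\<in>space M. e < norm (R m n t \<omega>)}) \<longlongrightarrow> 0) ?F"
        proof (rule conv)
          show "\<exists>k. \<forall>m\<ge>k. \<forall>n\<ge>k. prob {\<omega>\<in>space M. e < norm (R m n t \<omega>)} \<le> \<eta>" if "0 < \<eta>" for \<eta>
            using Rt[OF \<open>t \<in> {0..T}\<close> \<open>0 < e\<close> that] by blast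
        qed simp
        then show ?thesis by (simp add: case_prod_unfold)
      qed
    qed
  qed
qed

end
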